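(* Let $G$ be a second countable infinite locally compact abelian group with dual group $\widehat{G}$, let $\Lambda\subset G$ and $\Gamma\subset\widehat{G}$ be countable uniform lattices, and let $\mathcal{S}_{\Lambda}$ and $\mathcal{S}_{\Gamma^{\perp}}$ be Borel measurable sections of $G/\Lambda$ and $G/\Gamma^{\perp}$ respectively. Suppose there exist a finite number $k$ of elements $\alpha_1,\dots,\alpha_k\in\Gamma^{\perp}$ such that $$\bigcup_{i=1}^k \big((\alpha_i+\mathcal{S}_{\Gamma^{\perp}})\cap\mathcal{S}_{\Lambda}\big)=\mathcal{S}_{\Lambda}.$$ Let $f\in L^2(G)$. If the Gabor system $\{E_{\gamma}\mathcal{T}_{\lambda}f\}_{(\lambda,\gamma)\in\Lambda\times\Gamma}$ is a complete Bessel sequence in $L^2(G)$, then $d(\Lambda\times\Gamma)\leq 1$.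
   Context: Groups are written additively. $\widehat{G}$ is the group of continuous characters of $G$. $\mu_G$ and $\mu_{\widehat{G}}$ denote Haar measures on $G$ and $\widehat{G}$, normalized to be dual to each other (so that the Plancherel theorem holds). A uniform lattice is a discrete co-compact subgroup. For $u\in G$ and $\xi\in\widehat{G}$, the operators on $L^2(G)$ are $\mathcal{T}_u f(x)=f(x-u)$ (translation) and $E_{\xi}f(x)=\xi(x)f(x)$ (modulation). The annihilator of $\Gamma$ is $\Gamma^{\perp}=\{x\in G:\gamma(x)=1\ \forall\gamma\in\Gamma\}$, which is a uniform lattice in $G$. A Borel measurable section $\mathcal{S}_H$ of a quotient $K/H$ is a Borel subset of $K$ containing exactly one element of each coset of $H$; $\mathcal{S}_{\Gamma}$ denotes one for $\widehat{G}/\Gamma$. The size of the lattice is $d(\Lambda\times\Gamma):=\mu_G(\mathcal{S}_{\Lambda})\,\mu_{\widehat{G}}(\mathcal{S}_{\Gamma})$ (independent of the choice of sections). A family $\{f_i\}_{i\in I}$ ($I$ countable) in a Hilbert space $\mathcal{H}$ is a Bessel sequence if there is $B>0$ with $\sum_i|\langle g,f_i\rangle|^2\le B\|g\|^2$ for all $g\in\mathcal{H}$; it is complete if its linear span is dense in $\mathcal{H}$. *)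

theory Defs
  imports "HOL-Analysis.Analysis"
begin

section \<open>The dual group\<close>

typedef (overloaded) ('a::topological_ab_group_add) dual =
  "{\<xi> :: 'a \<Rightarrow> complex. continuous_on UNIV \<xi> \<and> (\<forall>x. cmod (\<xi> x) = 1) \<and>
      (\<forall>x y. \<xi> (x + y) = \<xi> x * \<xi> y)}"
  morphisms eval_char Abs_dual
  by (rule exI[of _ "\<lambda>_. 1"]) auto

lemma eval_char_add_arg: "eval_char \<xi> (x + y) = eval_char \<xi> x * eval_char \<xi> y"
  using eval_char[of \<xi>] by auto

lemma norm_eval_char [simp]: "cmod (eval_char \<xi> x) = 1"
  using eval_char[of \<xi>] by auto

lemma continuous_eval_char: "continuous_on UNIV (eval_char \<xi>)"
  using eval_char[of \<xi>] by auto

instantiation dual :: (topological_ab_group_add) ab_group_add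
begin

definition "0 = Abs_dual (\<lambda>_. 1)"
definition "\<xi> + \<psi> = Abs_dual (\<lambda>x. eval_char \<xi> x * eval_char \<psi> x)"
definition "- \<xi> = Abs_dual (\<lambda>x. cnj (eval_char \<xi> x))"
definition "(\<xi> :: 'a dual) - \<psi> = \<xi> + - \<psi>"

lemma eval_char_zero: "eval_char 0 x = 1"
  unfolding zero_dual_def by (subst Abs_dual_inverse) auto

lemma eval_char_plus: "eval_char (\<xi> + \<psi>) x = eval_char \<xi> x * eval_char \<psi> x"
  unfolding plus_dual_def
  by (subst Abs_dual_inverse)
     (auto intro!: continuous_intros continuous_eval_char simp: norm_mult eval_char_add_arg)

lemma eval_char_uminus: "eval_char (- \<xi>) x = cnj (eval_char \<xi> x)"
  unfolding uminus_dual_def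
  by (subst Abs_dual_inverse)
     (auto intro!: continuous_intros continuous_eval_char simp: eval_char_add_arg)

instance
proof
  fix a b c :: "'a dual"
  show "a + b + c = a + (b + c)"
    by (simp add: eval_char_inject[symmetric] fun_eq_iff eval_char_plus mult.assoc)
  show "a + b = b + a"
    by (simp add: eval_char_inject[symmetric] fun_eq_iff eval_char_plus mult.commute)
  show "0 + a = a"
    by (simp add: eval_char_inject[symmetric] fun_eq_iff eval_char_plus eval_char_zero)
  have "cnj (eval_char a x) * eval_char a x = 1" for x
    by (metis complex_norm_square mult.commute norm_eval_char of_real_1 one_power2)
  then show "- a + a = 0"
    by (simp add: eval_char_inject[symmetric] fun_eq_iff eval_char_plus eval_char_zero
        eval_char_uminus)
  show "a - b = a + - b"
    by (rule minus_dual_def)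
qed

end

text \<open>The topology of uniform convergence on compact sets, i.e. the compact-open topology.\<close>

definition dual_nbhd :: "'a::topological_ab_group_add set \<Rightarrow> real \<Rightarrow> 'a dual \<Rightarrow> 'a dual set" where
  "dual_nbhd K e \<xi> = {\<psi>. \<forall>x\<in>K. dist (eval_char \<psi> x) (eval_char \<xi> x) < e}"

instantiation dual :: (topological_ab_group_add) topological_space
begin

definition
  "open (U :: 'a dual set) \<longleftrightarrow> (\<forall>\<xi>\<in>U. \<exists>K e. compact K \<and> e > 0 \<and> dual_nbhd K e \<xi> \<subseteq> U)"

lemma open_dualD:
  assumes "open (U :: 'a dual set)" "\<xi> \<in> U"
  obtains K e where "compact K" "e > 0" "dual_nbhd K e \<xi> \<subseteq> U"
  using assms unfolding open_dual_def by meson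

instance
proof
  have "compact ({} :: 'a set) \<and> (1::real) > 0 \<and> dual_nbhd {} 1 \<xi> \<subseteq> UNIV" for \<xi> :: "'a dual"
    by simp
  then show "open (UNIV :: 'a dual set)"
    unfolding open_dual_def by meson
next
  fix S T :: "'a dual set"
  assume S: "open S" and T: "open T"
  show "open (S \<inter> T)"
    unfolding open_dual_def
  proof
    fix \<xi> assume \<xi>: "\<xi> \<in> S \<inter> T"
    obtain K e where K: "compact K" "e > 0" "dual_nbhd K e \<xi> \<subseteq> S"
      using open_dualD[OF S] \<xi> by (metis IntD1)
    obtain L d where L: "compact L" "d > 0" "dual_nbhd L d \<xi> \<subseteq> T"
      using open_dualD[OF T] \<xi> by (metis IntD2)
    have "dual_nbhd (K \<union> L) (min e d) \<xi> \<subseteq> dual_nbhd K e \<xi> \<inter> dual_nbhd L d \<xi>"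
      by (auto simp: dual_nbhd_def)
    then have "dual_nbhd (K \<union> L) (min e d) \<xi> \<subseteq> S \<inter> T"
      using K(3) L(3) by (meson Int_mono order_trans)
    moreover have "compact (K \<union> L)" "min e d > 0" using K L by (simp_all add: compact_Un)
    ultimately show "\<exists>K e. compact K \<and> e > 0 \<and> dual_nbhd K e \<xi> \<subseteq> S \<inter> T" by meson
  qed
next
  fix \<K> :: "'a dual set set"
  assume *: "\<forall>S\<in>\<K>. open S"
  show "open (\<Union>\<K>)"
    unfolding open_dual_def
  proof
    fix \<xi> assume "\<xi> \<in> \<Union>\<K>"
    then obtain S where S: "S \<in> \<K>" "\<xi> \<in> S" by (rule UnionE)
    obtain K e where "compact K" "e > 0" "dual_nbhd K e \<xi> \<subseteq> S"
      using open_dualD[of S \<xi>] * S by metis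
    moreover have "S \<subseteq> \<Union>\<K>" using S(1) by (rule Union_upper)
    ultimately show "\<exists>K e. compact K \<and> e > 0 \<and> dual_nbhd K e \<xi> \<subseteq> \<Union>\<K>"
      by (meson order_trans)
  qed
qed

end

lemma open_dual_nbhd:
  assumes "compact K" "e > 0"
  shows "\<exists>U. open U \<and> \<xi> \<in> U \<and> U \<subseteq> dual_nbhd K e \<xi>"
proof (intro exI conjI)
  let ?U = "{\<psi>. \<exists>d<e. \<forall>x\<in>K. dist (eval_char \<psi> x) (eval_char \<xi> x) \<le> d}"
  show "open ?U"
    unfolding open_dual_def
  proof
    fix \<psi> assume "\<psi> \<in> ?U"
    then obtain d where d: "d < e" "\<forall>x\<in>K. dist (eval_char \<psi> x) (eval_char \<xi> x) \<le> d" by auto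
    have "dual_nbhd K ((e - d) / 2) \<psi> \<subseteq> ?U"
    proof
      fix \<phi> assume \<phi>: "\<phi> \<in> dual_nbhd K ((e - d) / 2) \<psi>"
      have "dist (eval_char \<phi> x) (eval_char \<xi> x) \<le> (e + d) / 2" if "x \<in> K" for x
      proof -
        have "dist (eval_char \<phi> x) (eval_char \<psi> x) < (e - d) / 2"
          using \<phi> that by (auto simp: dual_nbhd_def)
        moreover have "dist (eval_char \<psi> x) (eval_char \<xi> x) \<le> d" using d that by auto
        ultimately show ?thesis
          using dist_triangle[of "eval_char \<phi> x" "eval_char \<xi> x" "eval_char \<psi> x"] 
          by (simp add: field_simps)
      qed
      moreover have "(e + d) / 2 < e" using d by simp
      ultimately show "\<phi> \<in> ?U" by blast
    qed
    then show "\<exists>K e. compact K \<and> e > 0 \<and> dual_nbhd K e \<psi> \<subseteq> ?U"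
      using assms d by (intro exI[of _ K] exI[of _ "(e - d) / 2"]) auto
  qed
  show "\<xi> \<in> ?U" using assms by (auto intro!: exI[of _ "0::real"])
  show "?U \<subseteq> dual_nbhd K e \<xi>" unfolding dual_nbhd_def by force
qed

lemma eventually_dual_nbhd:
  assumes "compact K" "e > 0"
  shows "\<forall>\<^sub>F \<psi> in nhds \<xi>. \<psi> \<in> dual_nbhd K e \<xi>"
  using open_dual_nbhd[OF assms, of \<xi>] unfolding eventually_nhds by blast

lemma filterlim_dualI:
  assumes "\<And>K e. compact K \<Longrightarrow> e > 0 \<Longrightarrow> \<forall>\<^sub>F z in F. f z \<in> dual_nbhd K e \<xi>"
  shows "filterlim f (nhds \<xi>) F"
proof (rule topological_tendstoI)
  fix S assume "open S" "\<xi> \<in> S"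
  then obtain K e where "compact K" "e > 0" "dual_nbhd K e \<xi> \<subseteq> S"
    unfolding open_dual_def by blast
  with assms[of K e] show "\<forall>\<^sub>F z in F. f z \<in> S"
    by (auto elim: eventually_mono)
qed

instance dual :: (topological_ab_group_add) topological_ab_group_add
proof
  fix a b :: "'a dual"
  show "LIM x (nhds a \<times>\<^sub>F nhds b). fst x + snd x :> nhds (a + b)"
  proof (rule filterlim_dualI)
    fix K :: "'a set" and e :: real
    assume K: "compact K" and e: "e > 0"
    have "\<forall>\<^sub>F z in nhds a \<times>\<^sub>F nhds b. fst z \<in> dual_nbhd K (e/2) a \<and> snd z \<in> dual_nbhd K (e/2) b"
      using eventually_dual_nbhd[OF K, of "e/2" a] eventually_dual_nbhd[OF K, of "e/2" b] e
      unfolding eventually_prod_filter by auto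
    then show "\<forall>\<^sub>F z in nhds a \<times>\<^sub>F nhds b. fst z + snd z \<in> dual_nbhd K e (a + b)"
    proof (rule eventually_mono, clarify)
      fix \<phi> \<psi> :: "'a dual"
      assume *: "fst (\<phi>, \<psi>) \<in> dual_nbhd K (e/2) a" "snd (\<phi>, \<psi>) \<in> dual_nbhd K (e/2) b"
      have "dist (eval_char (\<phi> + \<psi>) x) (eval_char (a + b) x) < e" if "x \<in> K" for x
      proof -
        have 1: "cmod (eval_char \<phi> x - eval_char a x) < e/2"
          "cmod (eval_char \<psi> x - eval_char b x) < e/2"
          using * that by (auto simp: dual_nbhd_def dist_norm)
        have "cmod (eval_char \<phi> x * eval_char \<psi> x - eval_char a x * eval_char b x)
          = cmod ((eval_char \<phi> x - eval_char a x) * eval_char \<psi> x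
                   + eval_char a x * (eval_char \<psi> x - eval_char b x))"
          by (simp add: algebra_simps)
        also have "\<dots> \<le> cmod (eval_char \<phi> x - eval_char a x) + cmod (eval_char \<psi> x - eval_char b x)"
          by (rule order_trans[OF norm_triangle_ineq]) (simp add: norm_mult)
        finally show ?thesis using 1 by (simp add: dist_norm eval_char_plus)
      qed
      then show "fst (\<phi>, \<psi>) + snd (\<phi>, \<psi>) \<in> dual_nbhd K e (a + b)"
        by (simp add: dual_nbhd_def)
    qed
  qed
  show "(uminus \<longlongrightarrow> - a) (nhds a)"
  proof (rule filterlim_dualI)
    fix K :: "'a set" and e :: real
    assume K: "compact K" and e: "e > 0"
    show "\<forall>\<^sub>F z in nhds a. - z \<in> dual_nbhd K e (- a)"
      using eventually_dual_nbhd[OF K e, of a]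
      by (rule eventually_mono)
         (simp add: dual_nbhd_def eval_char_uminus dist_norm flip: complex_cnj_diff)
  qed
qed

instance dual :: (topological_ab_group_add) t2_space
proof
  fix a b :: "'a dual" assume "a \<noteq> b"
  then obtain x where x: "eval_char a x \<noteq> eval_char b x"
    by (auto simp: eval_char_inject[symmetric] fun_eq_iff)
  define e where "e = dist (eval_char a x) (eval_char b x) / 2"
  have e: "e > 0" using x by (simp add: e_def)
  obtain U V where "open U" "a \<in> U" "U \<subseteq> dual_nbhd {x} e a"
    and "open V" "b \<in> V" "V \<subseteq> dual_nbhd {x} e b"
    using open_dual_nbhd[of "{x}" e] e by (metis compact_sing)
  moreover have "dual_nbhd {x} e a \<inter> dual_nbhd {x} e b = {}"
  proof (rule ccontr)
    assume "\<not> ?thesis"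
    then obtain \<psi> where "dist (eval_char \<psi> x) (eval_char a x) < e"
      "dist (eval_char \<psi> x) (eval_char b x) < e"
      by (auto simp: dual_nbhd_def)
    then show False
      using dist_triangle3[of "eval_char a x" "eval_char b x" "eval_char \<psi> x"] by (simp add: e_def)
  qed
  ultimately show "\<exists>U V. open U \<and> open V \<and> a \<in> U \<and> b \<in> V \<and> U \<inter> V = {}" by blast
qed


section \<open>Subgroups, quotients, uniform lattices\<close>

definition add_subgroup :: "'a::ab_group_add set \<Rightarrow> bool" where
  "add_subgroup H \<longleftrightarrow> 0 \<in> H \<and> (\<forall>x\<in>H. \<forall>y\<in>H. x + y \<in> H) \<and> (\<forall>x\<in>H. - x \<in> H)"

definition add_coset :: "'a::ab_group_add set \<Rightarrow> 'a \<Rightarrow> 'a set" where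
  "add_coset H x = (\<lambda>h. x + h) ` H"

definition quotient_topology ::
    "'a::{topological_space,ab_group_add} set \<Rightarrow> 'a set topology" where
  "quotient_topology H =
     topology (\<lambda>W. W \<subseteq> range (add_coset H) \<and> open {x. add_coset H x \<in> W})"

lemma openin_quotient_topology:
  "openin (quotient_topology H) W \<longleftrightarrow>
     W \<subseteq> range (add_coset H) \<and> open {x. add_coset H x \<in> W}"
proof -
  have "istopology (\<lambda>W. W \<subseteq> range (add_coset H) \<and> open {x. add_coset H x \<in> W})"
    unfolding istopology_def
  proof (intro conjI allI impI)
    fix S T
    assume "S \<subseteq> range (add_coset H) \<and> open {x. add_coset H x \<in> S}"
      "T \<subseteq> range (add_coset H) \<and> open {x. add_coset H x \<in> T}"
    then show "S \<inter> T \<subseteq> range (add_coset H)" "open {x. add_coset H x \<in> S \<inter> T}"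
      by (auto intro: open_Collect_conj)
  next
    fix \<K>
    assume *: "\<forall>S\<in>\<K>. S \<subseteq> range (add_coset H) \<and> open {x. add_coset H x \<in> S}"
    then show "\<Union>\<K> \<subseteq> range (add_coset H)" by blast
    have "{x. add_coset H x \<in> \<Union>\<K>} = (\<Union>S\<in>\<K>. {x. add_coset H x \<in> S})" by auto
    then show "open {x. add_coset H x \<in> \<Union>\<K>}" using * by auto
  qed
  then show ?thesis
    unfolding quotient_topology_def by (simp add: topology_inverse')
qed

lemma topspace_quotient_topology: "topspace (quotient_topology H) = range (add_coset H)"
proof
  show "topspace (quotient_topology H) \<subseteq> range (add_coset H)"
    using openin_quotient_topology[of H "topspace (quotient_topology H)"] by auto
  have "openin (quotient_topology H) (range (add_coset H))"
    by (simp add: openin_quotient_topology)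
  then show "range (add_coset H) \<subseteq> topspace (quotient_topology H)" by (rule openin_subset)
qed

lemma quotient_map_add_coset: "quotient_map euclidean (quotient_topology H) (add_coset H)"
  by (auto simp: quotient_map_def topspace_quotient_topology openin_quotient_topology)

definition uniform_lattice :: "'a::{topological_space,ab_group_add} set \<Rightarrow> bool" where
  "uniform_lattice H \<longleftrightarrow>
     add_subgroup H \<and> discrete H \<and> compact_space (quotient_topology H)"

definition borel_section :: "'a::{topological_space,ab_group_add} set \<Rightarrow> 'a set \<Rightarrow> bool" where
  "borel_section H S \<longleftrightarrow> S \<in> sets borel \<and> (\<forall>C\<in>range (add_coset H). \<exists>!s. s \<in> S \<and> s \<in> C)"

definition annihilator :: "'a::topological_ab_group_add dual set \<Rightarrow> 'a set" where
  "annihilator \<Gamma> = {x. \<forall>\<gamma>\<in>\<Gamma>. eval_char \<gamma> x = 1}"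


section \<open>Haar measures and the space of square integrable functions\<close>

text \<open>A Haar measure is a nonzero translation invariant Radon measure: finite on compact sets,
  outer regular on Borel sets and inner regular on open sets.\<close>

definition haar_measure :: "'a::{topological_space,ab_group_add} measure \<Rightarrow> bool" where
  "haar_measure \<mu> \<longleftrightarrow>
     sets \<mu> = sets borel \<and>
     emeasure \<mu> UNIV \<noteq> 0 \<and>
     (\<forall>x. \<forall>A\<in>sets borel. emeasure \<mu> ((\<lambda>y. x + y) ` A) = emeasure \<mu> A) \<and>
     (\<forall>K\<in>sets borel. compact K \<longrightarrow> emeasure \<mu> K < \<infinity>) \<and>
     (\<forall>A\<in>sets borel. emeasure \<mu> A = (INF U\<in>{U. open U \<and> A \<subseteq> U}. emeasure \<mu> U)) \<and>
     (\<forall>U. open U \<longrightarrow> emeasure \<mu> U = (SUP K\<in>{K. compact K \<and> K \<subseteq> U}. emeasure \<mu> K))"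

text \<open>Elements of \<open>L\<^sup>2\<close> are represented by functions; almost everywhere equal functions are not
  identified, so \<open>L2_norm\<close> is a seminorm.\<close>

definition L2_space :: "'a measure \<Rightarrow> ('a \<Rightarrow> complex) set" where
  "L2_space \<mu> = {f \<in> borel_measurable \<mu>. integrable \<mu> (\<lambda>x. (cmod (f x))\<^sup>2)}"

definition L2_inner :: "'a measure \<Rightarrow> ('a \<Rightarrow> complex) \<Rightarrow> ('a \<Rightarrow> complex) \<Rightarrow> complex" where
  "L2_inner \<mu> f g = (LINT x|\<mu>. f x * cnj (g x))"

definition L2_norm :: "'a measure \<Rightarrow> ('a \<Rightarrow> complex) \<Rightarrow> real" where
  "L2_norm \<mu> f = sqrt (LINT x|\<mu>. (cmod (f x))\<^sup>2)"

definition fourier_transform ::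
    "'a::topological_ab_group_add measure \<Rightarrow> ('a \<Rightarrow> complex) \<Rightarrow> 'a dual \<Rightarrow> complex" where
  "fourier_transform \<mu> f \<xi> = (LINT x|\<mu>. f x * cnj (eval_char \<xi> x))"

text \<open>The normalization is Plancherel's identity on \<open>L\<^sup>1 \<inter> L\<^sup>2\<close>.\<close>

definition dual_haar_measures ::
    "'a::topological_ab_group_add measure \<Rightarrow> 'a dual measure \<Rightarrow> bool" where
  "dual_haar_measures \<mu> \<nu> \<longleftrightarrow>
     haar_measure \<mu> \<and> haar_measure \<nu> \<and>
     (\<forall>f \<in> L2_space \<mu>. integrable \<mu> f \<longrightarrow>
        (\<integral>\<^sup>+\<xi>. ennreal ((cmod (fourier_transform \<mu> f \<xi>))\<^sup>2) \<partial>\<nu>) =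
        (\<integral>\<^sup>+x. ennreal ((cmod (f x))\<^sup>2) \<partial>\<mu>))"


section \<open>Bessel sequences, completeness, Gabor systems\<close>

definition bessel_sequence ::
    "'a measure \<Rightarrow> 'i set \<Rightarrow> ('i \<Rightarrow> 'a \<Rightarrow> complex) \<Rightarrow> bool" where
  "bessel_sequence \<mu> I F \<longleftrightarrow>
     countable I \<and> (\<forall>i\<in>I. F i \<in> L2_space \<mu>) \<and>
     (\<exists>B>0. \<forall>g\<in>L2_space \<mu>.
        (\<lambda>i. (cmod (L2_inner \<mu> g (F i)))\<^sup>2) summable_on I \<and>
        (\<Sum>\<^sub>\<infinity>i\<in>I. (cmod (L2_inner \<mu> g (F i)))\<^sup>2) \<le> B * (L2_norm \<mu> g)\<^sup>2)"

definition family_span :: "'i set \<Rightarrow> ('i \<Rightarrow> 'a \<Rightarrow> complex) \<Rightarrow> ('a \<Rightarrow> complex) set" where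
  "family_span I F = {\<lambda>x. \<Sum>i\<in>J. c i * F i x | J c. finite J \<and> J \<subseteq> I}"

definition complete_family ::
    "'a measure \<Rightarrow> 'i set \<Rightarrow> ('i \<Rightarrow> 'a \<Rightarrow> complex) \<Rightarrow> bool" where
  "complete_family \<mu> I F \<longleftrightarrow>
     (\<forall>i\<in>I. F i \<in> L2_space \<mu>) \<and>
     (\<forall>g\<in>L2_space \<mu>. \<forall>e>0. \<exists>h\<in>family_span I F. L2_norm \<mu> (\<lambda>x. g x - h x) < e)"

definition translation :: "'a::ab_group_add \<Rightarrow> ('a \<Rightarrow> complex) \<Rightarrow> 'a \<Rightarrow> complex" where
  "translation u f = (\<lambda>x. f (x - u))"

definition modulation ::
    "'a::topological_ab_group_add dual \<Rightarrow> ('a \<Rightarrow> complex) \<Rightarrow> 'a \<Rightarrow> complex" where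
  "modulation \<xi> f = (\<lambda>x. eval_char \<xi> x * f x)"

definition gabor_system ::
    "('a::topological_ab_group_add \<Rightarrow> complex) \<Rightarrow> 'a \<times> 'a dual \<Rightarrow> 'a \<Rightarrow> complex" where
  "gabor_system f = (\<lambda>(u, \<gamma>). modulation \<gamma> (translation u f))"

text \<open>The size of \<open>\<Lambda> \<times> \<Gamma>\<close>, as a function of chosen Borel sections of the two quotients; its value
  does not depend on this choice. It is kept in \<open>ennreal\<close> so that no infinite measure is
  truncated.\<close>

definition lattice_size :: "'a measure \<Rightarrow> 'b measure \<Rightarrow> 'a set \<Rightarrow> 'b set \<Rightarrow> ennreal" where
  "lattice_size \<mu> \<nu> S T = emeasure \<mu> S * emeasure \<nu> T"

end

(* After scaling f, the frame operator S of the Gabor system satisfies 0 <= S <= 1 by the Bessel bound,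
   and (1 - S)^N tends to 0 by completeness. With p_N(S) = sum of (1 - S)^j over j < N one has
   0 <= <p_N(S) f, f> <= 1, because f f^* <= S, and S p_N(S) = 1 - (1 - S)^N tends to the identity.
   On operators commuting with the time-frequency shifts there is a trace T -> sum of <T g_n, g_n>,
   where the g_n, normalized indicators of pieces of the section of Lambda, generate a tight Gabor
   frame. The trace of S p_N(S) is <p_N(S) f, f> <= 1 and the trace of the identity is the lattice
   size, so the latter is at most 1.

   The g_n generate a tight frame because, for u supported on a compact set whose points are separated
   by Gamma, the sum over gamma of |u^(gamma + xi)|^2 does not depend on xi (by Stone-Weierstrass), so
   that it can be evaluated by integrating over a section of Gamma and applying Plancherel. This
   avoids Pontryagin duality. *)

theory Submission
  imports Defs
begin

section \<open>Square integrable functions\<close>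

text \<open>The polynomials p_N(S) act as approximate inverses, and positivity and monotonicity of
  the moments of 1 - S take the place of spectral calculus. The trace identity is a double sum:
  moving each shift pi_k from f to g_n turns the sum over n and k of <p_N(S) g_n, pi_k f> <pi_k f,
  g_n> into Parseval's identity for f and p_N(S) f. This needs powers of 1 - S to commute with the
  shifts, hence the care for phases. The section of \<Lambda> is cut into pieces because the
  characters in \<Gamma> form a tight frame only over sets whose points they separate. Such
  neighbourhoods exist since the annihilator of \<Gamma> is discrete, which follows from compactness
  of the quotient of the dual group by \<Gamma>. Functions that agree almost everywhere stay
  distinct, so operators are specified through inner products only, and their linearity and
  commutation are statements about inner products.\<close>

lemma borel_measurable_cnj [measurable (raw)]:
  "f \<in> borel_measurable M \<Longrightarrow> (\<lambda>x. cnj (f x)) \<in> borel_measurable M"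
  by (rule measurable_compose[of f M borel cnj borel])
    (auto intro: borel_measurable_continuous_onI continuous_intros)

lemma L2_spaceI:
  assumes "f \<in> borel_measurable M" "(\<integral>\<^sup>+x. ennreal ((cmod (f x))\<^sup>2) \<partial>M) < \<infinity>"
  shows "f \<in> L2_space M"
proof -
  have "integrable M (\<lambda>x. (cmod (f x))\<^sup>2)"
  proof (rule integrableI_bounded)
    show "(\<lambda>x. (cmod (f x))\<^sup>2) \<in> borel_measurable M" using assms(1) by measurable
  qed (use assms(2) in auto)
  then show ?thesis using assms(1) by (simp add: L2_space_def)
qed

lemma L2_measurable [measurable_dest]: "f \<in> L2_space M \<Longrightarrow> f \<in> borel_measurable M"
  by (simp add: L2_space_def)

lemma L2_sq_integrable: "f \<in> L2_space M \<Longrightarrow> integrable M (\<lambda>x. (cmod (f x))\<^sup>2)"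
  by (simp add: L2_space_def)

lemma L2_norm_nonneg [simp]: "0 \<le> L2_norm M f"
  by (simp add: L2_norm_def)

lemma L2_norm_sq: "(L2_norm M f)\<^sup>2 = (LINT x|M. (cmod (f x))\<^sup>2)"
  by (simp add: L2_norm_def)

lemma L2_nn_integral:
  assumes "f \<in> L2_space M"
  shows "(\<integral>\<^sup>+x. ennreal ((cmod (f x))\<^sup>2) \<partial>M) = ennreal ((L2_norm M f)\<^sup>2)"
  unfolding L2_norm_sq by (rule nn_integral_eq_integral[OF L2_sq_integrable[OF assms]]) simp

lemma L2_dominated:
  assumes "g \<in> borel_measurable M" "u \<in> L2_space M" "0 \<le> c"
    and "\<And>x. x \<in> space M \<Longrightarrow> cmod (g x) \<le> c * cmod (u x)"
  shows "g \<in> L2_space M" "L2_norm M g \<le> c * L2_norm M u"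
proof -
  have le: "(cmod (g x))\<^sup>2 \<le> c\<^sup>2 * (cmod (u x))\<^sup>2" if "x \<in> space M" for x
    using power_mono[OF assms(4)[OF that], of 2] by (simp add: power_mult_distrib)
  have int: "integrable M (\<lambda>x. c\<^sup>2 * (cmod (u x))\<^sup>2)"
    using L2_sq_integrable[OF assms(2)] by simp
  have "integrable M (\<lambda>x. (cmod (g x))\<^sup>2)"
    by (rule Bochner_Integration.integrable_bound[OF int]) (use assms(1) le in auto)
  then show g: "g \<in> L2_space M" using assms(1) by (simp add: L2_space_def)
  have "(L2_norm M g)\<^sup>2 \<le> (LINT x|M. c\<^sup>2 * (cmod (u x))\<^sup>2)"
    unfolding L2_norm_sq by (rule integral_mono[OF L2_sq_integrable[OF g] int le])
  then have "(L2_norm M g)\<^sup>2 \<le> (c * L2_norm M u)\<^sup>2"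
    by (simp add: L2_norm_sq power_mult_distrib)
  then show "L2_norm M g \<le> c * L2_norm M u"
    by (rule power2_le_imp_le) (use assms(3) in simp)
qed

lemma L2_mult:
  assumes "u \<in> L2_space M" "m \<in> borel_measurable M" "\<And>x. x \<in> space M \<Longrightarrow> cmod (m x) \<le> c" "0 \<le> c"
  shows "(\<lambda>x. m x * u x) \<in> L2_space M" "L2_norm M (\<lambda>x. m x * u x) \<le> c * L2_norm M u"
proof -
  have [measurable]: "u \<in> borel_measurable M" "m \<in> borel_measurable M" using assms by auto
  have *: "cmod (m x * u x) \<le> c * cmod (u x)" if "x \<in> space M" for x
    using assms(3)[OF that] by (simp add: norm_mult mult_right_mono)
  have "(\<lambda>x. m x * u x) \<in> borel_measurable M" by measurable
  from L2_dominated[OF this assms(1,4) *]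
  show "(\<lambda>x. m x * u x) \<in> L2_space M" "L2_norm M (\<lambda>x. m x * u x) \<le> c * L2_norm M u"
    by blast+
qed

lemma L2_zero [simp]: "(\<lambda>_. 0) \<in> L2_space M"
  by (simp add: L2_space_def)

lemma L2_scale: "u \<in> L2_space M \<Longrightarrow> (\<lambda>x. c * u x) \<in> L2_space M"
  by (rule L2_mult(1)[of _ _ "\<lambda>_. c" "cmod c"]) auto

lemma L2_add:
  assumes "u \<in> L2_space M" "v \<in> L2_space M"
  shows "(\<lambda>x. u x + v x) \<in> L2_space M"
proof -
  have [measurable]: "u \<in> borel_measurable M" "v \<in> borel_measurable M" using assms by auto
  have "integrable M (\<lambda>x. 2 * (cmod (u x))\<^sup>2 + 2 * (cmod (v x))\<^sup>2)"
    using assms[THEN L2_sq_integrable] by simp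
  then have "integrable M (\<lambda>x. (cmod (u x + v x))\<^sup>2)"
  proof (rule Bochner_Integration.integrable_bound)
    show "AE x in M. norm ((cmod (u x + v x))\<^sup>2) \<le> norm (2 * (cmod (u x))\<^sup>2 + 2 * (cmod (v x))\<^sup>2)"
    proof (rule AE_I2)
      fix x
      have "(cmod (u x + v x))\<^sup>2 \<le> (cmod (u x) + cmod (v x))\<^sup>2"
        by (intro power_mono norm_triangle_ineq) auto
      also have "\<dots> \<le> 2 * (cmod (u x))\<^sup>2 + 2 * (cmod (v x))\<^sup>2"
        using sum_squares_bound[of "cmod (u x)" "cmod (v x)"] by (simp add: power2_sum)
      finally show "norm ((cmod (u x + v x))\<^sup>2) \<le> norm (2 * (cmod (u x))\<^sup>2 + 2 * (cmod (v x))\<^sup>2)"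
        by simp
    qed
  qed measurable
  then show ?thesis by (simp add: L2_space_def)
qed

lemma L2_diff:
  assumes "u \<in> L2_space M" "v \<in> L2_space M"
  shows "(\<lambda>x. u x - v x) \<in> L2_space M"
  using L2_add[OF assms(1) L2_scale[OF assms(2), of "-1"]] by simp

lemma L2_sum:
  assumes "\<And>i. i \<in> J \<Longrightarrow> u i \<in> L2_space M"
  shows "(\<lambda>x. \<Sum>i\<in>J. u i x) \<in> L2_space M"
  using assms by (induction J rule: infinite_finite_induct) (auto intro: L2_add)

lemma L2_integrable_mult_cnj:
  assumes "u \<in> L2_space M" "v \<in> L2_space M"
  shows "integrable M (\<lambda>x. u x * cnj (v x))"
proof -
  have [measurable]: "u \<in> borel_measurable M" "v \<in> borel_measurable M" using assms by auto
  have "integrable M (\<lambda>x. (cmod (u x))\<^sup>2 + (cmod (v x))\<^sup>2)"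
    using assms[THEN L2_sq_integrable] by simp
  then show ?thesis
  proof (rule Bochner_Integration.integrable_bound)
    show "AE x in M. norm (u x * cnj (v x)) \<le> norm ((cmod (u x))\<^sup>2 + (cmod (v x))\<^sup>2)"
    proof (rule AE_I2)
      fix x
      have "2 * (cmod (u x) * cmod (v x)) \<le> (cmod (u x))\<^sup>2 + (cmod (v x))\<^sup>2"
        using sum_squares_bound[of "cmod (u x)" "cmod (v x)"] by simp
      moreover have "0 \<le> cmod (u x) * cmod (v x)" by simp
      ultimately have "cmod (u x) * cmod (v x) \<le> (cmod (u x))\<^sup>2 + (cmod (v x))\<^sup>2" by linarith
      then show "norm (u x * cnj (v x)) \<le> norm ((cmod (u x))\<^sup>2 + (cmod (v x))\<^sup>2)"
        by (simp add: norm_mult)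
    qed
  qed measurable
qed

lemma L2_inner_add_left:
  assumes "u \<in> L2_space M" "v \<in> L2_space M" "w \<in> L2_space M"
  shows "L2_inner M (\<lambda>x. u x + v x) w = L2_inner M u w + L2_inner M v w"
  using assms by (simp add: L2_inner_def ring_distribs L2_integrable_mult_cnj)

lemma L2_inner_diff_left:
  assumes "u \<in> L2_space M" "v \<in> L2_space M" "w \<in> L2_space M"
  shows "L2_inner M (\<lambda>x. u x - v x) w = L2_inner M u w - L2_inner M v w"
  using assms by (simp add: L2_inner_def left_diff_distrib L2_integrable_mult_cnj)

lemma L2_inner_scale_left: "L2_inner M (\<lambda>x. c * u x) w = c * L2_inner M u w"
  by (simp add: L2_inner_def mult.assoc)

lemma L2_inner_cnj: "cnj (L2_inner M u v) = L2_inner M v u"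
  unfolding L2_inner_def by (subst Bochner_Integration.integral_cnj[symmetric]) (simp add: mult.commute)

lemma L2_inner_scale_right: "L2_inner M u (\<lambda>x. c * w x) = cnj c * L2_inner M u w"
  by (simp add: L2_inner_scale_left flip: L2_inner_cnj[of M _ u])

lemma L2_inner_add_right:
  assumes "u \<in> L2_space M" "v \<in> L2_space M" "w \<in> L2_space M"
  shows "L2_inner M w (\<lambda>x. u x + v x) = L2_inner M w u + L2_inner M w v"
  using L2_inner_add_left[OF assms] by (simp flip: L2_inner_cnj[of M _ w])

lemma L2_inner_diff_right:
  assumes "u \<in> L2_space M" "v \<in> L2_space M" "w \<in> L2_space M"
  shows "L2_inner M w (\<lambda>x. u x - v x) = L2_inner M w u - L2_inner M w v"
  using L2_inner_diff_left[OF assms] by (simp flip: L2_inner_cnj[of M _ w])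

lemma L2_inner_sum_left:
  assumes "\<And>i. i \<in> J \<Longrightarrow> u i \<in> L2_space M" "w \<in> L2_space M"
  shows "L2_inner M (\<lambda>x. \<Sum>i\<in>J. u i x) w = (\<Sum>i\<in>J. L2_inner M (u i) w)"
  using assms(1)
proof (induction J rule: infinite_finite_induct)
  case (insert i J)
  then show ?case using assms(2) by (simp add: L2_inner_add_left L2_sum)
qed (simp_all add: L2_inner_def)

lemma L2_inner_sum_right:
  assumes "\<And>i. i \<in> J \<Longrightarrow> u i \<in> L2_space M" "w \<in> L2_space M"
  shows "L2_inner M w (\<lambda>x. \<Sum>i\<in>J. u i x) = (\<Sum>i\<in>J. L2_inner M w (u i))"
  using L2_inner_sum_left[of J u M w, OF assms] by (simp flip: L2_inner_cnj[of M _ w])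

lemma L2_inner_self: "L2_inner M u u = of_real ((L2_norm M u)\<^sup>2)"
  by (simp add: L2_inner_def L2_norm_sq flip: complex_norm_square of_real_power)

lemma L2_Cauchy_Schwarz:
  assumes "u \<in> L2_space M" "v \<in> L2_space M"
  shows "cmod (L2_inner M u v) \<le> L2_norm M u * L2_norm M v"
proof -
  have [measurable]: "u \<in> borel_measurable M" "v \<in> borel_measurable M" using assms by auto
  have "ennreal (cmod (L2_inner M u v)) \<le> (\<integral>\<^sup>+x. ennreal (cmod (u x * cnj (v x))) \<partial>M)"
    unfolding L2_inner_def by (rule integral_norm_bound_ennreal[OF L2_integrable_mult_cnj[OF assms]])
  then have "(ennreal (cmod (L2_inner M u v)))\<^sup>2 \<le> (\<integral>\<^sup>+x. ennreal (cmod (u x)) * ennreal (cmod (v x)) \<partial>M)\<^sup>2"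
    by (intro power_mono) (auto simp: norm_mult ennreal_mult)
  also have "\<dots> \<le> (\<integral>\<^sup>+x. (ennreal (cmod (u x)))\<^sup>2 \<partial>M) * (\<integral>\<^sup>+x. (ennreal (cmod (v x)))\<^sup>2 \<partial>M)"
    by (rule Cauchy_Schwarz_nn_integral) auto
  also have "\<dots> = ennreal ((L2_norm M u * L2_norm M v)\<^sup>2)"
    by (simp only: ennreal_power[OF norm_ge_zero] L2_nn_integral[OF assms(1)] L2_nn_integral[OF assms(2)]
        ennreal_mult[OF zero_le_power2 zero_le_power2] power_mult_distrib)
  finally have "(cmod (L2_inner M u v))\<^sup>2 \<le> (L2_norm M u * L2_norm M v)\<^sup>2"
    by (simp only: ennreal_power[OF norm_ge_zero] ennreal_le_iff[OF zero_le_power2])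
  then show ?thesis by (rule power2_le_imp_le) simp
qed

lemma L2_norm_triangle:
  assumes "u \<in> L2_space M" "v \<in> L2_space M"
  shows "L2_norm M (\<lambda>x. u x + v x) \<le> L2_norm M u + L2_norm M v"
proof -
  have "of_real ((L2_norm M (\<lambda>x. u x + v x))\<^sup>2) =
      L2_inner M u u + L2_inner M u v + cnj (L2_inner M u v) + L2_inner M v v"
    using assms unfolding L2_inner_self[symmetric]
    by (simp only: L2_inner_add_left L2_inner_add_right L2_add L2_inner_cnj add.assoc)
  from arg_cong[OF this, of Re] have "(L2_norm M (\<lambda>x. u x + v x))\<^sup>2 = (L2_norm M u)\<^sup>2 + 2 * Re (L2_inner M u v) + (L2_norm M v)\<^sup>2"
    by (simp only: L2_inner_self Re_complex_of_real plus_complex.sel cnj.sel)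
  also have "\<dots> \<le> (L2_norm M u + L2_norm M v)\<^sup>2"
    using L2_Cauchy_Schwarz[OF assms] complex_Re_le_cmod[of "L2_inner M u v"]
    by (simp add: power2_sum)
  finally show ?thesis by (rule power2_le_imp_le) simp
qed

lemma L2_norm_scale: "L2_norm M (\<lambda>x. c * u x) = cmod c * L2_norm M u"
  by (simp add: L2_norm_def norm_mult power_mult_distrib real_sqrt_mult)

text \<open>Riesz-Fischer for the seminorm: a subsequence with geometrically small gaps converges
  almost everywhere, and Fatou's lemma compares the full sequence with its limit.\<close>

theorem L2_complete:
  fixes w :: "nat \<Rightarrow> 'a \<Rightarrow> complex"
  assumes w: "\<And>n. w n \<in> L2_space M"
    and Cauchy: "\<And>e. e > 0 \<Longrightarrow> \<exists>N. \<forall>m\<ge>N. \<forall>n\<ge>N. L2_norm M (\<lambda>x. w m x - w n x) < e"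
  obtains v where "v \<in> L2_space M" "(\<lambda>n. L2_norm M (\<lambda>x. w n x - v x)) \<longlonglongrightarrow> 0"
proof -
  have [measurable]: "w n \<in> borel_measurable M" for n using w by auto
  obtain N where N: "\<And>k m n. m \<ge> N k \<Longrightarrow> n \<ge> N k \<Longrightarrow> L2_norm M (\<lambda>x. w m x - w n x) < (1/2)^k"
  proof -
    have "\<exists>N. \<forall>m\<ge>N. \<forall>n\<ge>N. L2_norm M (\<lambda>x. w m x - w n x) < (1/2)^k" for k by (rule Cauchy) simp
    then show ?thesis using that by metis
  qed
  \<comment> \<open>\<open>Suc r\<close> makes the subsequence strictly increasing;
    \<open>N (Suc k)\<close> ensures \<open>N k \<le> r k\<close>, so that consecutive terms are
    geometrically close.\<close>
  define r where "r = rec_nat (N 0) (\<lambda>k r. max (Suc r) (N (Suc k)))"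
  have rN: "N k \<le> r k" for k by (cases k) (auto simp: r_def)
  have "strict_mono r" unfolding strict_mono_Suc_iff by (auto simp: r_def intro: less_max_iff_disj[THEN iffD2])
  have rmono: "r k \<le> r (Suc k)" for k using \<open>strict_mono r\<close> by (simp add: strict_mono_less_eq)
  define d where "d k x = w (r (Suc k)) x - w (r k) x" for k x
  have dL: "d k \<in> L2_space M" for k unfolding d_def by (intro L2_diff w)
  have [measurable]: "d k \<in> borel_measurable M" for k using dL by auto
  have "L2_norm M (d k) \<le> (1/2)^k" for k
    unfolding d_def using N[of k "r (Suc k)" "r k"] rN[of k] rmono[of k] by auto
  \<comment> \<open>The squared gaps are at most (1/4)^k, which leaves room for the weight 2^k. With
    this weight, summability of the squared gaps at a point yields absolute summability of the gaps,
    by 2 a \<le> 2^k a^2 + (1/2)^k.\<close>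
  then have dn: "2^k * (L2_norm M (d k))\<^sup>2 \<le> (1/2)^k" for k
  proof -
    assume *: "\<And>k. L2_norm M (d k) \<le> (1/2)^k"
    have "2^k * (L2_norm M (d k))\<^sup>2 \<le> 2^k * ((1/2)^k)\<^sup>2"
      using *[of k] by (intro mult_left_mono power_mono) auto
    also have "\<dots> = (1/2)^k" by (simp add: power2_eq_square field_simps)
    finally show ?thesis .
  qed
  have "(\<integral>\<^sup>+x. (\<Sum>k. ennreal (2^k * (cmod (d k x))\<^sup>2)) \<partial>M) = (\<Sum>k. \<integral>\<^sup>+x. ennreal (2^k * (cmod (d k x))\<^sup>2) \<partial>M)"
    by (rule nn_integral_suminf) measurable
  also have "\<dots> = (\<Sum>k. ennreal (2^k * (L2_norm M (d k))\<^sup>2))"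
    by (intro suminf_cong) (simp add: ennreal_mult nn_integral_cmult L2_nn_integral dL)
  also have "\<dots> \<le> (\<Sum>k. ennreal ((1/2)^k))"
    by (intro suminf_le ennreal_leI dn) auto
  also have "\<dots> < \<infinity>" by (subst suminf_ennreal2) (auto simp: summable_geometric)
  finally have fin: "AE x in M. (\<Sum>k. ennreal (2^k * (cmod (d k x))\<^sup>2)) \<noteq> \<infinity>"
    by (intro nn_integral_PInf_AE) auto
  have conv: "convergent (\<lambda>k. w (r k) x)" if *: "(\<Sum>k. ennreal (2^k * (cmod (d k x))\<^sup>2)) \<noteq> \<infinity>" for x
  proof -
    have "summable (\<lambda>k. 2^k * (cmod (d k x))\<^sup>2)"
      using * by (intro summable_suminf_not_top) auto
    then have "summable (\<lambda>k. (2^k * (cmod (d k x))\<^sup>2 + (1/2)^k))"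
      by (intro summable_add summable_geometric) auto
    then have "summable (\<lambda>k. norm (d k x))"
    proof (rule summable_comparison_test')
      fix k :: nat
      have "0 \<le> (sqrt (2^k) * cmod (d k x) - sqrt ((1/2)^k))\<^sup>2" by simp
      then have "2 * (sqrt (2^k) * sqrt ((1/2)^k)) * cmod (d k x) \<le> 2^k * (cmod (d k x))\<^sup>2 + (1/2)^k"
        by (simp add: power2_diff power_mult_distrib mult.commute mult.left_commute)
      moreover have "sqrt (2^k) * sqrt ((1/2)^k) = 1"
        by (simp flip: real_sqrt_mult power_mult_distrib)
      ultimately have "2 * cmod (d k x) \<le> 2^k * (cmod (d k x))\<^sup>2 + (1/2)^k" by simp
      then show "norm (norm (d k x)) \<le> 2^k * (cmod (d k x))\<^sup>2 + (1/2)^k"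
        using norm_ge_zero[of "d k x"] unfolding real_norm_def abs_norm_cancel by linarith
    qed
    then have "summable (\<lambda>k. d k x)" by (rule summable_norm_cancel)
    then have "convergent (\<lambda>n. \<Sum>k<n. d k x)" by (simp add: summable_iff_convergent)
    moreover have "(\<Sum>k<n. d k x) = w (r n) x - w (r 0) x" for n
      unfolding d_def by (induction n) auto
    ultimately have "convergent (\<lambda>n. w (r n) x - w (r 0) x)" by simp
    then have "convergent (\<lambda>n. (w (r n) x - w (r 0) x) + w (r 0) x)"
      by (intro convergent_add convergent_const)
    then show ?thesis by simp
  qed
  \<comment> \<open>Where the subsequence diverges \<open>lim\<close> takes a default value; this
    happens on a null set only and does not disturb measurability.\<close>
  define v where "v x = lim (\<lambda>k. w (r k) x)" for x
  have [measurable]: "v \<in> borel_measurable M" unfolding v_def by measurable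
  have lim: "AE x in M. (\<lambda>k. w (r k) x) \<longlonglongrightarrow> v x"
    using fin
  proof eventually_elim
    case (elim x)
    then show ?case using conv[OF elim] by (simp add: v_def convergent_LIMSEQ_iff)
  qed
  have bound: "(\<integral>\<^sup>+x. ennreal ((cmod (w n x - v x))\<^sup>2) \<partial>M) \<le> ennreal (((1/2)^k)\<^sup>2)" if "n \<ge> N k" for n k
  proof -
    have "(\<integral>\<^sup>+x. ennreal ((cmod (w n x - v x))\<^sup>2) \<partial>M) = (\<integral>\<^sup>+x. liminf (\<lambda>j. ennreal ((cmod (w n x - w (r j) x))\<^sup>2)) \<partial>M)"
    proof (rule nn_integral_cong_AE)
      show "AE x in M. ennreal ((cmod (w n x - v x))\<^sup>2) = liminf (\<lambda>j. ennreal ((cmod (w n x - w (r j) x))\<^sup>2))"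
        using lim
      proof eventually_elim
        case (elim x)
        have "(\<lambda>j. ennreal ((cmod (w n x - w (r j) x))\<^sup>2)) \<longlonglongrightarrow> ennreal ((cmod (w n x - v x))\<^sup>2)"
          by (intro tendsto_intros tendsto_ennrealI elim)
        then show ?case by (rule lim_imp_Liminf[OF sequentially_bot, symmetric])
      qed
    qed
    also have "\<dots> \<le> liminf (\<lambda>j. \<integral>\<^sup>+x. ennreal ((cmod (w n x - w (r j) x))\<^sup>2) \<partial>M)"
      by (rule nn_integral_liminf) measurable
    also have "\<dots> \<le> ennreal (((1/2)^k)\<^sup>2)"
    proof -
      have "\<forall>\<^sub>F j in sequentially. (\<integral>\<^sup>+x. ennreal ((cmod (w n x - w (r j) x))\<^sup>2) \<partial>M) \<le> ennreal (((1/2)^k)\<^sup>2)"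
      proof (rule eventually_sequentiallyI[of k])
        fix j assume "j \<ge> k"
        then have "r j \<ge> N k" using rN[of k] \<open>strict_mono r\<close> by (meson order_trans strict_mono_less_eq)
        then have "(L2_norm M (\<lambda>x. w n x - w (r j) x))\<^sup>2 \<le> ((1/2)^k)\<^sup>2"
          using N[OF that, of "r j"] by (intro power_mono) auto
        then show "(\<integral>\<^sup>+x. ennreal ((cmod (w n x - w (r j) x))\<^sup>2) \<partial>M) \<le> ennreal (((1/2)^k)\<^sup>2)"
          by (simp add: L2_nn_integral L2_diff w ennreal_leI)
      qed
      then show ?thesis using Liminf_le by force
    qed
    finally show ?thesis .
  qed
  have dv: "(\<lambda>x. w n x - v x) \<in> L2_space M" if "n \<ge> N k" for n k
    using bound[OF that] by (intro L2_spaceI) (auto simp: le_less_trans)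
  have vL: "v \<in> L2_space M" using L2_diff[OF w dv[of 0 "N 0"], of "N 0"] by simp
  have "(\<lambda>n. L2_norm M (\<lambda>x. w n x - v x)) \<longlonglongrightarrow> 0"
  proof (rule LIMSEQ_I)
    fix e :: real assume "e > 0"
    then obtain k where k: "(1/2)^k < e" using real_arch_pow_inv[of e "1/2"] by auto
    have "norm (L2_norm M (\<lambda>x. w n x - v x) - 0) < e" if "n \<ge> N k" for n
    proof -
      have "(L2_norm M (\<lambda>x. w n x - v x))\<^sup>2 \<le> ((1/2)^k)\<^sup>2"
        using bound[OF that] by (simp add: L2_nn_integral dv[OF that])
      then have "L2_norm M (\<lambda>x. w n x - v x) \<le> (1/2)^k" by (rule power2_le_imp_le) simp
      with k show ?thesis by simp
    qed
    then show "\<exists>no. \<forall>n\<ge>no. norm (L2_norm M (\<lambda>x. w n x - v x) - 0) < e" by blast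
  qed
  then show ?thesis using that vL by blast
qed

section \<open>Frame operators and the trace argument\<close>

lemma polarization_complex:
  "a * cnj b = (complex_of_real ((cmod (a + b))\<^sup>2) - complex_of_real ((cmod (a - b))\<^sup>2)
     + \<i> * complex_of_real ((cmod (a + \<i> * b))\<^sup>2) - \<i> * complex_of_real ((cmod (a - \<i> * b))\<^sup>2)) / 4"
  unfolding complex_norm_square by (simp add: algebra_simps)

lemma has_sum_sum:
  fixes f :: "'j \<Rightarrow> 'i \<Rightarrow> 'b::topological_comm_monoid_add"
  assumes "\<And>j. j \<in> J \<Longrightarrow> (f j has_sum s j) I"
  shows "((\<lambda>i. \<Sum>j\<in>J. f j i) has_sum (\<Sum>j\<in>J. s j)) I"
  using assms by (induction J rule: infinite_finite_induct) (auto intro: has_sum_add)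

text \<open>The identity for squared norms is applied to u + c v for c = 1, -1, i, -i. Polarization
  combines the four unconditionally convergent sums, so convergence of the mixed sum comes along
  with its value.\<close>

lemma Parseval_polarization:
  assumes e: "\<And>i. i \<in> I \<Longrightarrow> e i \<in> L2_space M"
    and parseval: "\<And>u. u \<in> L2_space M \<Longrightarrow> ((\<lambda>i. (cmod (L2_inner M u (e i)))\<^sup>2) has_sum (L2_norm M u)\<^sup>2) I"
    and u: "u \<in> L2_space M" and v: "v \<in> L2_space M"
  shows "((\<lambda>i. L2_inner M u (e i) * L2_inner M (e i) v) has_sum L2_inner M u v) I"
proof -
  define S where "S c x = u x + c * v x" for c x
  have S: "S c \<in> L2_space M" for c unfolding S_def by (intro L2_add L2_scale u v)
  have Se: "L2_inner M (S c) w = L2_inner M u w + c * L2_inner M v w" if "w \<in> L2_space M" for c w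
    unfolding S_def using that u v by (simp add: L2_inner_add_left L2_inner_scale_left L2_scale)
  have SS: "complex_of_real ((L2_norm M (S c))\<^sup>2) =
    L2_inner M u u + cnj c * L2_inner M u v + c * L2_inner M v u + c * cnj c * L2_inner M v v" for c
    unfolding L2_inner_self[symmetric] Se[OF S]
    unfolding S_def using u v by (simp add: L2_inner_add_right L2_inner_scale_right L2_scale algebra_simps)
  have 1: "((\<lambda>i. complex_of_real ((cmod (L2_inner M u (e i) + c * L2_inner M v (e i)))\<^sup>2))
      has_sum complex_of_real ((L2_norm M (S c))\<^sup>2)) I" for c
    using has_sum_of_real[OF parseval[OF S[of c]]]
    by (rule has_sum_cong[THEN iffD1, rotated]) (simp add: Se e)
  have "((\<lambda>i. (complex_of_real ((cmod (L2_inner M u (e i) + 1 * L2_inner M v (e i)))\<^sup>2)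
        + (-1) * complex_of_real ((cmod (L2_inner M u (e i) + (-1) * L2_inner M v (e i)))\<^sup>2)
        + \<i> * complex_of_real ((cmod (L2_inner M u (e i) + \<i> * L2_inner M v (e i)))\<^sup>2)
        + (-\<i>) * complex_of_real ((cmod (L2_inner M u (e i) + (-\<i>) * L2_inner M v (e i)))\<^sup>2)) * (1/4))
      has_sum ((complex_of_real ((L2_norm M (S 1))\<^sup>2)
        + (-1) * complex_of_real ((L2_norm M (S (-1)))\<^sup>2)
        + \<i> * complex_of_real ((L2_norm M (S \<i>))\<^sup>2)
        + (-\<i>) * complex_of_real ((L2_norm M (S (-\<i>)))\<^sup>2)) * (1/4))) I"
    by (intro has_sum_add has_sum_cmult_left has_sum_cmult_right 1)
  moreover have "((complex_of_real ((L2_norm M (S 1))\<^sup>2)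
        + (-1) * complex_of_real ((L2_norm M (S (-1)))\<^sup>2)
        + \<i> * complex_of_real ((L2_norm M (S \<i>))\<^sup>2)
        + (-\<i>) * complex_of_real ((L2_norm M (S (-\<i>)))\<^sup>2)) * (1/4)) = L2_inner M u v"
    unfolding SS by (simp add: algebra_simps)
  moreover have "(complex_of_real ((cmod (L2_inner M u (e i) + 1 * L2_inner M v (e i)))\<^sup>2)
        + (-1) * complex_of_real ((cmod (L2_inner M u (e i) + (-1) * L2_inner M v (e i)))\<^sup>2)
        + \<i> * complex_of_real ((cmod (L2_inner M u (e i) + \<i> * L2_inner M v (e i)))\<^sup>2)
        + (-\<i>) * complex_of_real ((cmod (L2_inner M u (e i) + (-\<i>) * L2_inner M v (e i)))\<^sup>2)) * (1/4)
      = L2_inner M u (e i) * L2_inner M (e i) v" for i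
    unfolding L2_inner_cnj[of M v "e i", symmetric] polarization_complex[of "L2_inner M u (e i)"] by simp
  ultimately show ?thesis by simp
qed

text \<open>Synthesis is adjoint to analysis, hence also a contraction. For the combination w, the
  norm squared is the sum of c_i <F_i, w>; the arithmetic-geometric mean inequality produces half of
  the norm squared again, which is absorbed on the left.\<close>

lemma Bessel_finite_sum_bound:
  assumes F: "\<And>i. i \<in> I \<Longrightarrow> F i \<in> L2_space M"
    and bessel: "\<And>g J. g \<in> L2_space M \<Longrightarrow> finite J \<Longrightarrow> J \<subseteq> I \<Longrightarrow>
      (\<Sum>i\<in>J. (cmod (L2_inner M g (F i)))\<^sup>2) \<le> (L2_norm M g)\<^sup>2"
    and J: "finite J" "J \<subseteq> I"
  shows "(L2_norm M (\<lambda>x. \<Sum>i\<in>J. c i * F i x))\<^sup>2 \<le> (\<Sum>i\<in>J. (cmod (c i))\<^sup>2)"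
proof -
  define w where "w x = (\<Sum>i\<in>J. c i * F i x)" for x
  have cF: "(\<lambda>x. c i * F i x) \<in> L2_space M" if "i \<in> J" for i using that J F by (intro L2_scale) auto
  have w: "w \<in> L2_space M" unfolding w_def by (intro L2_sum cF)
  have "complex_of_real ((L2_norm M w)\<^sup>2) = (\<Sum>i\<in>J. c i * L2_inner M (F i) w)"
  proof -
    have "L2_inner M (\<lambda>x. \<Sum>i\<in>J. c i * F i x) w = (\<Sum>i\<in>J. c i * L2_inner M (F i) w)"
      by (subst L2_inner_sum_left) (auto simp: cF w L2_inner_scale_left)
    then show ?thesis unfolding L2_inner_self[symmetric] w_def[abs_def] .
  qed
  then have "(L2_norm M w)\<^sup>2 = cmod (\<Sum>i\<in>J. c i * L2_inner M (F i) w)"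
    by (metis norm_of_real abs_of_nonneg zero_le_power2)
  also have "\<dots> \<le> (\<Sum>i\<in>J. cmod (c i) * cmod (L2_inner M w (F i)))"
    by (rule order_trans[OF norm_sum])
      (simp add: norm_mult L2_inner_cnj[of M w, symmetric])
  also have "\<dots> \<le> (\<Sum>i\<in>J. ((cmod (c i))\<^sup>2 + (cmod (L2_inner M w (F i)))\<^sup>2) / 2)"
  proof (rule sum_mono)
    fix i
    show "cmod (c i) * cmod (L2_inner M w (F i)) \<le> ((cmod (c i))\<^sup>2 + (cmod (L2_inner M w (F i)))\<^sup>2) / 2"
      using sum_squares_bound[of "cmod (c i)" "cmod (L2_inner M w (F i))"] by simp
  qed
  also have "\<dots> = ((\<Sum>i\<in>J. (cmod (c i))\<^sup>2) + (\<Sum>i\<in>J. (cmod (L2_inner M w (F i)))\<^sup>2)) / 2"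
    by (simp add: sum.distrib flip: sum_divide_distrib)
  also have "\<dots> \<le> ((\<Sum>i\<in>J. (cmod (c i))\<^sup>2) + (L2_norm M w)\<^sup>2) / 2"
    using bessel[OF w J] by simp
  finally show ?thesis unfolding w_def by simp
qed

text \<open>Contractivity of synthesis makes the finite partial sums of <g, F_i> F_i Cauchy with
  respect to the tails of the squared coefficients. As completeness concerns sequences, the limit is
  taken along chosen finite sets \<open>J n\<close>, and every larger finite set is then compared
  with one of them.\<close>

lemma frame_operator_exists:
  assumes F: "\<And>i. i \<in> I \<Longrightarrow> F i \<in> L2_space M"
    and bessel: "\<And>g J. g \<in> L2_space M \<Longrightarrow> finite J \<Longrightarrow> J \<subseteq> I \<Longrightarrow>
      (\<Sum>i\<in>J. (cmod (L2_inner M g (F i)))\<^sup>2) \<le> (L2_norm M g)\<^sup>2"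
    and g: "g \<in> L2_space M"
  shows "\<exists>v\<in>L2_space M. \<forall>u\<in>L2_space M.
    ((\<lambda>i. L2_inner M g (F i) * L2_inner M (F i) u) has_sum L2_inner M v u) I"
proof -
  define c where "c i = L2_inner M g (F i)" for i
  define w where "w J x = (\<Sum>i\<in>J. c i * F i x)" for J x
  have w: "w J \<in> L2_space M" if "J \<subseteq> I" for J
    unfolding w_def using that F by (intro L2_sum L2_scale) auto
  have summ: "(\<lambda>i. (cmod (c i))\<^sup>2) summable_on I"
    by (rule nonneg_bdd_above_summable_on)
      (auto intro!: bdd_aboveI2[where M="(L2_norm M g)\<^sup>2"] bessel g simp: c_def)
  define s where "s = (\<Sum>\<^sub>\<infinity>i\<in>I. (cmod (c i))\<^sup>2)"
  have le_s: "(\<Sum>i\<in>J. (cmod (c i))\<^sup>2) \<le> s" if "finite J" "J \<subseteq> I" for J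
    unfolding s_def by (rule finite_sum_le_infsum[OF summ that]) auto
  have wdiff: "(L2_norm M (\<lambda>x. w J x - w K x))\<^sup>2
      \<le> (s - (\<Sum>i\<in>J. (cmod (c i))\<^sup>2)) + (s - (\<Sum>i\<in>K. (cmod (c i))\<^sup>2))"
    if J: "finite J" "J \<subseteq> I" and K: "finite K" "K \<subseteq> I" for J K
  proof -
    \<comment> \<open>The difference of two partial sums is one combination over the union, with
      coefficients living on the symmetric difference. Each such index lies in the tail of
      \<open>J\<close> or of \<open>K\<close>, which gives the two summands of the bound.\<close>
    define d where "d i = (if i \<in> J then c i else 0) - (if i \<in> K then c i else 0)" for i
    have fin: "finite (J \<union> K)" "J \<union> K \<subseteq> I" using J K by auto
    have "(\<lambda>x. w J x - w K x) = (\<lambda>x. \<Sum>i\<in>J \<union> K. d i * F i x)"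
      unfolding d_def w_def using fin
      by (simp add: left_diff_distrib sum_subtractf if_distrib[of "\<lambda>z. z * _"] sum.If_cases Int_absorb1 cong: if_cong)
    then have "(L2_norm M (\<lambda>x. w J x - w K x))\<^sup>2 \<le> (\<Sum>i\<in>J \<union> K. (cmod (d i))\<^sup>2)"
      using Bessel_finite_sum_bound[OF F bessel fin, of d] by simp
    also have "\<dots> \<le> (\<Sum>i\<in>J \<union> K. ((cmod (c i))\<^sup>2 - (if i \<in> J then (cmod (c i))\<^sup>2 else 0))
        + ((cmod (c i))\<^sup>2 - (if i \<in> K then (cmod (c i))\<^sup>2 else 0)))"
      by (intro sum_mono) (auto simp: d_def)
    also have "\<dots> = ((\<Sum>i\<in>J \<union> K. (cmod (c i))\<^sup>2) - (\<Sum>i\<in>J. (cmod (c i))\<^sup>2))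
        + ((\<Sum>i\<in>J \<union> K. (cmod (c i))\<^sup>2) - (\<Sum>i\<in>K. (cmod (c i))\<^sup>2))"
    proof -
      have "(\<Sum>i\<in>J \<union> K. if i \<in> J then (cmod (c i))\<^sup>2 else 0) = (\<Sum>i\<in>J. (cmod (c i))\<^sup>2)"
        "(\<Sum>i\<in>J \<union> K. if i \<in> K then (cmod (c i))\<^sup>2 else 0) = (\<Sum>i\<in>K. (cmod (c i))\<^sup>2)"
        using fin by (simp_all add: sum.If_cases Int_absorb1)
      then show ?thesis by (simp only: sum.distrib sum_subtractf)
    qed
    also have "\<dots> \<le> (s - (\<Sum>i\<in>J. (cmod (c i))\<^sup>2)) + (s - (\<Sum>i\<in>K. (cmod (c i))\<^sup>2))"
      using le_s[OF fin] by simp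
    finally show ?thesis .
  qed
  have approx0: "\<exists>J. finite J \<and> J \<subseteq> I \<and> s - (\<Sum>i\<in>J. (cmod (c i))\<^sup>2) \<le> e" if "e > 0" for e
    using infsum_finite_approximation[OF summ that] le_s unfolding s_def[symmetric]
    by (auto simp: dist_real_def abs_le_iff)
  \<comment> \<open>Two tails of size \<open>e\<^sup>2 / 8\<close> give a squared distance of at
    most \<open>e\<^sup>2 / 4\<close>, strictly below \<open>e\<^sup>2\<close>.\<close>
  then have approx: "\<exists>J. finite J \<and> J \<subseteq> I \<and> s - (\<Sum>i\<in>J. (cmod (c i))\<^sup>2) \<le> e\<^sup>2 / 8" if "e > 0" for e
    using that by (intro approx0) simp
  then obtain J where J: "\<And>n. finite (J n)" "\<And>n. J n \<subseteq> I"
      "\<And>n. s - (\<Sum>i\<in>J n. (cmod (c i))\<^sup>2) \<le> (1 / real (Suc n))\<^sup>2 / 8"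
    using approx[of "1 / real (Suc n)" for n] by (metis of_nat_0_less_iff zero_less_Suc zero_less_divide_1_iff)
  have small: "L2_norm M (\<lambda>x. w A x - w B x) < e"
    if "finite A" "A \<subseteq> I" "finite B" "B \<subseteq> I" "e > 0"
      "s - (\<Sum>i\<in>A. (cmod (c i))\<^sup>2) \<le> e\<^sup>2 / 8" "s - (\<Sum>i\<in>B. (cmod (c i))\<^sup>2) \<le> e\<^sup>2 / 8" for A B e
  proof (rule power2_less_imp_less)
    have "(L2_norm M (\<lambda>x. w A x - w B x))\<^sup>2 \<le> e\<^sup>2 / 4"
      using wdiff[of A B] that by simp
    also have "\<dots> < e\<^sup>2" using that by simp
    finally show "(L2_norm M (\<lambda>x. w A x - w B x))\<^sup>2 < e\<^sup>2" .
  qed (use that in simp)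
  have mono8: "(1 / real (Suc n))\<^sup>2 / 8 \<le> e\<^sup>2 / 8" if "1 / real (Suc N) < e" "N \<le> n" for N n e
  proof -
    have "1 / real (Suc n) \<le> 1 / real (Suc N)" using that by (simp add: frac_le)
    then have "1 / real (Suc n) \<le> e" using that by simp
    then show ?thesis by (simp add: power_mono)
  qed
  obtain v where v: "v \<in> L2_space M" and lim: "(\<lambda>n. L2_norm M (\<lambda>x. w (J n) x - v x)) \<longlonglongrightarrow> 0"
  proof (rule L2_complete)
    fix e :: real assume e: "e > 0"
    obtain N where N: "1 / real (Suc N) < e" using e nat_approx_posE by (metis)
    show "\<exists>N. \<forall>m\<ge>N. \<forall>n\<ge>N. L2_norm M (\<lambda>x. w (J m) x - w (J n) x) < e"
      by (intro exI[of _ N] allI impI small J e order_trans[OF J(3) mono8[OF N]])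
  qed (use w J in auto)
  have "((\<lambda>i. L2_inner M g (F i) * L2_inner M (F i) u) has_sum L2_inner M v u) I" if u: "u \<in> L2_space M" for u
    unfolding has_sum_def
  proof (rule tendstoI)
    fix e0 :: real assume "e0 > 0"
    \<comment> \<open>The factor 2 pays for two distances, from \<open>w Y\<close> to
      \<open>w (J n)\<close> and from there to \<open>v\<close>; the added 1 covers a test function
      of norm 0.\<close>
    define e where "e = e0 / (2 * (L2_norm M u + 1))"
    have nu: "0 < L2_norm M u + 1" using L2_norm_nonneg[of M u] by linarith
    have e: "e > 0" using \<open>e0 > 0\<close> nu by (simp add: e_def)
    obtain N where N: "1 / real (Suc N) < e" using e nat_approx_posE by metis
    obtain N' where N': "\<And>n. n \<ge> N' \<Longrightarrow> L2_norm M (\<lambda>x. w (J n) x - v x) < e"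
      using LIMSEQ_D[OF lim e] by auto
    define n where "n = max N N'"
    have Jn: "s - (\<Sum>i\<in>J n. (cmod (c i))\<^sup>2) \<le> e\<^sup>2 / 8"
      using order_trans[OF J(3)[of n] mono8[OF N, of n]] by (simp add: n_def)
    have "dist (\<Sum>i\<in>Y. L2_inner M g (F i) * L2_inner M (F i) u) (L2_inner M v u) < e0"
      if Y: "finite Y" "J n \<subseteq> Y" "Y \<subseteq> I" for Y
    proof -
      have "(\<Sum>i\<in>J n. (cmod (c i))\<^sup>2) \<le> (\<Sum>i\<in>Y. (cmod (c i))\<^sup>2)"
        using Y by (intro sum_mono2) auto
      then have "L2_norm M (\<lambda>x. w Y x - w (J n) x) < e"
        using Jn by (intro small) (use Y J e in auto)
      moreover have "L2_norm M (\<lambda>x. w (J n) x - v x) < e" by (rule N') (simp add: n_def)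
      moreover have "L2_norm M (\<lambda>x. w Y x - v x) \<le> L2_norm M (\<lambda>x. w Y x - w (J n) x) + L2_norm M (\<lambda>x. w (J n) x - v x)"
        using L2_norm_triangle[of "\<lambda>x. w Y x - w (J n) x" M "\<lambda>x. w (J n) x - v x"] w Y J v by (simp add: L2_diff)
      ultimately have wv: "L2_norm M (\<lambda>x. w Y x - v x) < 2 * e" by linarith
      have "(\<Sum>i\<in>Y. L2_inner M g (F i) * L2_inner M (F i) u) = L2_inner M (w Y) u"
        unfolding w_def using Y F u
        by (subst L2_inner_sum_left) (auto simp: L2_scale L2_inner_scale_left c_def subset_iff)
      then have "dist (\<Sum>i\<in>Y. L2_inner M g (F i) * L2_inner M (F i) u) (L2_inner M v u)
          = cmod (L2_inner M (\<lambda>x. w Y x - v x) u)"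
        using w Y v u by (simp add: dist_norm L2_inner_diff_left)
      also have "\<dots> \<le> L2_norm M (\<lambda>x. w Y x - v x) * L2_norm M u"
        using w Y v u by (intro L2_Cauchy_Schwarz L2_diff)
      also have "\<dots> \<le> (2 * e) * L2_norm M u" using wv by (intro mult_right_mono) auto
      also have "\<dots> < (2 * e) * (L2_norm M u + 1)" using e by (intro mult_strict_left_mono) auto
      also have "\<dots> = e0" using nu by (simp add: e_def field_simps)
      finally show ?thesis .
    qed
    then show "\<forall>\<^sub>F Y in finite_subsets_at_top I.
        dist (\<Sum>i\<in>Y. L2_inner M g (F i) * L2_inner M (F i) u) (L2_inner M v u) < e0"
      unfolding eventually_finite_subsets_at_top using J by (intro exI[of _ "J n"]) auto
  qed
  with v show ?thesis by blast
qed

text \<open>\<open>R\<close> stands for 1 - S with S the frame operator, and \<open>resid\<close> is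
  the weak form of S = 1 - R. The Bessel constant 1 is what places S, and hence \<open>R\<close>,
  between 0 and 1. \<open>R g\<close> is determined only up to null sets.\<close>

locale frame_residual =
  fixes M :: "'a measure" and I :: "'i set" and F :: "'i \<Rightarrow> 'a \<Rightarrow> complex"
    and R :: "('a \<Rightarrow> complex) \<Rightarrow> 'a \<Rightarrow> complex"
  assumes F: "i \<in> I \<Longrightarrow> F i \<in> L2_space M"
    and bessel: "g \<in> L2_space M \<Longrightarrow> finite J \<Longrightarrow> J \<subseteq> I \<Longrightarrow>
      (\<Sum>i\<in>J. (cmod (L2_inner M g (F i)))\<^sup>2) \<le> (L2_norm M g)\<^sup>2"
    and R: "g \<in> L2_space M \<Longrightarrow> R g \<in> L2_space M"
    and resid: "g \<in> L2_space M \<Longrightarrow> u \<in> L2_space M \<Longrightarrow>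
      ((\<lambda>i. L2_inner M g (F i) * L2_inner M (F i) u) has_sum L2_inner M g u - L2_inner M (R g) u) I"
begin

lemma R_selfadjoint:
  assumes "u \<in> L2_space M" "v \<in> L2_space M"
  shows "L2_inner M (R u) v = L2_inner M u (R v)"
proof -
  have "((\<lambda>i. cnj (L2_inner M v (F i) * L2_inner M (F i) u)) has_sum cnj (L2_inner M v u - L2_inner M (R v) u)) I"
    unfolding has_sum_cnj_iff by (rule resid[OF assms(2,1)])
  then have "((\<lambda>i. L2_inner M u (F i) * L2_inner M (F i) v) has_sum L2_inner M u v - L2_inner M u (R v)) I"
    by (simp add: L2_inner_cnj mult.commute)
  from has_sum_unique[OF resid[OF assms] this] show ?thesis by simp
qed

lemma R_pow: "g \<in> L2_space M \<Longrightarrow> (R ^^ n) g \<in> L2_space M"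
  by (induction n) (auto intro: R)

lemma R_pow_selfadjoint:
  assumes "u \<in> L2_space M" "v \<in> L2_space M"
  shows "L2_inner M ((R ^^ n) u) v = L2_inner M u ((R ^^ n) v)"
  using assms
proof (induction n arbitrary: v)
  case (Suc n)
  have "L2_inner M ((R ^^ Suc n) u) v = L2_inner M ((R ^^ n) u) (R v)"
    using Suc.prems by (simp add: R_selfadjoint R_pow)
  also have "\<dots> = L2_inner M u ((R ^^ Suc n) v)"
    using Suc by (simp add: R funpow_swap1)
  finally show ?case .
qed simp

lemma energy:
  assumes "u \<in> L2_space M"
  shows "((\<lambda>i. (cmod (L2_inner M u (F i)))\<^sup>2) has_sum (L2_norm M u)\<^sup>2 - Re (L2_inner M (R u) u)) I"
proof -
  have eq: "Re (L2_inner M u (F i) * L2_inner M (F i) u) = (cmod (L2_inner M u (F i)))\<^sup>2" for i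
    unfolding L2_inner_cnj[of M u "F i", symmetric]
    by (simp add: complex_norm_square[symmetric] del: of_real_power)
  from has_sum_Re[OF resid[OF assms assms]] show ?thesis
    unfolding eq by (simp add: L2_inner_self del: of_real_power)
qed

lemma R_le: "u \<in> L2_space M \<Longrightarrow> Re (L2_inner M (R u) u) \<le> (L2_norm M u)\<^sup>2"
  using has_sum_nonneg[OF energy] by fastforce

lemma R_nonneg:
  assumes "u \<in> L2_space M"
  shows "0 \<le> Re (L2_inner M (R u) u)"
proof -
  have "(L2_norm M u)\<^sup>2 - Re (L2_inner M (R u) u) \<le> (L2_norm M u)\<^sup>2"
    using energy[OF assms] by (rule has_sum_le_finite_sums) (use bessel assms in auto)
  then show ?thesis by simp
qed

lemma moment_split:
  assumes "u \<in> L2_space M"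
  shows "L2_inner M ((R ^^ (m + n)) u) u = L2_inner M ((R ^^ m) u) ((R ^^ n) u)"
proof -
  have "L2_inner M ((R ^^ (n + m)) u) u = L2_inner M ((R ^^ n) ((R ^^ m) u)) u"
    by (simp only: funpow_add o_apply)
  also have "\<dots> = L2_inner M ((R ^^ m) u) ((R ^^ n) u)"
    using assms by (intro R_pow_selfadjoint R_pow)
  finally show ?thesis by (simp add: add.commute)
qed

text \<open>Self-adjointness splits the exponent: an even moment is a squared norm, an odd one is
  the quadratic form of \<open>R\<close> at a power of \<open>R\<close>. No square root of
  \<open>R\<close> is involved.\<close>

lemma moment_nonneg:
  assumes "u \<in> L2_space M"
  shows "0 \<le> Re (L2_inner M ((R ^^ n) u) u)"
proof (cases "even n")
  case True
  then obtain k where "n = k + k" by (metis evenE mult_2)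
  then show ?thesis by (simp add: moment_split[OF assms] L2_inner_self)
next
  case False
  then obtain k where "n = Suc k + k" by (metis oddE mult_2 Suc_eq_plus1 add_Suc)
  then show ?thesis using R_nonneg[OF R_pow[OF assms, of k]] by (simp only: moment_split[OF assms] funpow.simps o_apply)
qed

text \<open>For odd exponents this uses \<open>R - R\<^sup>2 = R(1 - R)R + (1 - R)R(1 - R)\<close>.\<close>

lemma moment_decreasing:
  assumes "u \<in> L2_space M"
  shows "Re (L2_inner M ((R ^^ Suc n) u) u) \<le> Re (L2_inner M ((R ^^ n) u) u)"
proof (cases "even n")
  case True
  then obtain k where n: "n = k + k" by (metis evenE mult_2)
  then have n': "Suc n = Suc k + k" by simp
  show ?thesis
    using R_le[OF R_pow[OF assms, of k]]
    unfolding n' unfolding n moment_split[OF assms] funpow.simps o_apply L2_inner_self by simp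
next
  case False
  then obtain k where n: "n = Suc k + k" by (metis oddE mult_2 Suc_eq_plus1 add_Suc)
  then have n': "Suc n = Suc k + Suc k" by simp
  define v where "v = (R ^^ k) u"
  have v: "v \<in> L2_space M" and Rv: "R v \<in> L2_space M" and RRv: "R (R v) \<in> L2_space M"
    using assms by (auto simp: v_def intro: R_pow R)
  define d where "d x = v x - R v x" for x
  have d: "d \<in> L2_space M" unfolding d_def by (intro L2_diff v Rv)
  have "L2_inner M (R d) d = L2_inner M d (R v) - L2_inner M d (R (R v))"
    using R_selfadjoint[OF d d] L2_inner_diff_right[OF Rv RRv d] R_selfadjoint[OF d v]
      R_selfadjoint[OF d Rv] L2_inner_diff_right[OF v Rv R[OF d]] unfolding d_def by simp
  also have "\<dots> = L2_inner M v (R v) - L2_inner M (R v) (R v) - L2_inner M v (R (R v)) + L2_inner M (R v) (R (R v))"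
    unfolding d_def using v Rv RRv by (simp add: L2_inner_diff_left)
  also have "L2_inner M v (R v) = L2_inner M (R v) v" using R_selfadjoint[OF v v] by simp
  also have "L2_inner M v (R (R v)) = L2_inner M (R v) (R v)" using R_selfadjoint[OF v Rv] by simp
  also have "L2_inner M (R v) (R (R v)) = L2_inner M (R (R v)) (R v)" using R_selfadjoint[OF Rv Rv] by simp
  finally have "Re (L2_inner M (R v) v) = Re (L2_inner M (R d) d)
      + 2 * (L2_norm M (R v))\<^sup>2 - Re (L2_inner M (R (R v)) (R v))"
    by (simp add: L2_inner_self del: of_real_power)
  with R_nonneg[OF d] R_le[OF Rv] have "(L2_norm M (R v))\<^sup>2 \<le> Re (L2_inner M (R v) v)" by simp
  then show ?thesis
    unfolding n' unfolding n moment_split[OF assms] funpow.simps o_apply v_def[symmetric] L2_inner_self by simp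
qed

lemma norm_R_pow_sq:
  assumes "u \<in> L2_space M"
  shows "(L2_norm M ((R ^^ n) u))\<^sup>2 = Re (L2_inner M ((R ^^ (n + n)) u) u)"
  by (simp add: moment_split[OF assms] L2_inner_self)

lemma norm_R_pow_le:
  assumes "u \<in> L2_space M"
  shows "L2_norm M ((R ^^ n) u) \<le> L2_norm M u"
proof (rule power2_le_imp_le)
  have "decseq (\<lambda>n. Re (L2_inner M ((R ^^ n) u) u))"
    unfolding decseq_Suc_iff using moment_decreasing[OF assms] by blast
  from decseqD[OF this, of 0 "n + n"] show "(L2_norm M ((R ^^ n) u))\<^sup>2 \<le> (L2_norm M u)\<^sup>2"
    by (simp add: norm_R_pow_sq[OF assms] L2_inner_self)
qed simp

text \<open>The operator S dominates the rank one operator of each F_i. With q n = <R^n F_i, F_i>,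
  evaluating this domination at R^n F_i gives (q n)^2 \<le> q (2n) - q (2n+1). The right side tends
  to 0 because q decreases and is bounded below, so q tends to 0, and q (2n) is the squared norm of
  R^n F_i.\<close>

lemma R_pow_F_tendsto_0:
  assumes i: "i \<in> I"
  shows "(\<lambda>n. L2_norm M ((R ^^ n) (F i))) \<longlonglongrightarrow> 0"
proof -
  define q where "q n = Re (L2_inner M ((R ^^ n) (F i)) (F i))" for n
  have Fi: "F i \<in> L2_space M" by (rule F[OF i])
  have dec: "decseq q" unfolding decseq_Suc_iff q_def using moment_decreasing[OF Fi] by blast
  obtain L where L: "q \<longlonglongrightarrow> L"
    using decseq_convergent[OF dec, of 0] moment_nonneg[OF Fi] unfolding q_def by metis
  have bound: "(q n)\<^sup>2 \<le> q (n + n) - q (Suc (n + n))" for n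
  proof -
    define v where "v = (R ^^ n) (F i)"
    have v: "v \<in> L2_space M" unfolding v_def by (rule R_pow[OF Fi])
    have "(q n)\<^sup>2 \<le> (cmod (L2_inner M v (F i)))\<^sup>2"
      unfolding q_def v_def[symmetric] using abs_Re_le_cmod by (metis abs_le_square_iff abs_norm_cancel)
    also have "\<dots> \<le> (L2_norm M v)\<^sup>2 - Re (L2_inner M (R v) v)"
      using finite_sum_le_has_sum[OF energy[OF v], of "{i}"] i by simp
    also have "\<dots> = q (n + n) - q (Suc (n + n))"
      using moment_split[OF Fi, of "Suc n" n] by (simp add: q_def v_def norm_R_pow_sq[OF Fi])
    finally show ?thesis .
  qed
  have sub: "strict_mono (\<lambda>n::nat. n + n)" by (auto simp: strict_mono_def)
  have "(\<lambda>n. q (n + n)) \<longlonglongrightarrow> L" using LIMSEQ_subseq_LIMSEQ[OF L sub] by (simp add: o_def)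
  moreover have "(\<lambda>n. q (Suc (n + n))) \<longlonglongrightarrow> L"
    using LIMSEQ_subseq_LIMSEQ[OF LIMSEQ_Suc[OF L] sub] by (simp add: o_def)
  ultimately have "(\<lambda>n. q (n + n) - q (Suc (n + n))) \<longlonglongrightarrow> L - L" by (rule tendsto_diff)
  then have lim0: "(\<lambda>n. q (n + n) - q (Suc (n + n))) \<longlonglongrightarrow> 0" by simp
  have "(\<lambda>n. (q n)\<^sup>2) \<longlonglongrightarrow> 0"
    by (rule tendsto_sandwich[OF always_eventually always_eventually tendsto_const lim0]) (simp_all only: bound zero_le_power2 simp_thms)
  then have q0: "q \<longlonglongrightarrow> 0" by simp
  have "(\<lambda>n. q (n + n)) \<longlonglongrightarrow> 0" using LIMSEQ_subseq_LIMSEQ[OF q0 sub] by (simp add: o_def)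
  then have "(\<lambda>n. (L2_norm M ((R ^^ n) (F i)))\<^sup>2) \<longlonglongrightarrow> 0"
    by (simp add: q_def norm_R_pow_sq[OF Fi])
  then show ?thesis by simp
qed

text \<open>Completeness enters here: the powers of \<open>R\<close> are contractions that tend to 0
  on each F_i, and every g is approximated by finite combinations of these.\<close>

lemma moments_tendsto_0:
  assumes complete: "complete_family M I F" and g: "g \<in> L2_space M"
  shows "(\<lambda>n. Re (L2_inner M ((R ^^ n) g) g)) \<longlonglongrightarrow> 0"
proof (rule LIMSEQ_I)
  fix e0 :: real assume "e0 > 0"
  define e where "e = e0 / (2 * (L2_norm M g + 1))"
  have ng: "0 < L2_norm M g + 1" using L2_norm_nonneg[of M g] by linarith
  have e: "e > 0" using \<open>e0 > 0\<close> ng by (simp add: e_def)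
  obtain J c where J: "finite J" "J \<subseteq> I"
    and close: "L2_norm M (\<lambda>x. g x - (\<Sum>i\<in>J. c i * F i x)) < e"
    using complete g e unfolding complete_family_def family_span_def by blast
  define h where "h x = (\<Sum>i\<in>J. c i * F i x)" for x
  have cF: "(\<lambda>x. c i * F i x) \<in> L2_space M" if "i \<in> J" for i using that J F by (intro L2_scale) auto
  have h: "h \<in> L2_space M" unfolding h_def by (intro L2_sum cF)
  have lim: "(\<lambda>n. \<Sum>i\<in>J. cmod (c i) * L2_norm M ((R ^^ n) (F i))) \<longlonglongrightarrow> (\<Sum>i\<in>J. cmod (c i) * 0)"
    using J by (intro tendsto_sum tendsto_mult tendsto_const R_pow_F_tendsto_0) auto
  then obtain N where N: "\<And>n. n \<ge> N \<Longrightarrow> (\<Sum>i\<in>J. cmod (c i) * L2_norm M ((R ^^ n) (F i))) < e"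
    using LIMSEQ_D[OF lim e] by (auto simp: abs_less_iff)
  have "norm (Re (L2_inner M ((R ^^ n) g) g) - 0) < e0" if "n \<ge> N" for n
  proof -
    define v where "v = (R ^^ n) g"
    have v: "v \<in> L2_space M" unfolding v_def by (rule R_pow[OF g])
    \<comment> \<open>The power of \<open>R\<close> is moved onto the single F_i inside the inner
      product, so that \<open>R\<close> never has to be applied to the combination
      \<open>h\<close>.\<close>
    have "L2_inner M v h = (\<Sum>i\<in>J. cnj (c i) * L2_inner M g ((R ^^ n) (F i)))"
      unfolding h_def v_def using J F
      by (subst L2_inner_sum_right) (auto simp: cF R_pow[OF g] L2_inner_scale_right subset_iff R_pow_selfadjoint[OF g])
    then have "cmod (L2_inner M v h) \<le> (\<Sum>i\<in>J. cmod (c i) * cmod (L2_inner M g ((R ^^ n) (F i))))"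
      by (simp add: order_trans[OF norm_sum] norm_mult)
    also have "\<dots> \<le> (\<Sum>i\<in>J. cmod (c i) * (L2_norm M g * L2_norm M ((R ^^ n) (F i))))"
      using J F by (intro sum_mono mult_left_mono L2_Cauchy_Schwarz g R_pow) auto
    also have "\<dots> = L2_norm M g * (\<Sum>i\<in>J. cmod (c i) * L2_norm M ((R ^^ n) (F i)))"
      by (simp add: sum_distrib_left mult.left_commute)
    also have "\<dots> \<le> L2_norm M g * e" using N[OF that] by (intro mult_left_mono) auto
    finally have 1: "cmod (L2_inner M v h) \<le> L2_norm M g * e" .
    have "cmod (L2_inner M v (\<lambda>x. g x - h x)) \<le> L2_norm M v * L2_norm M (\<lambda>x. g x - h x)"
      by (intro L2_Cauchy_Schwarz v L2_diff g h)
    also have "\<dots> \<le> L2_norm M g * e"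
      using close norm_R_pow_le[OF g, of n] unfolding v_def h_def by (intro mult_mono) auto
    finally have 2: "cmod (L2_inner M v (\<lambda>x. g x - h x)) \<le> L2_norm M g * e" .
    have "L2_inner M v g = L2_inner M v (\<lambda>x. g x - h x) + L2_inner M v h"
      using L2_inner_diff_right[OF g h v] by simp
    then have "cmod (L2_inner M v g) \<le> 2 * e * L2_norm M g"
      using 1 2 norm_triangle_ineq[of "L2_inner M v (\<lambda>x. g x - h x)" "L2_inner M v h"] by (simp add: algebra_simps)
    also have "\<dots> < 2 * e * (L2_norm M g + 1)" using e by simp
    also have "\<dots> = e0" using ng by (simp add: e_def field_simps)
    finally show ?thesis using abs_Re_le_cmod[of "L2_inner M v g"] by (simp add: v_def)
  qed
  then show "\<exists>no. \<forall>n\<ge>no. norm (Re (L2_inner M ((R ^^ n) g) g) - 0) < e0" by blast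
qed

text \<open>Let y = p(S) F_i and t = Re <F_i, y>. Since S y = F_i - R^N F_i by telescoping and <R^N
  F_i, y> has nonnegative real part, Re <S y, y> \<le> t. Domination of the rank one operator gives
  t^2 \<le> Re <S y, y>, so t^2 \<le> t and therefore t \<le> 1.\<close>

lemma geometric_sum_inner_le_1:
  assumes i: "i \<in> I"
  shows "Re (L2_inner M (F i) (\<lambda>x. \<Sum>j<N. (R ^^ j) (F i) x)) \<le> 1"
proof -
  define y where "y x = (\<Sum>j<N. (R ^^ j) (F i) x)" for x
  have Fi: "F i \<in> L2_space M" by (rule F[OF i])
  have y: "y \<in> L2_space M" unfolding y_def by (intro L2_sum R_pow Fi)
  have yl: "L2_inner M y w = (\<Sum>j<N. L2_inner M ((R ^^ j) (F i)) w)" if "w \<in> L2_space M" for w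
    unfolding y_def by (intro L2_inner_sum_left R_pow Fi that)
  define t where "t = Re (L2_inner M (F i) y)"
  have "L2_inner M y y - L2_inner M (R y) y =
      (\<Sum>j<N. L2_inner M ((R ^^ j) (F i)) y - L2_inner M ((R ^^ Suc j) (F i)) y)"
  proof -
    have "L2_inner M (R y) y = (\<Sum>j<N. L2_inner M ((R ^^ Suc j) (F i)) y)"
      unfolding R_selfadjoint[OF y y] yl[OF R[OF y]]
      by (intro sum.cong refl) (simp add: R_selfadjoint[OF R_pow[OF Fi] y])
    then show ?thesis by (simp only: yl[OF y] sum_subtractf)
  qed
  also have "\<dots> = L2_inner M (F i) y - L2_inner M ((R ^^ N) (F i)) y"
    using sum_lessThan_telescope'[of "\<lambda>j. L2_inner M ((R ^^ j) (F i)) y" N] by simp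
  finally have *: "L2_inner M y y - L2_inner M (R y) y = L2_inner M (F i) y - L2_inner M ((R ^^ N) (F i)) y" .
  have "L2_inner M ((R ^^ N) (F i)) y = (\<Sum>j<N. L2_inner M ((R ^^ (N + j)) (F i)) (F i))"
    unfolding y_def using Fi by (subst L2_inner_sum_right) (auto simp: R_pow moment_split)
  then have "0 \<le> Re (L2_inner M ((R ^^ N) (F i)) y)"
    by (simp add: moment_nonneg[OF Fi] sum_nonneg)
  with arg_cong[OF *, of Re] have "(L2_norm M y)\<^sup>2 - Re (L2_inner M (R y) y) \<le> t"
    by (simp add: L2_inner_self t_def del: of_real_power)
  moreover have "t\<^sup>2 \<le> (cmod (L2_inner M y (F i)))\<^sup>2"
    unfolding t_def L2_inner_cnj[of M y "F i", symmetric]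
    using abs_Re_le_cmod[of "L2_inner M y (F i)"] by (simp add: abs_le_square_iff flip: abs_le_square_iff)
  moreover have "(cmod (L2_inner M y (F i)))\<^sup>2 \<le> (L2_norm M y)\<^sup>2 - Re (L2_inner M (R y) y)"
    using finite_sum_le_has_sum[OF energy[OF y], of "{i}"] i by simp
  ultimately have "t * t \<le> t * 1" by (simp add: power2_eq_square)
  then have "t \<le> 1" by (metis mult_le_cancel_left_pos mult_le_0_iff not_le order_le_less_trans zero_le_one linear)
  then show ?thesis by (simp add: t_def y_def[abs_def])
qed

text \<open>The trace argument: \<open>\<Sum>n. \<langle>S p(S) g\<^sub>n, g\<^sub>n\<rangle>\<close> equals \<open>\<langle>f, p(S) f\<rangle> \<le> 1\<close>
  for \<open>p(S) = \<Sum>j<N. (1 - S)\<^sup>j\<close>, and \<open>S p(S) = 1 - (1 - S)\<^sup>N\<close> tends to the identity.\<close>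

theorem trace_bound:
  fixes g :: "nat \<Rightarrow> 'a \<Rightarrow> complex" and W :: "'i \<Rightarrow> ('a \<Rightarrow> complex) \<Rightarrow> 'a \<Rightarrow> complex"
  assumes complete: "complete_family M I F" and i0: "i0 \<in> I"
    and g: "\<And>n. g n \<in> L2_space M"
    and W: "\<And>i u. i \<in> I \<Longrightarrow> u \<in> L2_space M \<Longrightarrow> W i u \<in> L2_space M"
    and adj: "\<And>i u j. i \<in> I \<Longrightarrow> u \<in> L2_space M \<Longrightarrow>
      L2_inner M ((R ^^ j) (F i)) u = L2_inner M ((R ^^ j) (F i0)) (W i u)"
    and parseval: "\<And>u. u \<in> L2_space M \<Longrightarrow>
      ((\<lambda>(n, i). (cmod (L2_inner M u (W i (g n))))\<^sup>2) has_sum (L2_norm M u)\<^sup>2) (UNIV \<times> I)"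
  shows "(\<Sum>n<m. (L2_norm M (g n))\<^sup>2) \<le> 1"
proof -
  let ?f = "F i0"
  have f: "?f \<in> L2_space M" by (rule F[OF i0])
  have bound: "(\<Sum>n<m. (L2_norm M (g n))\<^sup>2 - Re (L2_inner M ((R ^^ N) (g n)) (g n))) \<le> 1" for N
  proof -
    define y where "y x = (\<Sum>j<N. (R ^^ j) ?f x)" for x
    have y: "y \<in> L2_space M" unfolding y_def by (intro L2_sum R_pow f)
    \<comment> \<open>This computes <S p(S) u, u> in two ways: the sum over \<open>j\<close>
      telescopes to <u, u> - <R^N u, u>, while \<open>adj\<close> moves the operator carrying F_i0
      to F_i onto \<open>u\<close>, leaving an expression in \<open>?f\<close> and \<open>y\<close>
      alone.\<close>
    have inner: "((\<lambda>i. L2_inner M ?f (W i u) * L2_inner M (W i u) y) has_sum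
        L2_inner M u u - L2_inner M ((R ^^ N) u) u) I" if u: "u \<in> L2_space M" for u
    proof -
      have "((\<lambda>i. \<Sum>j<N. L2_inner M ((R ^^ j) u) (F i) * L2_inner M (F i) u) has_sum
        (\<Sum>j<N. L2_inner M ((R ^^ j) u) u - L2_inner M ((R ^^ Suc j) u) u)) I"
        using resid[OF R_pow[OF u] u] by (intro has_sum_sum) simp
      also have "(\<Sum>j<N. L2_inner M ((R ^^ j) u) u - L2_inner M ((R ^^ Suc j) u) u)
          = L2_inner M u u - L2_inner M ((R ^^ N) u) u"
        using sum_lessThan_telescope'[of "\<lambda>j. L2_inner M ((R ^^ j) u) u" N] by simp
      finally show ?thesis
      proof (rule has_sum_cong[THEN iffD1, rotated])
        fix i assume i: "i \<in> I"
        have "L2_inner M ((R ^^ j) u) (F i) = L2_inner M (W i u) ((R ^^ j) ?f)" for j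
        proof -
          have "L2_inner M ((R ^^ j) u) (F i) = L2_inner M u ((R ^^ j) (F i))"
            by (rule R_pow_selfadjoint[OF u F[OF i]])
          also have "\<dots> = cnj (L2_inner M ((R ^^ j) (F i)) u)" by (simp add: L2_inner_cnj)
          also have "\<dots> = L2_inner M (W i u) ((R ^^ j) ?f)" by (simp add: adj[OF i u] L2_inner_cnj)
          finally show ?thesis .
        qed
        moreover have "L2_inner M (W i u) y = (\<Sum>j<N. L2_inner M (W i u) ((R ^^ j) ?f))"
          unfolding y_def by (intro L2_inner_sum_right R_pow f W i u)
        ultimately show "(\<Sum>j<N. L2_inner M ((R ^^ j) u) (F i) * L2_inner M (F i) u)
          = L2_inner M ?f (W i u) * L2_inner M (W i u) y"
          using adj[OF i u, of 0] by (simp add: sum_distrib_left mult.commute)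
      qed
    qed
    \<comment> \<open>Parseval over all pairs (n, i) evaluates the whole sum as <f, y>. Summing over
      \<open>i\<close> first recovers the terms <S p(S) g_n, g_n>; they are nonnegative, so every
      finite part is bounded by the total.\<close>
    have "((\<lambda>p. L2_inner M ?f (case p of (n, i) \<Rightarrow> W i (g n)) * L2_inner M (case p of (n, i) \<Rightarrow> W i (g n)) y)
        has_sum L2_inner M ?f y) (UNIV \<times> I)"
    proof (rule Parseval_polarization[OF _ _ f y])
      fix u assume "u \<in> L2_space M"
      from parseval[OF this]
      show "((\<lambda>p. (cmod (L2_inner M u (case p of (n, i) \<Rightarrow> W i (g n))))\<^sup>2) has_sum (L2_norm M u)\<^sup>2) (UNIV \<times> I)"
        by (simp add: case_prod_unfold)
    qed (use W g in auto)
    then have "((\<lambda>n. L2_inner M (g n) (g n) - L2_inner M ((R ^^ N) (g n)) (g n)) has_sum L2_inner M ?f y) UNIV"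
      by (rule has_sum_SigmaD) (use inner[OF g] in simp)
    from has_sum_Re[OF this]
    have "((\<lambda>n. (L2_norm M (g n))\<^sup>2 - Re (L2_inner M ((R ^^ N) (g n)) (g n))) has_sum Re (L2_inner M ?f y)) UNIV"
      by (simp add: L2_inner_self del: of_real_power)
    then have "(\<Sum>n<m. (L2_norm M (g n))\<^sup>2 - Re (L2_inner M ((R ^^ N) (g n)) (g n))) \<le> Re (L2_inner M ?f y)"
    proof (rule finite_sum_le_has_sum)
      fix n
      have "decseq (\<lambda>k. Re (L2_inner M ((R ^^ k) (g n)) (g n)))"
        unfolding decseq_Suc_iff using moment_decreasing[OF g] by blast
      from decseqD[OF this, of 0 N]
      show "0 \<le> (L2_norm M (g n))\<^sup>2 - Re (L2_inner M ((R ^^ N) (g n)) (g n))"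
        by (simp add: L2_inner_self)
    qed auto
    also have "\<dots> \<le> 1" using geometric_sum_inner_le_1[OF i0, of N] by (simp add: y_def[abs_def])
    finally show ?thesis .
  qed
  \<comment> \<open>The number \<open>m\<close> of test functions is fixed while \<open>N\<close>
    grows, so the limit passes through a finite sum.\<close>
  have "(\<lambda>N. \<Sum>n<m. (L2_norm M (g n))\<^sup>2 - Re (L2_inner M ((R ^^ N) (g n)) (g n)))
      \<longlonglongrightarrow> (\<Sum>n<m. (L2_norm M (g n))\<^sup>2 - 0)"
    by (intro tendsto_intros moments_tendsto_0 complete g)
  from LIMSEQ_le_const2[OF this] bound show ?thesis by auto
qed

end

lemma frame_residual_exists:
  assumes F: "\<And>i. i \<in> I \<Longrightarrow> F i \<in> L2_space M"
    and bessel: "\<And>g J. g \<in> L2_space M \<Longrightarrow> finite J \<Longrightarrow> J \<subseteq> I \<Longrightarrow>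
      (\<Sum>i\<in>J. (cmod (L2_inner M g (F i)))\<^sup>2) \<le> (L2_norm M g)\<^sup>2"
  obtains R where "frame_residual M I F R"
proof -
  have "\<forall>g\<in>L2_space M. \<exists>v. v \<in> L2_space M \<and> (\<forall>u\<in>L2_space M.
      ((\<lambda>i. L2_inner M g (F i) * L2_inner M (F i) u) has_sum L2_inner M v u) I)"
    using frame_operator_exists[OF F bessel] by blast
  then obtain T where "\<forall>g\<in>L2_space M. T g \<in> L2_space M \<and> (\<forall>u\<in>L2_space M.
      ((\<lambda>i. L2_inner M g (F i) * L2_inner M (F i) u) has_sum L2_inner M (T g) u) I)"
    by (rule bchoice[THEN exE])
  then have T: "\<And>g. g \<in> L2_space M \<Longrightarrow> T g \<in> L2_space M"
    and sum: "\<And>g u. g \<in> L2_space M \<Longrightarrow> u \<in> L2_space M \<Longrightarrow>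
      ((\<lambda>i. L2_inner M g (F i) * L2_inner M (F i) u) has_sum L2_inner M (T g) u) I"
    by blast+
  have "frame_residual M I F (\<lambda>g x. g x - T g x)"
  proof
    fix g u assume g: "g \<in> L2_space M" and u: "u \<in> L2_space M"
    show "((\<lambda>i. L2_inner M g (F i) * L2_inner M (F i) u) has_sum
        L2_inner M g u - L2_inner M (\<lambda>x. g x - T g x) u) I"
      using sum[OF g u] g u by (simp add: L2_inner_diff_left T)
  qed (use F bessel T in \<open>auto intro: L2_diff\<close>)
  then show ?thesis by (rule that)
qed

context frame_residual
begin

text \<open>Linearity is not among the locale assumptions, and it can hold only up to null sets. It
  is recovered inside inner products by moving \<open>R\<close> to the test function.\<close>

lemma R_add:
  assumes "u \<in> L2_space M" "v \<in> L2_space M" "w \<in> L2_space M"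
  shows "L2_inner M (R (\<lambda>x. u x + v x)) w = L2_inner M (R u) w + L2_inner M (R v) w"
  using assms by (simp add: R_selfadjoint L2_add L2_inner_add_left R)

lemma R_diff:
  assumes "u \<in> L2_space M" "v \<in> L2_space M" "w \<in> L2_space M"
  shows "L2_inner M (R (\<lambda>x. u x - v x)) w = L2_inner M (R u) w - L2_inner M (R v) w"
  using assms by (simp add: R_selfadjoint L2_diff L2_inner_diff_left R)

lemma R_scale:
  assumes "u \<in> L2_space M" "w \<in> L2_space M"
  shows "L2_inner M (R (\<lambda>x. c * u x)) w = c * L2_inner M (R u) w"
  using assms by (simp add: R_selfadjoint L2_scale L2_inner_scale_left R)

lemma R_bounded:
  assumes "u \<in> L2_space M" "v \<in> L2_space M"
  shows "cmod (L2_inner M (R u) v) \<le> L2_norm M u * L2_norm M v"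
proof -
  have "cmod (L2_inner M (R u) v) \<le> L2_norm M (R u) * L2_norm M v"
    by (intro L2_Cauchy_Schwarz R assms)
  also have "\<dots> \<le> L2_norm M u * L2_norm M v"
    using norm_R_pow_le[OF assms(1), of 1] by (intro mult_right_mono) auto
  finally show ?thesis .
qed

end

section \<open>Nonnegative sums as integrals for counting measure, in order to apply Tonelli\<close>

lemma nn_integral_count_space_has_sum:
  fixes f :: "'a \<Rightarrow> real"
  assumes "(f has_sum s) A" "\<And>x. x \<in> A \<Longrightarrow> 0 \<le> f x"
  shows "(\<integral>\<^sup>+x. ennreal (f x) \<partial>count_space A) = ennreal s"
proof -
  have "f summable_on A" using assms(1) by (rule has_sum_imp_summable)
  then have "(\<lambda>x. norm (f x)) summable_on A" by (rule summable_on_iff_abs_summable_on_real[THEN iffD1])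
  then have abs: "Infinite_Set_Sum.abs_summable_on f A" by (rule abs_summable_equivalent[THEN iffD1])
  have "(\<integral>\<^sup>+x. ennreal (f x) \<partial>count_space A) = ennreal (infsetsum f A)"
    by (rule nn_integral_conv_infsetsum[OF abs assms(2)])
  also have "infsetsum f A = s"
    using infsetsum_infsum[OF abs] infsumI[OF assms(1)] by simp
  finally show ?thesis .
qed

lemma has_sum_nn_integral_count_space:
  fixes f :: "'a \<Rightarrow> real"
  assumes "(\<integral>\<^sup>+x. ennreal (f x) \<partial>count_space A) = ennreal s" "\<And>x. x \<in> A \<Longrightarrow> 0 \<le> f x" "0 \<le> s"
  shows "(f has_sum s) A"
proof -
  have "f summable_on A"
  proof (rule nonneg_bdd_above_summable_on[OF assms(2) bdd_aboveI2[where M=s]])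
    fix J assume J: "J \<in> {F. F \<subseteq> A \<and> finite F}"
    have "ennreal (sum f J) = (\<Sum>x\<in>J. ennreal (f x))"
      using J assms(2) by (subst sum_ennreal) auto
    also have "\<dots> = (\<integral>\<^sup>+x. ennreal (f x) \<partial>count_space J)"
      using J by (simp add: nn_integral_count_space_finite)
    also have "\<dots> \<le> (\<integral>\<^sup>+x. ennreal (f x) \<partial>count_space A)"
      using J by (auto simp: nn_integral_count_space_indicator intro!: nn_integral_mono split: split_indicator)
    finally show "sum f J \<le> s" using assms(1,3) by (simp add: ennreal_le_iff)
  qed auto
  then have "(f has_sum infsum f A) A" by simp
  moreover from nn_integral_count_space_has_sum[OF this assms(2)] assms(1,3) have "infsum f A = s"
    using infsum_nonneg[of A f, OF assms(2)] by simp
  ultimately show ?thesis by simp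
qed

section \<open>Haar measures\<close>

lemma image_add_eq_vimage: "(\<lambda>y. a + y) ` U = (\<lambda>x::'b::ab_group_add. x + (- a)) -` U"
proof (intro set_eqI iffI)
  fix x assume "x \<in> (\<lambda>x. x + (- a)) -` U"
  then show "x \<in> (\<lambda>y. a + y) ` U" by (intro image_eqI[of _ _ "x + (- a)"]) auto
qed auto

lemma measurable_translate:
  "(\<lambda>x::'b::topological_ab_group_add. x + a) \<in> borel_measurable borel"
  by (intro borel_measurable_continuous_onI continuous_intros)

lemma haar_sets: "haar_measure \<mu> \<Longrightarrow> sets \<mu> = sets borel"
  by (simp add: haar_measure_def)

lemma haar_space: "haar_measure \<mu> \<Longrightarrow> space \<mu> = UNIV"
  using sets_eq_imp_space_eq[of \<mu> borel] by (simp add: haar_measure_def)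

lemma haar_translate:
  fixes \<mu> :: "'b::topological_ab_group_add measure"
  assumes "haar_measure \<mu>" "A \<in> sets borel"
  shows "emeasure \<mu> ((\<lambda>y. x + y) ` A) = emeasure \<mu> A"
proof -
  have "\<forall>x. \<forall>A\<in>sets borel. emeasure \<mu> ((\<lambda>y. x + y) ` A) = emeasure \<mu> A"
    using assms(1) unfolding haar_measure_def by (elim conjE)
  then show ?thesis using assms(2) by blast
qed

lemma haar_distr:
  fixes \<mu> :: "'b::topological_ab_group_add measure"
  assumes "haar_measure \<mu>"
  shows "distr \<mu> \<mu> (\<lambda>x. x + a) = \<mu>"
proof (rule measure_eqI)
  note [measurable_cong] = haar_sets[OF assms]
  have meas: "(\<lambda>x. x + a) \<in> measurable \<mu> \<mu>"
    using measurable_translate[of a] by (simp add: measurable_cong_sets[OF haar_sets[OF assms] haar_sets[OF assms]])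
  fix A assume "A \<in> sets (distr \<mu> \<mu> (\<lambda>x. x + a))"
  then have A: "A \<in> sets \<mu>" by simp
  have "(\<lambda>x. x + a) -` A = (\<lambda>y. - a + y) ` A"
    by (simp only: image_add_eq_vimage minus_minus)
  then have "emeasure (distr \<mu> \<mu> (\<lambda>x. x + a)) A = emeasure \<mu> ((\<lambda>y. - a + y) ` A)"
    using A meas by (simp add: emeasure_distr haar_space[OF assms])
  also have "\<dots> = emeasure \<mu> A"
    using A haar_sets[OF assms] by (intro haar_translate[OF assms]) simp
  finally show "emeasure (distr \<mu> \<mu> (\<lambda>x. x + a)) A = emeasure \<mu> A" .
qed simp

lemma haar_translate_measurable:
  fixes \<mu> :: "'b::topological_ab_group_add measure"
  assumes "haar_measure \<mu>"
  shows "(\<lambda>x. x + a) \<in> measurable \<mu> \<mu>"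
  using measurable_translate[of a] by (simp add: measurable_cong_sets[OF haar_sets[OF assms] haar_sets[OF assms]])

lemma haar_nn_integral_translate:
  fixes \<mu> :: "'b::topological_ab_group_add measure"
  assumes "haar_measure \<mu>" "f \<in> borel_measurable \<mu>"
  shows "(\<integral>\<^sup>+x. f (x + a) \<partial>\<mu>) = (\<integral>\<^sup>+x. f x \<partial>\<mu>)"
proof -
  have "(\<integral>\<^sup>+x. f x \<partial>\<mu>) = (\<integral>\<^sup>+x. f x \<partial>distr \<mu> \<mu> (\<lambda>x. x + a))"
    by (simp add: haar_distr[OF assms(1)])
  also have "\<dots> = (\<integral>\<^sup>+x. f (x + a) \<partial>\<mu>)"
    by (rule nn_integral_distr[OF haar_translate_measurable[OF assms(1)]]) (simp add: assms(2))
  finally show ?thesis by simp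
qed

lemma haar_integral_translate:
  fixes \<mu> :: "'b::topological_ab_group_add measure" and f :: "'b \<Rightarrow> complex"
  assumes "haar_measure \<mu>" "f \<in> borel_measurable \<mu>"
  shows "(LINT x|\<mu>. f (x + a)) = (LINT x|\<mu>. f x)"
proof -
  have "(LINT x|\<mu>. f x) = (LINT x|distr \<mu> \<mu> (\<lambda>x. x + a). f x)"
    by (simp add: haar_distr[OF assms(1)])
  also have "\<dots> = (LINT x|\<mu>. f (x + a))"
    by (rule integral_distr[OF haar_translate_measurable[OF assms(1)] assms(2)])
  finally show ?thesis by simp
qed

lemma haar_compact_finite:
  fixes \<mu> :: "'b::{topological_ab_group_add,t2_space} measure"
  assumes "haar_measure \<mu>" "compact K"
  shows "emeasure \<mu> K < \<infinity>" "K \<in> sets \<mu>"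
proof -
  have K: "K \<in> sets borel" by (intro borel_closed compact_imp_closed assms)
  then show "K \<in> sets \<mu>" by (simp add: haar_sets[OF assms(1)])
  have "\<forall>K\<in>sets borel. compact K \<longrightarrow> emeasure \<mu> K < \<infinity>"
    using assms(1) unfolding haar_measure_def by (elim conjE)
  then show "emeasure \<mu> K < \<infinity>" using K assms(2) by blast
qed

lemma open_image_add:
  fixes U :: "'b::topological_ab_group_add set"
  assumes "open U"
  shows "open ((\<lambda>y. a + y) ` U)"
proof -
  have "open ((\<lambda>x. x + (- a)) -` U)"
    by (intro open_vimage assms continuous_intros)
  then show ?thesis by (simp only: image_add_eq_vimage)
qed

text \<open>If U were null, every compact set would be null, being covered by finitely many
  translates of U; inner regularity of the whole group would then make the measure zero.\<close>

lemma haar_open_pos: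
  fixes \<mu> :: "'b::{topological_ab_group_add,t2_space} measure"
  assumes "haar_measure \<mu>" "open U" "U \<noteq> {}"
  shows "0 < emeasure \<mu> U"
proof (rule ccontr)
  assume "\<not> 0 < emeasure \<mu> U"
  then have U0: "emeasure \<mu> U = 0" by (simp add: zero_less_iff_neq_zero)
  obtain z where z: "z \<in> U" using assms by auto
  have U: "U \<in> sets borel" using assms(2) by simp
  have tr: "emeasure \<mu> ((\<lambda>y. a + y) ` U) = 0" for a
    using haar_translate[OF assms(1) U] U0 by simp
  have "emeasure \<mu> K = 0" if K: "compact K" for K
  proof -
    have cover: "K \<subseteq> (\<Union>a\<in>UNIV. (\<lambda>y. a + y) ` U)"
    proof
      fix x assume "x \<in> K"
      have "x = (x - z) + z" by simp
      then show "x \<in> (\<Union>a\<in>UNIV. (\<lambda>y. a + y) ` U)" using z by blast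
    qed
    obtain C where C: "finite C" "K \<subseteq> (\<Union>a\<in>C. (\<lambda>y. a + y) ` U)"
      using compactE_image[OF K _ cover] open_image_add[OF assms(2)] by metis
    have "emeasure \<mu> K \<le> emeasure \<mu> (\<Union>a\<in>C. (\<lambda>y. a + y) ` U)"
      using C open_image_add[OF assms(2)]
      by (intro emeasure_mono C) (auto simp: haar_sets[OF assms(1)])
    also have "\<dots> \<le> (\<Sum>a\<in>C. emeasure \<mu> ((\<lambda>y. a + y) ` U))"
      using C open_image_add[OF assms(2)]
      by (intro emeasure_subadditive_finite) (auto simp: haar_sets[OF assms(1)])
    also have "\<dots> = 0" by (simp add: tr)
    finally show ?thesis by simp
  qed
  moreover have "emeasure \<mu> UNIV = (SUP K\<in>{K. compact K \<and> K \<subseteq> UNIV}. emeasure \<mu> K)"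
    using assms(1) open_UNIV unfolding haar_measure_def by blast
  moreover have "emeasure \<mu> UNIV \<noteq> 0" using assms(1) unfolding haar_measure_def by blast
  moreover have "{K::'b set. compact K} \<noteq> {}" using compact_empty by blast
  ultimately show False by (auto simp: SUP_constant bot_ennreal split: if_splits)
qed

text \<open>On the dual group this stands in for local compactness: it supplies small compact sets
  of positive finite measure to average over.\<close>

lemma haar_inner_compact:
  fixes \<mu> :: "'b::{topological_ab_group_add,t2_space} measure"
  assumes "haar_measure \<mu>" "open U" "U \<noteq> {}"
  obtains L where "compact L" "L \<subseteq> U" "0 < emeasure \<mu> L" "emeasure \<mu> L < \<infinity>"
proof -
  have "0 < (SUP K\<in>{K. compact K \<and> K \<subseteq> U}. emeasure \<mu> K)"
    using haar_open_pos[OF assms] assms(1,2) unfolding haar_measure_def by metis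
  then obtain L where "compact L" "L \<subseteq> U" "0 < emeasure \<mu> L"
    unfolding less_SUP_iff by blast
  then show ?thesis using that haar_compact_finite[OF assms(1)] by blast
qed

lemma open_diff_nbhd:
  fixes T :: "'b::topological_ab_group_add set"
  assumes "open T" "0 \<in> T"
  obtains U where "open U" "0 \<in> U" "\<And>x y. x \<in> U \<Longrightarrow> y \<in> U \<Longrightarrow> x - y \<in> T"
proof -
  have "((\<lambda>p. fst p - snd p) \<longlongrightarrow> 0 - (0::'b)) (nhds 0 \<times>\<^sub>F nhds 0)"
    by (intro tendsto_diff filterlim_fst filterlim_snd)
  then have "\<forall>\<^sub>F p in nhds 0 \<times>\<^sub>F nhds 0. fst p - snd p \<in> T"
    using assms by (auto dest: topological_tendstoD)
  then obtain P Q where P: "\<forall>\<^sub>F x in nhds (0::'b). P x" and Q: "\<forall>\<^sub>F y in nhds (0::'b). Q y"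
    and PQ: "\<And>x y. P x \<Longrightarrow> Q y \<Longrightarrow> x - y \<in> T"
    unfolding eventually_prod_filter by auto
  from P Q obtain U V where "open U" "0 \<in> U" "\<forall>x\<in>U. P x" "open V" "0 \<in> V" "\<forall>x\<in>V. Q x"
    unfolding eventually_nhds by auto
  then show ?thesis using PQ by (intro that[of "U \<inter> V"]) auto
qed

section \<open>Periodization on the dual group\<close>

text \<open>Characters need not be square integrable, so they are cut off to a set. The inner
  product of u with \<open>char_on K \<xi>\<close> is the Fourier transform of the restriction of u
  to K, evaluated at \<xi>.\<close>

definition char_on :: "'a::topological_ab_group_add set \<Rightarrow> 'a dual \<Rightarrow> 'a \<Rightarrow> complex" where
  "char_on K \<xi> x = indicator K x * eval_char \<xi> x"

lemma eval_char_cnj_mult [simp]: "cnj (eval_char \<xi> x) * eval_char \<xi> x = 1"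
  "eval_char \<xi> x * cnj (eval_char \<xi> x) = 1"
  by (simp_all add: mult.commute flip: complex_norm_square)

lemma eval_char_zero_arg [simp]: "eval_char \<xi> 0 = 1"
proof -
  have "eval_char \<xi> 0 * eval_char \<xi> 0 = eval_char \<xi> 0"
    using eval_char_add_arg[of \<xi> 0 0] by simp
  moreover have "eval_char \<xi> 0 \<noteq> 0" using norm_eval_char[of \<xi> 0] by (metis norm_zero zero_neq_one)
  ultimately show ?thesis by simp
qed

lemma eval_char_uminus_arg: "eval_char \<xi> (- x) = cnj (eval_char \<xi> x)"
proof -
  have "eval_char \<xi> x * eval_char \<xi> (- x) = 1" using eval_char_add_arg[of \<xi> x "- x"] by simp
  then have "cnj (eval_char \<xi> x) * (eval_char \<xi> x * eval_char \<xi> (- x)) = cnj (eval_char \<xi> x)" by simp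
  then show ?thesis by (simp flip: mult.assoc)
qed

lemma eval_char_diff_arg: "eval_char \<xi> (x - y) = eval_char \<xi> x * cnj (eval_char \<xi> y)"
  unfolding diff_conv_add_uminus[of x] by (simp only: eval_char_add_arg eval_char_uminus_arg)

locale dual_lattice =
  fixes \<mu> :: "'a::{topological_ab_group_add, t2_space, second_countable_topology} measure"
    and \<nu> :: "'a dual measure" and \<Gamma> :: "'a dual set"
  assumes dual: "dual_haar_measures \<mu> \<nu>"
    and lattice: "uniform_lattice \<Gamma>" and countable_lattice: "countable \<Gamma>"
begin

lemma haar: "haar_measure \<mu>" "haar_measure \<nu>"
  using dual by (auto simp: dual_haar_measures_def)

lemmas sets_\<mu> [measurable_cong] = haar_sets[OF haar(1)]
lemmas sets_\<nu> [measurable_cong] = haar_sets[OF haar(2)]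

lemma space_\<mu> [simp]: "space \<mu> = UNIV" by (rule haar_space[OF haar(1)])
lemma space_\<nu> [simp]: "space \<nu> = UNIV" by (rule haar_space[OF haar(2)])

lemma eval_char_measurable [measurable]: "eval_char \<xi> \<in> borel_measurable borel"
  by (intro borel_measurable_continuous_onI continuous_eval_char)

lemma subgroup: "0 \<in> \<Gamma>" "\<And>x y. x \<in> \<Gamma> \<Longrightarrow> y \<in> \<Gamma> \<Longrightarrow> x + y \<in> \<Gamma>" "\<And>x. x \<in> \<Gamma> \<Longrightarrow> - x \<in> \<Gamma>"
  "\<And>x y. x \<in> \<Gamma> \<Longrightarrow> y \<in> \<Gamma> \<Longrightarrow> x - y \<in> \<Gamma>"
proof -
  show a: "0 \<in> \<Gamma>" "\<And>x y. x \<in> \<Gamma> \<Longrightarrow> y \<in> \<Gamma> \<Longrightarrow> x + y \<in> \<Gamma>" "\<And>x. x \<in> \<Gamma> \<Longrightarrow> - x \<in> \<Gamma>"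
    using lattice by (auto simp: uniform_lattice_def add_subgroup_def)
  show "\<And>x y. x \<in> \<Gamma> \<Longrightarrow> y \<in> \<Gamma> \<Longrightarrow> x - y \<in> \<Gamma>"
    using a(2,3) unfolding diff_conv_add_uminus by blast
qed

lemma L2_mult_char: "u \<in> L2_space \<mu> \<Longrightarrow> (\<lambda>x. eval_char \<xi> x * u x) \<in> L2_space \<mu>"
  by (rule L2_mult(1)[of u \<mu> "eval_char \<xi>" 1]) auto

lemma L2_mult_indicator:
  assumes "u \<in> L2_space \<mu>" "A \<in> sets borel"
  shows "(\<lambda>x. indicator A x * u x) \<in> L2_space \<mu>" "L2_norm \<mu> (\<lambda>x. indicator A x * u x) \<le> L2_norm \<mu> u"
proof -
  have "(indicator A :: 'a \<Rightarrow> complex) \<in> borel_measurable \<mu>" using assms(2) by measurable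
  from L2_mult[OF assms(1) this, of 1]
  show "(\<lambda>x. indicator A x * u x) \<in> L2_space \<mu>" "L2_norm \<mu> (\<lambda>x. indicator A x * u x) \<le> L2_norm \<mu> u"
    by (auto simp: indicator_def)
qed

context
  fixes K :: "'a set"
  assumes K: "compact K"
begin

lemma K_sets [measurable]: "K \<in> sets borel"
  by (intro borel_closed compact_imp_closed K)

lemma K_finite: "emeasure \<mu> K < \<infinity>"
  by (rule haar_compact_finite(1)[OF haar(1) K])

lemma bounded_on_K_L2:
  assumes [measurable]: "m \<in> borel_measurable borel" and "\<And>x. x \<in> K \<Longrightarrow> cmod (m x) \<le> c" "0 \<le> c"
  shows "(\<lambda>x. indicator K x * m x) \<in> L2_space \<mu>"
    "L2_norm \<mu> (\<lambda>x. indicator K x * m x) \<le> c * sqrt (measure \<mu> K)"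
proof -
  have i: "(\<lambda>x. (cmod (indicator K x :: complex))\<^sup>2) = (\<lambda>x. indicator K x :: real)"
    by (auto simp: indicator_def)
  have "integrable \<mu> (indicator K :: 'a \<Rightarrow> real)"
    using K_finite by (simp add: sets_\<mu>)
  then have 1: "(indicator K :: 'a \<Rightarrow> complex) \<in> L2_space \<mu>"
    by (simp add: L2_space_def i)
  have 2: "L2_norm \<mu> (indicator K :: 'a \<Rightarrow> complex) = sqrt (measure \<mu> K)"
    by (simp add: L2_norm_def i sets_\<mu>)
  have "(\<lambda>x. indicator K x * m x) \<in> borel_measurable \<mu>" by measurable
  from L2_dominated[OF this 1 assms(3)] 2 assms(2,3)
  show "(\<lambda>x. indicator K x * m x) \<in> L2_space \<mu>"
    "L2_norm \<mu> (\<lambda>x. indicator K x * m x) \<le> c * sqrt (measure \<mu> K)"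
    by (auto simp: indicator_def)
qed

lemma char_on_L2: "char_on K \<xi> \<in> L2_space \<mu>"
  using bounded_on_K_L2(1)[of "eval_char \<xi>" 1] by (simp add: char_on_def[abs_def])

lemma norm_char_on: "L2_norm \<mu> (char_on K \<xi>) \<le> sqrt (measure \<mu> K)"
  using bounded_on_K_L2(2)[of "eval_char \<xi>" 1] by (simp add: char_on_def[abs_def])

lemma inner_char_on_add:
  "L2_inner \<mu> u (char_on K (\<gamma> + \<xi>)) = L2_inner \<mu> (\<lambda>x. eval_char (- \<xi>) x * u x) (char_on K \<gamma>)"
  unfolding L2_inner_def by (rule Bochner_Integration.integral_cong)
    (auto simp: char_on_def eval_char_plus eval_char_uminus)

lemma inner_char_on_restrict:
  "L2_inner \<mu> (\<lambda>x. indicator K x * u x) (char_on K \<gamma>) = L2_inner \<mu> u (char_on K \<gamma>)"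
  unfolding L2_inner_def by (rule Bochner_Integration.integral_cong)
    (auto simp: char_on_def indicator_def)

text \<open>Nearby points of the dual group are characters uniformly close on K, and K has finite
  measure, so the cut-off characters are close in the L2 norm. Measurability on the dual group rests
  on this.\<close>

lemma inner_char_on_continuous:
  assumes u: "u \<in> L2_space \<mu>"
  shows "continuous_on UNIV (\<lambda>\<xi>. L2_inner \<mu> u (char_on K \<xi>))"
  unfolding continuous_on_def
proof (intro ballI tendstoI)
  fix \<xi> :: "'a dual" and e :: real assume "e > 0"
  define c where "c = L2_norm \<mu> u * sqrt (measure \<mu> K) + 1"
  have "0 \<le> L2_norm \<mu> u * sqrt (measure \<mu> K)" by simp
  then have c: "c > 0" unfolding c_def by linarith
  define d where "d = e / c"
  have d: "d > 0" using \<open>e > 0\<close> c by (simp add: d_def)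
  have "\<forall>\<^sub>F \<psi> in nhds \<xi>. dist (L2_inner \<mu> u (char_on K \<psi>)) (L2_inner \<mu> u (char_on K \<xi>)) < e"
    using eventually_dual_nbhd[OF K d, of \<xi>]
  proof eventually_elim
    case (elim \<psi>)
    have "(\<lambda>x. char_on K \<psi> x - char_on K \<xi> x) = (\<lambda>x. indicator K x * (eval_char \<psi> x - eval_char \<xi> x))"
      by (auto simp: char_on_def right_diff_distrib)
    then have n: "L2_norm \<mu> (\<lambda>x. char_on K \<psi> x - char_on K \<xi> x) \<le> d * sqrt (measure \<mu> K)"
      using bounded_on_K_L2(2)[of "\<lambda>x. eval_char \<psi> x - eval_char \<xi> x" d] elim d
      by (auto simp: dual_nbhd_def dist_norm less_imp_le)
    have "dist (L2_inner \<mu> u (char_on K \<psi>)) (L2_inner \<mu> u (char_on K \<xi>))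
        = cmod (L2_inner \<mu> u (\<lambda>x. char_on K \<psi> x - char_on K \<xi> x))"
      by (simp add: dist_norm L2_inner_diff_right u char_on_L2)
    also have "\<dots> \<le> L2_norm \<mu> u * L2_norm \<mu> (\<lambda>x. char_on K \<psi> x - char_on K \<xi> x)"
      by (intro L2_Cauchy_Schwarz u L2_diff char_on_L2)
    also have "\<dots> \<le> L2_norm \<mu> u * (d * sqrt (measure \<mu> K))"
      using n by (intro mult_left_mono) auto
    also have "\<dots> < d * c" using d by (simp add: c_def algebra_simps)
    also have "\<dots> = e" using c by (simp add: d_def)
    finally show ?case .
  qed
  then show "\<forall>\<^sub>F \<psi> in at \<xi>. dist (L2_inner \<mu> u (char_on K \<psi>)) (L2_inner \<mu> u (char_on K \<xi>)) < e"
    by (simp add: eventually_nhds_conv_at)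
qed

lemma inner_char_on_measurable [measurable]:
  assumes "u \<in> L2_space \<mu>"
  shows "(\<lambda>\<xi>. L2_inner \<mu> u (char_on K \<xi>)) \<in> borel_measurable borel"
  by (intro borel_measurable_continuous_onI inner_char_on_continuous assms)

text \<open>Cutting off to the set K of finite measure puts u into the intersection of L1 and L2,
  where the normalization of the dual measures applies.\<close>

lemma Plancherel_char_on:
  assumes u: "u \<in> L2_space \<mu>"
  shows "(\<integral>\<^sup>+\<xi>. ennreal ((cmod (L2_inner \<mu> u (char_on K \<xi>)))\<^sup>2) \<partial>\<nu>)
    = ennreal ((L2_norm \<mu> (\<lambda>x. indicator K x * u x))\<^sup>2)"
proof -
  let ?v = "\<lambda>x. indicator K x * u x"
  have v: "?v \<in> L2_space \<mu>" by (intro L2_mult_indicator u K_sets)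
  have "integrable \<mu> (\<lambda>x. u x * cnj (char_on K 0 x))"
    by (intro L2_integrable_mult_cnj u char_on_L2)
  moreover have "(\<lambda>x. u x * cnj (char_on K 0 x)) = ?v"
    by (auto simp: char_on_def eval_char_zero indicator_def)
  ultimately have int: "integrable \<mu> ?v" by simp
  have ft: "fourier_transform \<mu> ?v \<xi> = L2_inner \<mu> u (char_on K \<xi>)" for \<xi>
    unfolding L2_inner_def fourier_transform_def
    by (rule Bochner_Integration.integral_cong) (simp_all add: char_on_def indicator_def)
  have "(\<integral>\<^sup>+\<xi>. ennreal ((cmod (fourier_transform \<mu> ?v \<xi>))\<^sup>2) \<partial>\<nu>)
    = (\<integral>\<^sup>+x. ennreal ((cmod (?v x))\<^sup>2) \<partial>\<mu>)"
    using dual v int unfolding dual_haar_measures_def by blast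
  then show ?thesis by (simp only: ft L2_nn_integral[OF v])
qed

end

end

lemma borel_section_unique:
  assumes "borel_section H S" "add_subgroup H"
  shows "\<exists>!h. h \<in> H \<and> x - h \<in> S"
proof -
  have "\<exists>!s. s \<in> S \<and> s \<in> add_coset H x"
    using assms(1) unfolding borel_section_def by blast
  then obtain s where s: "s \<in> S" "s \<in> add_coset H x"
    and uniq: "\<And>t. t \<in> S \<Longrightarrow> t \<in> add_coset H x \<Longrightarrow> t = s" by metis
  obtain h where h: "h \<in> H" "s = x + h" using s(2) by (auto simp: add_coset_def)
  have neg: "\<And>k. k \<in> H \<Longrightarrow> - k \<in> H" using assms(2) by (auto simp: add_subgroup_def)
  show ?thesis
  proof (rule ex1I[of _ "- h"])
    show "- h \<in> H \<and> x - (- h) \<in> S" using h s neg by simp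
    fix k assume k: "k \<in> H \<and> x - k \<in> S"
    then have "x - k \<in> add_coset H x"
      using neg[of k] unfolding add_coset_def by (intro image_eqI[of _ _ "- k"]) auto
    with uniq[of "x - k"] k h show "k = - h" by (metis add_left_cancel diff_conv_add_uminus minus_minus)
  qed
qed

lemma nn_integral_count_space_unique:
  fixes c :: ennreal
  assumes "\<exists>!h. h \<in> H \<and> P h"
  shows "(\<integral>\<^sup>+h. c * indicator {h. P h} h \<partial>count_space H) = c"
proof -
  obtain h0 where h0: "h0 \<in> H" "P h0" and u: "\<And>h. h \<in> H \<Longrightarrow> P h \<Longrightarrow> h = h0"
    using assms by metis
  have "(\<integral>\<^sup>+h. c * indicator {h. P h} h \<partial>count_space H) = (\<integral>\<^sup>+h. c * indicator {h0} h \<partial>count_space H)"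
  proof (rule nn_integral_cong)
    fix h assume "h \<in> space (count_space H)"
    then have "P h \<longleftrightarrow> h = h0" using h0 u[of h] by auto
    then show "c * indicator {h. P h} h = c * indicator {h0} h" by (simp add: indicator_def)
  qed
  also have "\<dots> = c" using h0 by (simp add: nn_integral_cmult_indicator)
  finally show ?thesis .
qed

section \<open>A Bessel bound for the lattice characters on a compact set\<close>

context dual_lattice
begin

text \<open>Discreteness at 0 together with continuity of subtraction: a neighbourhood whose
  differences meet \<Gamma> only in 0 has pairwise disjoint translates under \<Gamma>.\<close>

lemma lattice_separated:
  obtains U where "open U" "0 \<in> U"
    "\<And>\<gamma> \<gamma>' x y. \<gamma> \<in> \<Gamma> \<Longrightarrow> \<gamma>' \<in> \<Gamma> \<Longrightarrow> x \<in> U \<Longrightarrow> y \<in> U \<Longrightarrow> \<gamma> + x = \<gamma>' + y \<Longrightarrow> \<gamma> = \<gamma>'"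
proof -
  obtain T where T: "open T" "T \<inter> \<Gamma> = {0}"
    using lattice subgroup(1) unfolding uniform_lattice_def discrete_def isolated_in_def by blast
  then have "0 \<in> T" by blast
  from open_diff_nbhd[OF T(1) this] obtain U where U: "open U" "0 \<in> U"
    "\<And>x y. x \<in> U \<Longrightarrow> y \<in> U \<Longrightarrow> x - y \<in> T" by metis
  show ?thesis
  proof (rule that[OF U(1,2)])
    fix \<gamma> \<gamma>' x y assume *: "\<gamma> \<in> \<Gamma>" "\<gamma>' \<in> \<Gamma>" "x \<in> U" "y \<in> U" "\<gamma> + x = \<gamma>' + y"
    have "\<gamma> - \<gamma>' = y - x" using *(5) by (simp add: algebra_simps)
    then have "\<gamma> - \<gamma>' \<in> T \<inter> \<Gamma>" using U(3)[OF *(4,3)] subgroup(4)[OF *(1,2)] by simp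
    then show "\<gamma> = \<gamma>'" using T(2) by simp
  qed
qed

context
  fixes K :: "'a set"
  assumes K: "compact K"
begin

text \<open>The translates of L by \<Gamma> are disjoint, so averaging the translated sums over L
  integrates the squared Fourier transform over disjoint sets; Plancherel bounds the total.\<close>

lemma packing_bound:
  assumes u: "u \<in> L2_space \<mu>" and L: "compact L" and J: "finite J" "J \<subseteq> \<Gamma>"
    and sep: "\<And>\<gamma> \<gamma>' x y. \<gamma> \<in> \<Gamma> \<Longrightarrow> \<gamma>' \<in> \<Gamma> \<Longrightarrow> x \<in> L \<Longrightarrow> y \<in> L \<Longrightarrow> \<gamma> + x = \<gamma>' + y \<Longrightarrow> \<gamma> = \<gamma>'"
  shows "(\<integral>\<^sup>+\<xi>. (\<Sum>\<gamma>\<in>J. ennreal ((cmod (L2_inner \<mu> u (char_on K (\<gamma> + \<xi>))))\<^sup>2)) * indicator L \<xi> \<partial>\<nu>)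
    \<le> ennreal ((L2_norm \<mu> u)\<^sup>2)"
proof -
  note [measurable] = inner_char_on_measurable[OF K u]
  define h where "h \<xi> = ennreal ((cmod (L2_inner \<mu> u (char_on K \<xi>)))\<^sup>2)" for \<xi>
  have [measurable]: "L \<in> sets borel" by (intro borel_closed compact_imp_closed L)
  have [measurable]: "h \<in> borel_measurable borel" unfolding h_def by measurable
  have [measurable]: "(\<lambda>\<xi>. h (\<xi> + \<gamma>)) \<in> borel_measurable borel" for \<gamma>
    by (rule measurable_compose[OF measurable_translate]) measurable
  have [measurable]: "(\<lambda>\<xi>. indicator L (\<xi> + \<gamma>) :: ennreal) \<in> borel_measurable borel" for \<gamma>
    by (rule measurable_compose[OF measurable_translate]) measurable
  have "(\<integral>\<^sup>+\<xi>. (\<Sum>\<gamma>\<in>J. h (\<gamma> + \<xi>)) * indicator L \<xi> \<partial>\<nu>)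
      = (\<integral>\<^sup>+\<xi>. (\<Sum>\<gamma>\<in>J. h (\<xi> + \<gamma>) * indicator L (\<xi> + \<gamma> + (- \<gamma>))) \<partial>\<nu>)"
    by (simp add: sum_distrib_right add.commute)
  also have "\<dots> = (\<Sum>\<gamma>\<in>J. \<integral>\<^sup>+\<xi>. h (\<xi> + \<gamma>) * indicator L (\<xi> + \<gamma> + (- \<gamma>)) \<partial>\<nu>)"
    by (rule nn_integral_sum) simp
  also have "\<dots> = (\<Sum>\<gamma>\<in>J. \<integral>\<^sup>+\<zeta>. h \<zeta> * indicator L (\<zeta> + (- \<gamma>)) \<partial>\<nu>)"
    by (intro sum.cong refl haar_nn_integral_translate[OF haar(2), of "\<lambda>\<zeta>. h \<zeta> * indicator L (\<zeta> + (- \<gamma>))" for \<gamma>]) measurable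
  also have "\<dots> = (\<integral>\<^sup>+\<zeta>. (\<Sum>\<gamma>\<in>J. h \<zeta> * indicator L (\<zeta> + (- \<gamma>))) \<partial>\<nu>)"
    by (rule nn_integral_sum[symmetric]) measurable
  also have "\<dots> \<le> (\<integral>\<^sup>+\<zeta>. h \<zeta> \<partial>\<nu>)"
  proof (rule nn_integral_mono)
    fix \<zeta>
    show "(\<Sum>\<gamma>\<in>J. h \<zeta> * indicator L (\<zeta> + (- \<gamma>))) \<le> h \<zeta>"
    proof (cases "\<exists>\<gamma>\<in>J. \<zeta> + (- \<gamma>) \<in> L")
      case True
      then obtain \<gamma>0 where g0: "\<gamma>0 \<in> J" "\<zeta> + (- \<gamma>0) \<in> L" by blast
      have uniq: "\<gamma> = \<gamma>0" if "\<gamma> \<in> J" "\<zeta> + (- \<gamma>) \<in> L" for \<gamma>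
        by (rule sep[of _ _ "\<zeta> + (- \<gamma>)" "\<zeta> + (- \<gamma>0)"]) (use that g0 J in auto)
      have "(\<Sum>\<gamma>\<in>J. h \<zeta> * indicator L (\<zeta> + (- \<gamma>))) = (\<Sum>\<gamma>\<in>{\<gamma>0}. h \<zeta> * indicator L (\<zeta> + (- \<gamma>)))"
      proof (intro sum.mono_neutral_right ballI)
        fix \<gamma> assume "\<gamma> \<in> J - {\<gamma>0}"
        with uniq[of \<gamma>]
        have "\<zeta> + (- \<gamma>) \<notin> L" by blast
        then show "h \<zeta> * indicator L (\<zeta> + (- \<gamma>)) = 0" by (simp add: indicator_def)
      qed (use J g0 in auto)
      also have "\<dots> = h \<zeta>" using g0 by simp
      finally show ?thesis by simp
    next
      case False
      then have "(\<Sum>\<gamma>\<in>J. h \<zeta> * indicator L (\<zeta> + (- \<gamma>))) = 0" by (intro sum.neutral) (auto simp: indicator_def)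
      then show ?thesis by simp
    qed
  qed
  also have "\<dots> \<le> ennreal ((L2_norm \<mu> u)\<^sup>2)"
    unfolding h_def Plancherel_char_on[OF K u]
    using L2_mult_indicator(2)[OF u K_sets[OF K]] by (intro ennreal_leI power_mono) auto
  finally show ?thesis unfolding h_def .
qed

text \<open>Moving the frequencies by a small \<open>\<xi>\<close> changes the sum by at most a quarter of the
  best constant, while averaging over \<open>\<xi>\<close> is controlled by Plancherel; hence any bound \<open>c\<close>
  improves to \<open>2 / l + c / 2\<close>.\<close>

lemma bessel_improve:
  assumes L: "compact L" and l: "emeasure \<nu> L = ennreal l" "l > 0" and J: "finite J" "J \<subseteq> \<Gamma>"
    and sep: "\<And>\<gamma> \<gamma>' x y. \<gamma> \<in> \<Gamma> \<Longrightarrow> \<gamma>' \<in> \<Gamma> \<Longrightarrow> x \<in> L \<Longrightarrow> y \<in> L \<Longrightarrow> \<gamma> + x = \<gamma>' + y \<Longrightarrow> \<gamma> = \<gamma>'"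
    and small: "\<And>\<xi> x. \<xi> \<in> L \<Longrightarrow> x \<in> K \<Longrightarrow> cmod (eval_char \<xi> x - 1) \<le> 1/2"
    and c: "\<And>u. u \<in> L2_space \<mu> \<Longrightarrow> (\<Sum>\<gamma>\<in>J. (cmod (L2_inner \<mu> u (char_on K \<gamma>)))\<^sup>2) \<le> c * (L2_norm \<mu> u)\<^sup>2" "0 \<le> c"
    and u: "u \<in> L2_space \<mu>"
  shows "(\<Sum>\<gamma>\<in>J. (cmod (L2_inner \<mu> u (char_on K \<gamma>)))\<^sup>2) \<le> (2 / l + c / 2) * (L2_norm \<mu> u)\<^sup>2"
proof -
  define N where "N = (\<Sum>\<gamma>\<in>J. (cmod (L2_inner \<mu> u (char_on K \<gamma>)))\<^sup>2)"
  define P where "P \<xi> = (\<Sum>\<gamma>\<in>J. (cmod (L2_inner \<mu> u (char_on K (\<gamma> + \<xi>))))\<^sup>2)" for \<xi>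
  have [measurable]: "L \<in> sets borel" by (intro borel_closed compact_imp_closed L)
  \<comment> \<open>On K, \<open>u\<close> is its modulation by \<open>- \<xi>\<close> plus an error
    \<open>w\<close> with at most half the norm. From (a + b)^2 \<le> 2 a^2 + 2 b^2 the error
    contributes 2 * c * (1/2)^2 = c / 2.\<close>
  have pt: "N \<le> 2 * P \<xi> + c / 2 * (L2_norm \<mu> u)\<^sup>2" if \<xi>: "\<xi> \<in> L" for \<xi>
  proof -
    define w where "w x = (indicator K x * (1 - eval_char (- \<xi>) x)) * u x" for x
    note [measurable] = K_sets[OF K]
    have "(\<lambda>x. indicator K x * (1 - eval_char (- \<xi>) x)) \<in> borel_measurable \<mu>" by measurable
    moreover have "cmod (indicator K x * (1 - eval_char (- \<xi>) x)) \<le> 1/2" for x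
    proof -
      have "cmod (1 - eval_char (- \<xi>) x) = cmod (eval_char \<xi> x - 1)"
        by (metis complex_cnj_diff complex_cnj_one complex_mod_cnj eval_char_uminus norm_minus_commute)
      then show ?thesis using small[OF \<xi>, of x] by (auto simp: indicator_def)
    qed
    ultimately have w: "w \<in> L2_space \<mu>" "L2_norm \<mu> w \<le> 1/2 * L2_norm \<mu> u"
      unfolding w_def[abs_def] using L2_mult[OF u, of "\<lambda>x. indicator K x * (1 - eval_char (- \<xi>) x)" "1/2"] by auto
    have inner: "L2_inner \<mu> u (char_on K \<gamma>) = L2_inner \<mu> u (char_on K (\<gamma> + \<xi>)) + L2_inner \<mu> w (char_on K \<gamma>)" for \<gamma>
    proof -
      have "L2_inner \<mu> w (char_on K \<gamma>) = L2_inner \<mu> (\<lambda>x. u x - eval_char (- \<xi>) x * u x) (char_on K \<gamma>)"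
        unfolding w_def[abs_def]
        using inner_char_on_restrict[OF K, of "\<lambda>x. u x - eval_char (- \<xi>) x * u x" \<gamma>] by (simp add: algebra_simps)
      then show ?thesis
        by (simp add: L2_inner_diff_left u L2_mult_char char_on_L2[OF K] inner_char_on_add[OF K])
    qed
    have "N \<le> (\<Sum>\<gamma>\<in>J. 2 * (cmod (L2_inner \<mu> u (char_on K (\<gamma> + \<xi>))))\<^sup>2 + 2 * (cmod (L2_inner \<mu> w (char_on K \<gamma>)))\<^sup>2)"
      unfolding N_def
    proof (rule sum_mono)
      fix \<gamma>
      have "(cmod (L2_inner \<mu> u (char_on K \<gamma>)))\<^sup>2 \<le> (cmod (L2_inner \<mu> u (char_on K (\<gamma> + \<xi>))) + cmod (L2_inner \<mu> w (char_on K \<gamma>)))\<^sup>2"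
        unfolding inner[of \<gamma>] by (intro power_mono norm_triangle_ineq) auto
      also have "\<dots> \<le> 2 * (cmod (L2_inner \<mu> u (char_on K (\<gamma> + \<xi>))))\<^sup>2 + 2 * (cmod (L2_inner \<mu> w (char_on K \<gamma>)))\<^sup>2"
        using sum_squares_bound[of "cmod (L2_inner \<mu> u (char_on K (\<gamma> + \<xi>)))" "cmod (L2_inner \<mu> w (char_on K \<gamma>))"]
        by (simp add: power2_sum)
      finally show "(cmod (L2_inner \<mu> u (char_on K \<gamma>)))\<^sup>2 \<le> \<dots>" .
    qed
    also have "\<dots> = 2 * P \<xi> + 2 * (\<Sum>\<gamma>\<in>J. (cmod (L2_inner \<mu> w (char_on K \<gamma>)))\<^sup>2)"
      by (simp add: P_def sum.distrib sum_distrib_left)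
    also have "\<dots> \<le> 2 * P \<xi> + 2 * (c * (1/2 * L2_norm \<mu> u)\<^sup>2)"
      using c(1)[OF w(1)] mult_left_mono[OF power_mono[OF w(2), of 2] c(2)] by simp
    also have "\<dots> = 2 * P \<xi> + c / 2 * (L2_norm \<mu> u)\<^sup>2" by (simp add: power_mult_distrib power2_eq_square)
    finally show ?thesis .
  qed
  have P0: "0 \<le> P \<xi>" for \<xi> unfolding P_def by (intro sum_nonneg) auto
  have [measurable]: "(\<lambda>\<xi>. L2_inner \<mu> u (char_on K (\<gamma> + \<xi>))) \<in> borel_measurable borel" for \<gamma>
    using measurable_compose[OF measurable_translate inner_char_on_measurable[OF K u], of \<gamma>]
    by (simp add: add.commute)
  have [measurable]: "P \<in> borel_measurable borel" unfolding P_def by measurable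
  \<comment> \<open>The pointwise estimate is integrated over \<open>L\<close>: the left side is
    constant and picks up the factor \<open>l\<close>, and the averaged energies are controlled by
    the packing bound.\<close>
  have "ennreal N * ennreal l = (\<integral>\<^sup>+\<xi>. ennreal N * indicator L \<xi> \<partial>\<nu>)"
    by (simp add: nn_integral_cmult_indicator sets_\<nu> l(1))
  also have "\<dots> \<le> (\<integral>\<^sup>+\<xi>. 2 * (ennreal (P \<xi>) * indicator L \<xi>) + ennreal (c / 2 * (L2_norm \<mu> u)\<^sup>2) * indicator L \<xi> \<partial>\<nu>)"
  proof (rule nn_integral_mono)
    fix \<xi>
    have "ennreal N \<le> 2 * ennreal (P \<xi>) + ennreal (c / 2 * (L2_norm \<mu> u)\<^sup>2)" if "\<xi> \<in> L"
    proof -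
      have "ennreal N \<le> ennreal (2 * P \<xi> + c / 2 * (L2_norm \<mu> u)\<^sup>2)"
        by (rule ennreal_leI[OF pt[OF that]])
      also have "\<dots> = ennreal (2 * P \<xi>) + ennreal (c / 2 * (L2_norm \<mu> u)\<^sup>2)"
        by (rule ennreal_plus) (use P0[of \<xi>] c(2) in auto)
      also have "ennreal (2 * P \<xi>) = 2 * ennreal (P \<xi>)"
        by (subst ennreal_mult) (use P0[of \<xi>] in auto)
      finally show ?thesis .
    qed
    then show "ennreal N * indicator L \<xi> \<le> 2 * (ennreal (P \<xi>) * indicator L \<xi>) + ennreal (c / 2 * (L2_norm \<mu> u)\<^sup>2) * indicator L \<xi>"
      by (auto simp: indicator_def)
  qed
  also have "\<dots> = 2 * (\<integral>\<^sup>+\<xi>. ennreal (P \<xi>) * indicator L \<xi> \<partial>\<nu>) + ennreal (c / 2 * (L2_norm \<mu> u)\<^sup>2) * ennreal l"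
    by (simp add: nn_integral_add nn_integral_cmult nn_integral_cmult_indicator sets_\<nu> l(1))
  also have "(\<integral>\<^sup>+\<xi>. ennreal (P \<xi>) * indicator L \<xi> \<partial>\<nu>) \<le> ennreal ((L2_norm \<mu> u)\<^sup>2)"
    using packing_bound[OF u L J sep] unfolding P_def by (simp add: sum_ennreal)
  finally have "ennreal N * ennreal l \<le> 2 * ennreal ((L2_norm \<mu> u)\<^sup>2) + ennreal (c / 2 * (L2_norm \<mu> u)\<^sup>2) * ennreal l"
    by (simp add: add_right_mono mult_left_mono)
  also have "\<dots> = ennreal (2 * (L2_norm \<mu> u)\<^sup>2 + c / 2 * (L2_norm \<mu> u)\<^sup>2 * l)"
  proof -
    have "2 * ennreal ((L2_norm \<mu> u)\<^sup>2) = ennreal (2 * (L2_norm \<mu> u)\<^sup>2)"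
      by (subst ennreal_mult) auto
    moreover have "ennreal (c / 2 * (L2_norm \<mu> u)\<^sup>2) * ennreal l = ennreal (c / 2 * (L2_norm \<mu> u)\<^sup>2 * l)"
      using c(2) l(2) by (intro ennreal_mult[symmetric]) auto
    ultimately show ?thesis
      using c(2) l(2) by (simp only: ennreal_plus[symmetric] zero_le_mult_iff) auto
  qed
  finally have "ennreal (N * l) \<le> ennreal (2 * (L2_norm \<mu> u)\<^sup>2 + c / 2 * (L2_norm \<mu> u)\<^sup>2 * l)"
    using l(2) by (simp add: ennreal_mult'' less_imp_le)
  then have "N * l \<le> 2 * (L2_norm \<mu> u)\<^sup>2 + c / 2 * (L2_norm \<mu> u)\<^sup>2 * l"
    using c(2) l(2) by (subst (asm) ennreal_le_iff) auto
  then have "N \<le> (2 * (L2_norm \<mu> u)\<^sup>2 + c / 2 * (L2_norm \<mu> u)\<^sup>2 * l) / l"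
    using l(2) by (simp add: pos_le_divide_eq)
  also have "\<dots> = (2 / l + c / 2) * (L2_norm \<mu> u)\<^sup>2" using l(2) by (simp add: field_simps)
  finally show ?thesis unfolding N_def .
qed

text \<open>For finite J there is a crude bound that depends on J. Iterating the improvement c
  \<mapsto> 2 / l + c / 2 drives it to the fixed point 4 / l, in which J no longer occurs.\<close>

lemma lattice_characters_Bessel:
  obtains C where "C > 0" "\<And>u J. u \<in> L2_space \<mu> \<Longrightarrow> finite J \<Longrightarrow> J \<subseteq> \<Gamma> \<Longrightarrow>
    (\<Sum>\<gamma>\<in>J. (cmod (L2_inner \<mu> u (char_on K \<gamma>)))\<^sup>2) \<le> C * (L2_norm \<mu> u)\<^sup>2"
proof -
  obtain U where U: "open U" "0 \<in> U"
    and sep: "\<And>\<gamma> \<gamma>' x y. \<gamma> \<in> \<Gamma> \<Longrightarrow> \<gamma>' \<in> \<Gamma> \<Longrightarrow> x \<in> U \<Longrightarrow> y \<in> U \<Longrightarrow> \<gamma> + x = \<gamma>' + y \<Longrightarrow> \<gamma> = \<gamma>'"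
    using lattice_separated by metis
  \<comment> \<open>Characters in \<open>W\<close> differ from 1 by less than 1/2 on
    \<open>K\<close>, while \<open>U\<close> keeps lattice translates apart; \<open>L\<close> is
    taken inside both.\<close>
  obtain W where W: "open W" "0 \<in> W" "W \<subseteq> dual_nbhd K (1/2) 0"
    using open_dual_nbhd[OF K, of "1/2" 0] by auto
  obtain L where L: "compact L" "L \<subseteq> U \<inter> W" "0 < emeasure \<nu> L" "emeasure \<nu> L < \<infinity>"
    using haar_inner_compact[OF haar(2), of "U \<inter> W"] U W by blast
  define l where "l = measure \<nu> L"
  have l: "emeasure \<nu> L = ennreal l" "l > 0"
  proof -
    show "emeasure \<nu> L = ennreal l"
      unfolding l_def using L(4) by (intro emeasure_eq_ennreal_measure) auto
    with L(3) show "l > 0" by simp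
  qed
  have small: "cmod (eval_char \<xi> x - 1) \<le> 1/2" if "\<xi> \<in> L" "x \<in> K" for \<xi> x
    using that L W by (force simp: dual_nbhd_def dist_norm eval_char_zero)
  have sepL: "\<gamma> = \<gamma>'" if "\<gamma> \<in> \<Gamma>" "\<gamma>' \<in> \<Gamma>" "x \<in> L" "y \<in> L" "\<gamma> + x = \<gamma>' + y" for \<gamma> \<gamma>' x y
    using sep that L(2) by blast
  show ?thesis
  proof (rule that[of "4 / l"])
    fix u J assume u: "u \<in> L2_space \<mu>" and J: "finite J" "J \<subseteq> \<Gamma>"
    \<comment> \<open>The crude initial constant: Cauchy-Schwarz for each of the
      \<open>card J\<close> characters, whose squared norms are at most
      \<open>measure \<mu> K\<close>.\<close>
    define c0 where "c0 = real (card J) * measure \<mu> K"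
    have c0: "0 \<le> c0" by (simp add: c0_def)
    have iter: "(\<Sum>\<gamma>\<in>J. (cmod (L2_inner \<mu> v (char_on K \<gamma>)))\<^sup>2) \<le> (4 / l + c0 / 2^n) * (L2_norm \<mu> v)\<^sup>2"
      if "v \<in> L2_space \<mu>" for v n
      using that
    proof (induction n arbitrary: v)
      case 0
      have "(\<Sum>\<gamma>\<in>J. (cmod (L2_inner \<mu> v (char_on K \<gamma>)))\<^sup>2) \<le> (\<Sum>\<gamma>\<in>J. measure \<mu> K * (L2_norm \<mu> v)\<^sup>2)"
      proof (rule sum_mono)
        fix \<gamma>
        have "cmod (L2_inner \<mu> v (char_on K \<gamma>)) \<le> L2_norm \<mu> v * sqrt (measure \<mu> K)"
          using L2_Cauchy_Schwarz[OF 0 char_on_L2[OF K, of \<gamma>]] norm_char_on[OF K, of \<gamma>]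
          by (meson L2_norm_nonneg mult_left_mono order_trans)
        then have "(cmod (L2_inner \<mu> v (char_on K \<gamma>)))\<^sup>2 \<le> (L2_norm \<mu> v * sqrt (measure \<mu> K))\<^sup>2"
          by (intro power_mono) auto
        then show "(cmod (L2_inner \<mu> v (char_on K \<gamma>)))\<^sup>2 \<le> measure \<mu> K * (L2_norm \<mu> v)\<^sup>2"
          by (simp add: power_mult_distrib mult.commute)
      qed
      also have "\<dots> = c0 * (L2_norm \<mu> v)\<^sup>2" by (simp add: c0_def)
      also have "\<dots> \<le> (4 / l + c0 / 2^0) * (L2_norm \<mu> v)\<^sup>2" using l(2) by (intro mult_right_mono) auto
      finally show ?case .
    next
      case (Suc n)
      have "(\<Sum>\<gamma>\<in>J. (cmod (L2_inner \<mu> v (char_on K \<gamma>)))\<^sup>2) \<le> (2 / l + (4 / l + c0 / 2^n) / 2) * (L2_norm \<mu> v)\<^sup>2"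
        by (rule bessel_improve[OF L(1) l J sepL small Suc.IH]) (use c0 l(2) Suc.prems in auto)
      then show ?case by (simp add: field_simps)
    qed
    have "(\<lambda>n. (4 / l + c0 * (1/2)^n) * (L2_norm \<mu> u)\<^sup>2) \<longlonglongrightarrow> (4 / l + c0 * 0) * (L2_norm \<mu> u)\<^sup>2"
      by (intro tendsto_intros LIMSEQ_realpow_zero) auto
    then have lim: "(\<lambda>n. (4 / l + c0 * (1/2)^n) * (L2_norm \<mu> u)\<^sup>2) \<longlonglongrightarrow> 4 / l * (L2_norm \<mu> u)\<^sup>2"
      by simp
    show "(\<Sum>\<gamma>\<in>J. (cmod (L2_inner \<mu> u (char_on K \<gamma>)))\<^sup>2) \<le> 4 / l * (L2_norm \<mu> u)\<^sup>2"
      by (rule LIMSEQ_le_const[OF lim]) (intro exI[of _ 0], use iter[OF u] in \<open>simp add: power_one_over\<close>)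
  qed (use l in simp)
qed

end

end

section \<open>Constancy of the periodized energy and the local Parseval identity\<close>

context dual_lattice
begin

text \<open>The frame operator of the lattice characters on \<open>K\<close> commutes with multiplication by
  lattice characters. These separate the points of \<open>K\<close>, so by Stone--Weierstrass it commutes with
  multiplication by every character, i.e. the energy does not change under modulation.\<close>

lemma periodization_constant:
  assumes K: "compact K"
    and sep: "\<And>x y. x \<in> K \<Longrightarrow> y \<in> K \<Longrightarrow> x \<noteq> y \<Longrightarrow> \<exists>\<gamma>\<in>\<Gamma>. eval_char \<gamma> x \<noteq> eval_char \<gamma> y"
    and u: "u \<in> L2_space \<mu>"
  obtains Q where "0 \<le> Q"
    "\<And>\<xi>. ((\<lambda>\<gamma>. (cmod (L2_inner \<mu> u (char_on K (\<gamma> + \<xi>))))\<^sup>2) has_sum Q) \<Gamma>"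
proof -
  obtain C where C: "C > 0" and CB: "\<And>u J. u \<in> L2_space \<mu> \<Longrightarrow> finite J \<Longrightarrow> J \<subseteq> \<Gamma> \<Longrightarrow>
    (\<Sum>\<gamma>\<in>J. (cmod (L2_inner \<mu> u (char_on K \<gamma>)))\<^sup>2) \<le> C * (L2_norm \<mu> u)\<^sup>2"
    using lattice_characters_Bessel[OF K] by blast
  note [measurable] = K_sets[OF K]
  \<comment> \<open>The factor scales the Bessel constant to 1, as \<open>frame_residual\<close>
    requires; \<open>Q\<close> below multiplies by \<open>C\<close> again to undo it.\<close>
  define F where "F \<gamma> x = complex_of_real (1 / sqrt C) * char_on K \<gamma> x" for \<gamma> x
  have F: "F \<gamma> \<in> L2_space \<mu>" for \<gamma> unfolding F_def by (intro L2_scale char_on_L2 K)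
  have uF: "L2_inner \<mu> v (F \<gamma>) = complex_of_real (1 / sqrt C) * L2_inner \<mu> v (char_on K \<gamma>)" for v \<gamma>
    unfolding F_def by (simp only: L2_inner_scale_right complex_cnj_complex_of_real)
  have uF2: "(cmod (L2_inner \<mu> v (F \<gamma>)))\<^sup>2 = (cmod (L2_inner \<mu> v (char_on K \<gamma>)))\<^sup>2 / C" for v \<gamma>
    unfolding uF norm_mult power_mult_distrib using C by (simp add: power_divide norm_divide)
  have "\<exists>R. frame_residual \<mu> \<Gamma> F R"
  proof (rule frame_residual_exists[of \<Gamma> F \<mu>])
    fix g J assume "g \<in> L2_space \<mu>" "finite J" "J \<subseteq> \<Gamma>"
    from CB[OF this] C show "(\<Sum>i\<in>J. (cmod (L2_inner \<mu> g (F i)))\<^sup>2) \<le> (L2_norm \<mu> g)\<^sup>2"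
      unfolding uF2 sum_divide_distrib[symmetric] by (simp add: pos_divide_le_eq mult.commute)
  qed (use F in auto)
  then obtain R where "frame_residual \<mu> \<Gamma> F R" by blast
  then interpret frame_residual \<mu> \<Gamma> F R .
  \<comment> \<open>\<open>mult m\<close> says weakly that \<open>R\<close> commutes with
    multiplication by \<open>m\<close>, whose adjoint is multiplication by the conjugate. The
    functions with this property will be shown to form an algebra closed under bounded uniform
    limits.\<close>
  define mult where "mult m \<longleftrightarrow> m \<in> borel_measurable borel \<and> bounded (range m) \<and>
    (\<forall>u\<in>L2_space \<mu>. \<forall>v\<in>L2_space \<mu>. L2_inner \<mu> (R (\<lambda>x. m x * u x)) v = L2_inner \<mu> (R u) (\<lambda>x. cnj (m x) * v x))"
    for m :: "'a \<Rightarrow> complex"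
  have mL2: "(\<lambda>x. m x * v x) \<in> L2_space \<mu>"
    if m: "m \<in> borel_measurable borel" "bounded (range m)" and v: "v \<in> L2_space \<mu>" for m v
  proof -
    obtain B where B: "\<And>x. cmod (m x) \<le> B" using m(2) unfolding bounded_iff by auto
    have "0 \<le> B" using B[of 0] norm_ge_zero order_trans by blast
    with L2_mult(1)[OF v, of m B] B m(1) show ?thesis by (simp add: measurable_cong_sets[OF sets_\<mu> refl])
  qed
  have bcnj: "bounded (range (\<lambda>x. cnj (m x)))" if "bounded (range m)" for m :: "'a \<Rightarrow> complex"
    using that unfolding bounded_iff by auto
  have mult_L2: "(\<lambda>x. m x * v x) \<in> L2_space \<mu>" "(\<lambda>x. cnj (m x) * v x) \<in> L2_space \<mu>"
    if "mult m" "v \<in> L2_space \<mu>" for m v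
    using that mL2[of m v] mL2[of "\<lambda>x. cnj (m x)" v] bcnj[of m] unfolding mult_def by auto
  have mult_eq: "L2_inner \<mu> (R (\<lambda>x. m x * u x)) v = L2_inner \<mu> (R u) (\<lambda>x. cnj (m x) * v x)"
    if "mult m" "u \<in> L2_space \<mu>" "v \<in> L2_space \<mu>" for m u v
    using that unfolding mult_def by blast
  have mult_add: "mult (\<lambda>x. m x + n x)" if m: "mult m" and n: "mult n" for m n
    unfolding mult_def
  proof (intro conjI ballI)
    show "(\<lambda>x. m x + n x) \<in> borel_measurable borel" using m n unfolding mult_def by (intro borel_measurable_add) auto
    show "bounded (range (\<lambda>x. m x + n x))" using m n unfolding mult_def by (intro bounded_plus_comp) auto
    fix u v assume u: "u \<in> L2_space \<mu>" and v: "v \<in> L2_space \<mu>"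
    show "L2_inner \<mu> (R (\<lambda>x. (m x + n x) * u x)) v = L2_inner \<mu> (R u) (\<lambda>x. cnj (m x + n x) * v x)"
      using u v m n
      by (simp add: distrib_right R_add mult_L2 mult_eq L2_inner_add_right R)
  qed
  have mult_mult: "mult (\<lambda>x. m x * n x)" if m: "mult m" and n: "mult n" for m n
    unfolding mult_def
  proof (intro conjI ballI)
    show "(\<lambda>x. m x * n x) \<in> borel_measurable borel" using m n unfolding mult_def by (intro borel_measurable_times) auto
    obtain A B where AB: "\<And>x. cmod (m x) \<le> A" "\<And>x. cmod (n x) \<le> B"
      using m n unfolding mult_def bounded_iff by auto
    have "cmod (m x * n x) \<le> A * B" for x
      unfolding norm_mult using AB[of x] order_trans[OF norm_ge_zero AB(1)[of x]]
      by (intro mult_mono) auto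
    then show "bounded (range (\<lambda>x. m x * n x))" unfolding bounded_iff by auto
    fix u v assume u: "u \<in> L2_space \<mu>" and v: "v \<in> L2_space \<mu>"
    have "L2_inner \<mu> (R (\<lambda>x. m x * (n x * u x))) v = L2_inner \<mu> (R u) (\<lambda>x. cnj (n x) * (cnj (m x) * v x))"
      using u v m n by (simp add: mult_L2 mult_eq)
    then show "L2_inner \<mu> (R (\<lambda>x. m x * n x * u x)) v = L2_inner \<mu> (R u) (\<lambda>x. cnj (m x * n x) * v x)"
      by (simp add: mult.assoc mult.left_commute)
  qed
  have mult_const: "mult (\<lambda>_. c)" for c
    unfolding mult_def
    by (auto simp: R_scale L2_inner_scale_right)
  \<comment> \<open>A permutation of the frequencies does not change an unconditional sum, so pairs
    of functions with matching coefficients have the same frame form. Frequency shifts use a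
    translation as \<open>t\<close>, the cut-off to \<open>K\<close> uses the identity.\<close>
  have energy_eq: "L2_inner \<mu> v w - L2_inner \<mu> (R v) w = L2_inner \<mu> v' w' - L2_inner \<mu> (R v') w'"
    if "v \<in> L2_space \<mu>" "w \<in> L2_space \<mu>" "v' \<in> L2_space \<mu>" "w' \<in> L2_space \<mu>" "bij_betw t \<Gamma> \<Gamma>"
      "\<And>\<gamma>. L2_inner \<mu> v (F \<gamma>) = L2_inner \<mu> v' (F (t \<gamma>))" "\<And>\<gamma>. L2_inner \<mu> w (F \<gamma>) = L2_inner \<mu> w' (F (t \<gamma>))"
    for v w v' w' t
  proof -
    have eq: "L2_inner \<mu> v (F \<gamma>) * L2_inner \<mu> (F \<gamma>) w = L2_inner \<mu> v' (F (t \<gamma>)) * L2_inner \<mu> (F (t \<gamma>)) w'" for \<gamma>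
      using that(6,7)[of \<gamma>] by (metis L2_inner_cnj)
    have "((\<lambda>\<gamma>. L2_inner \<mu> v (F \<gamma>) * L2_inner \<mu> (F \<gamma>) w) has_sum L2_inner \<mu> v' w' - L2_inner \<mu> (R v') w') \<Gamma>"
      unfolding eq using has_sum_reindex_bij_betw[OF that(5), of "\<lambda>\<gamma>. L2_inner \<mu> v' (F \<gamma>) * L2_inner \<mu> (F \<gamma>) w'"]
        resid[OF that(3,4)] by simp
    from has_sum_unique[OF resid[OF that(1,2)] this] show ?thesis .
  qed
  have inner_mult: "L2_inner \<mu> (\<lambda>x. m x * u x) v = L2_inner \<mu> u (\<lambda>x. cnj (m x) * v x)" for m u v
    unfolding L2_inner_def by (rule Bochner_Integration.integral_cong) (auto simp: mult_ac)
  have mult_char: "mult (eval_char \<gamma>0)" if g0: "\<gamma>0 \<in> \<Gamma>" for \<gamma>0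
    unfolding mult_def
  proof (intro conjI ballI)
    show "eval_char \<gamma>0 \<in> borel_measurable borel" by measurable
    show "bounded (range (eval_char \<gamma>0))" unfolding bounded_iff by (intro exI[of _ 1]) auto
    fix u v assume u: "u \<in> L2_space \<mu>" and v: "v \<in> L2_space \<mu>"
    have cn: "(\<lambda>x. cnj (eval_char \<gamma>0 x) * v x) = (\<lambda>x. eval_char (- \<gamma>0) x * v x)"
      by (simp add: eval_char_uminus)
    have bij: "bij_betw (\<lambda>\<gamma>. \<gamma> - \<gamma>0) \<Gamma> \<Gamma>"
      by (rule bij_betw_byWitness[where f' = "\<lambda>\<gamma>. \<gamma> + \<gamma>0"]) (use g0 subgroup in auto)
    have 1: "L2_inner \<mu> (\<lambda>x. eval_char \<gamma>0 x * u x) (F \<gamma>) = L2_inner \<mu> u (F (\<gamma> - \<gamma>0))" for \<gamma>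
      unfolding uF using inner_char_on_add[OF K, of u \<gamma> "- \<gamma>0"] by simp
    have 2: "L2_inner \<mu> v (F \<gamma>) = L2_inner \<mu> (\<lambda>x. eval_char (- \<gamma>0) x * v x) (F (\<gamma> - \<gamma>0))" for \<gamma>
      unfolding uF using inner_char_on_add[OF K, of v "\<gamma> - \<gamma>0" \<gamma>0] by simp
    from energy_eq[OF L2_mult_char[OF u] v u L2_mult_char[OF v] bij 1 2]
    show "L2_inner \<mu> (R (\<lambda>x. eval_char \<gamma>0 x * u x)) v = L2_inner \<mu> (R u) (\<lambda>x. cnj (eval_char \<gamma>0 x) * v x)"
      unfolding cn inner_mult[of "eval_char \<gamma>0"] by simp
  qed
  \<comment> \<open>The coefficients see a function only on \<open>K\<close>, so cutting off either
    argument leaves the frame form unchanged.\<close>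
  have mult_K: "mult (indicator K)"
    unfolding mult_def
  proof (intro conjI ballI)
    show "bounded (range (indicator K :: 'a \<Rightarrow> complex))"
      unfolding bounded_iff by (intro exI[of _ 1]) (auto simp: indicator_def)
    fix u v assume u: "u \<in> L2_space \<mu>" and v: "v \<in> L2_space \<mu>"
    have i: "cnj (indicator K x) = indicator K x" for x by (simp add: indicator_def)
    have inn: "L2_inner \<mu> w (F \<gamma>) = L2_inner \<mu> (\<lambda>x. indicator K x * w x) (F \<gamma>)" for w \<gamma>
      unfolding uF by (simp only: inner_char_on_restrict[OF K])
    have Ku: "(\<lambda>x. indicator K x * u x) \<in> L2_space \<mu>" and Kv: "(\<lambda>x. indicator K x * v x) \<in> L2_space \<mu>"
      using u v by (auto intro: L2_mult_indicator)
    show "L2_inner \<mu> (R (\<lambda>x. indicator K x * u x)) v = L2_inner \<mu> (R u) (\<lambda>x. cnj (indicator K x) * v x)"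
      using energy_eq[OF Ku v u Kv, of "\<lambda>\<gamma>. \<gamma>"] inn inner_mult[of "indicator K" u v]
      by (simp add: i bij_betw_def)
  qed measurable
  \<comment> \<open>Uniform error \<open>e\<close> in the multiplier changes each side by at most
    \<open>e\<close> times the product of the norms, as \<open>R\<close> is a contraction; the
    defect \<open>D\<close> is therefore smaller than every positive number.\<close>
  have mult_limit: "mult g" if [measurable]: "g \<in> borel_measurable borel" and gb: "bounded (range g)"
    and lim: "\<And>e. e > 0 \<Longrightarrow> \<exists>m. mult m \<and> (\<forall>x. cmod (g x - m x) \<le> e)" for g
    unfolding mult_def
  proof (intro conjI ballI)
    fix u v assume u: "u \<in> L2_space \<mu>" and v: "v \<in> L2_space \<mu>"
    have gu: "(\<lambda>x. g x * u x) \<in> L2_space \<mu>" by (rule mL2[OF that(1) gb u])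
    have gv: "(\<lambda>x. cnj (g x) * v x) \<in> L2_space \<mu>" by (rule mL2[OF _ bcnj[OF gb] v]) measurable
    define D where "D = cmod (L2_inner \<mu> (R (\<lambda>x. g x * u x)) v - L2_inner \<mu> (R u) (\<lambda>x. cnj (g x) * v x))"
    have De: "D \<le> e * (2 * L2_norm \<mu> u * L2_norm \<mu> v)" if e: "e > 0" for e
    proof -
      obtain m where m: "mult m" and close: "\<And>x. cmod (g x - m x) \<le> e" using lim[OF e] by auto
      have [measurable]: "m \<in> borel_measurable borel" using m by (simp add: mult_def)
      have mu: "(\<lambda>x. m x * u x) \<in> L2_space \<mu>" and mv: "(\<lambda>x. cnj (m x) * v x) \<in> L2_space \<mu>"
        using mult_L2[OF m] u v by auto
      have "(\<lambda>x. g x - m x) \<in> borel_measurable \<mu>" "(\<lambda>x. cnj (g x - m x)) \<in> borel_measurable \<mu>"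
        by measurable
      from L2_mult[OF u this(1), of e] L2_mult[OF v this(2), of e] close e
      have 1: "(\<lambda>x. (g x - m x) * u x) \<in> L2_space \<mu>" "L2_norm \<mu> (\<lambda>x. (g x - m x) * u x) \<le> e * L2_norm \<mu> u"
        and 2: "(\<lambda>x. cnj (g x - m x) * v x) \<in> L2_space \<mu>" "L2_norm \<mu> (\<lambda>x. cnj (g x - m x) * v x) \<le> e * L2_norm \<mu> v"
        by (auto simp del: complex_cnj_diff)
      have "L2_inner \<mu> (R (\<lambda>x. g x * u x)) v - L2_inner \<mu> (R u) (\<lambda>x. cnj (g x) * v x)
        = (L2_inner \<mu> (R (\<lambda>x. g x * u x)) v - L2_inner \<mu> (R (\<lambda>x. m x * u x)) v)
        - (L2_inner \<mu> (R u) (\<lambda>x. cnj (g x) * v x) - L2_inner \<mu> (R u) (\<lambda>x. cnj (m x) * v x))"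
        using mult_eq[OF m u v] by simp
      also have "\<dots> = L2_inner \<mu> (R (\<lambda>x. (g x - m x) * u x)) v - L2_inner \<mu> (R u) (\<lambda>x. cnj (g x - m x) * v x)"
        using R_diff[OF gu mu v] L2_inner_diff_right[OF gv mv R[OF u]]
        by (simp add: left_diff_distrib)
      finally have "D \<le> cmod (L2_inner \<mu> (R (\<lambda>x. (g x - m x) * u x)) v) + cmod (L2_inner \<mu> (R u) (\<lambda>x. cnj (g x - m x) * v x))"
        unfolding D_def by (simp only: norm_triangle_ineq4)
      also have "\<dots> \<le> L2_norm \<mu> (\<lambda>x. (g x - m x) * u x) * L2_norm \<mu> v + L2_norm \<mu> u * L2_norm \<mu> (\<lambda>x. cnj (g x - m x) * v x)"
        by (intro add_mono R_bounded 1 2 u v)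
      also have "\<dots> \<le> e * L2_norm \<mu> u * L2_norm \<mu> v + L2_norm \<mu> u * (e * L2_norm \<mu> v)"
        by (intro add_mono mult_right_mono mult_left_mono 1 2) auto
      finally show ?thesis by (simp add: algebra_simps)
    qed
    have "D \<le> 0 + e" if "e > 0" for e
    proof -
      define n where "n = 2 * L2_norm \<mu> u * L2_norm \<mu> v + 1"
      have n: "n > 0" "2 * L2_norm \<mu> u * L2_norm \<mu> v \<le> n" by (auto simp: n_def intro: add_nonneg_pos)
      have "D \<le> e / n * (2 * L2_norm \<mu> u * L2_norm \<mu> v)" using n that by (intro De) simp
      also have "\<dots> \<le> e / n * n" using n that by (intro mult_left_mono) auto
      finally show ?thesis using n by simp
    qed
    then have "D \<le> 0" by (rule field_le_epsilon)
    then show "L2_inner \<mu> (R (\<lambda>x. g x * u x)) v = L2_inner \<mu> (R u) (\<lambda>x. cnj (g x) * v x)"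
      unfolding D_def by simp
  qed (use that in auto)
  \<comment> \<open>Stone-Weierstrass is applied in its real form. Real and imaginary parts of a
    lattice character lie in \<open>A\<close> since the inverse character is again in \<Gamma>, and
    at least one of them distinguishes two given points.\<close>
  define A where "A = {r :: 'a \<Rightarrow> real. continuous_on UNIV r \<and> mult (\<lambda>x. complex_of_real (r x))}"
  interpret SW: function_ring_on A K
  proof
    show "compact K" by (rule K)
    show "continuous_on K r" if "r \<in> A" for r
      using that unfolding A_def by (auto intro: continuous_on_subset)
    show "(\<lambda>x. r x + s x) \<in> A" if "r \<in> A" "s \<in> A" for r s
      using that mult_add unfolding A_def by (auto intro: continuous_on_add)
    show "(\<lambda>x. r x * s x) \<in> A" if "r \<in> A" "s \<in> A" for r s
      using that mult_mult unfolding A_def by (auto intro: continuous_on_mult)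
    show "(\<lambda>_. c) \<in> A" for c unfolding A_def using mult_const by auto
    fix x y assume "x \<in> K" "y \<in> K" "x \<noteq> y"
    then obtain \<gamma> where g: "\<gamma> \<in> \<Gamma>" "eval_char \<gamma> x \<noteq> eval_char \<gamma> y" using sep by blast
    have c: "mult (eval_char \<gamma>)" "mult (eval_char (- \<gamma>))" using g subgroup by (auto intro: mult_char)
    have "mult (\<lambda>x. (1/2) * (eval_char \<gamma> x + eval_char (- \<gamma>) x))"
      by (intro mult_mult mult_const mult_add c)
    moreover have "(1/2) * (eval_char \<gamma> x + eval_char (- \<gamma>) x) = complex_of_real (Re (eval_char \<gamma> x))" for x
      by (simp add: eval_char_uminus complex_add_cnj)
    ultimately have re: "(\<lambda>x. Re (eval_char \<gamma> x)) \<in> A"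
      unfolding A_def by (auto intro!: continuous_intros continuous_eval_char)
    have "mult (\<lambda>x. (- \<i> / 2) * (eval_char \<gamma> x + (- 1) * eval_char (- \<gamma>) x))"
      by (intro mult_mult mult_const mult_add c)
    moreover have "(- \<i> / 2) * (eval_char \<gamma> x + (- 1) * eval_char (- \<gamma>) x) = complex_of_real (Im (eval_char \<gamma> x))" for x
      by (simp add: eval_char_uminus complex_eq_iff)
    ultimately have im: "(\<lambda>x. Im (eval_char \<gamma> x)) \<in> A"
      unfolding A_def by (auto intro!: continuous_intros continuous_eval_char)
    have "Re (eval_char \<gamma> x) \<noteq> Re (eval_char \<gamma> y) \<or> Im (eval_char \<gamma> x) \<noteq> Im (eval_char \<gamma> y)"
      using g(2) by (auto simp: complex_eq_iff)
    then show "\<exists>f\<in>A. f x \<noteq> f y" by (elim disjE) (rule bexI[OF _ re] bexI[OF _ im], assumption)+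
  qed
  \<comment> \<open>The approximation is uniform on \<open>K\<close> only; the indicator, itself an
    admissible multiplier, makes it uniform everywhere.\<close>
  have mult_real: "mult (\<lambda>x. indicator K x * complex_of_real (r x))" if r: "continuous_on UNIV r" for r :: "'a \<Rightarrow> real"
  proof (rule mult_limit)
    have [measurable]: "r \<in> borel_measurable borel" by (intro borel_measurable_continuous_onI r)
    show "(\<lambda>x. indicator K x * complex_of_real (r x)) \<in> borel_measurable borel" by measurable
    have rK: "continuous_on K r" using r by (rule continuous_on_subset) simp
    have "bounded (r ` K)" by (intro compact_imp_bounded compact_continuous_image rK K)
    then obtain B where B: "\<And>x. x \<in> K \<Longrightarrow> \<bar>r x\<bar> \<le> B" unfolding bounded_iff by auto
    have "cmod (indicator K x * complex_of_real (r x)) \<le> \<bar>B\<bar>" for x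
      using B[of x] by (auto simp: indicator_def)
    then show "bounded (range (\<lambda>x. indicator K x * complex_of_real (r x)))" unfolding bounded_iff by blast
    fix e :: real assume "e > 0"
    then obtain g where g: "g \<in> A" "\<And>x. x \<in> K \<Longrightarrow> \<bar>r x - g x\<bar> < e"
      using SW.Stone_Weierstrass_basic[OF rK] by blast
    show "\<exists>m. mult m \<and> (\<forall>x. cmod (indicator K x * complex_of_real (r x) - m x) \<le> e)"
    proof (intro exI conjI allI)
      show "mult (\<lambda>x. indicator K x * complex_of_real (g x))"
        using g(1) unfolding A_def by (intro mult_mult mult_K) auto
      fix x
      show "cmod (indicator K x * complex_of_real (r x) - indicator K x * complex_of_real (g x)) \<le> e"
        using g(2)[of x] \<open>e > 0\<close>
        by (cases "x \<in> K") (auto simp: less_imp_le simp flip: of_real_diff)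
    qed
  qed
  have mult_Kchar: "mult (\<lambda>x. indicator K x * eval_char \<xi> x)" for \<xi>
  proof -
    have "mult (\<lambda>x. indicator K x * complex_of_real (Re (eval_char \<xi> x))
        + \<i> * (indicator K x * complex_of_real (Im (eval_char \<xi> x))))"
      by (intro mult_add mult_mult[of "\<lambda>_. \<i>"] mult_const mult_real continuous_intros continuous_eval_char)
    moreover have "indicator K x * complex_of_real (Re (eval_char \<xi> x))
        + \<i> * (indicator K x * complex_of_real (Im (eval_char \<xi> x))) = indicator K x * eval_char \<xi> x" for x
      by (subst (3) complex_eq) (simp add: algebra_simps)
    ultimately show ?thesis by simp
  qed
  \<comment> \<open>For v = m u with m a character cut off to \<open>K\<close>, commutation gives <R
    v, v> = <R u, |m|^2 u>, and |m|^2 is the indicator of \<open>K\<close> whatever the character.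
    Hence \<open>Q\<close> does not mention \<xi>.\<close>
  define Q where "Q = C * ((L2_norm \<mu> (\<lambda>x. indicator K x * u x))\<^sup>2 - Re (L2_inner \<mu> (R u) (\<lambda>x. indicator K x * u x)))"
  have sum: "((\<lambda>\<gamma>. (cmod (L2_inner \<mu> u (char_on K (\<gamma> + \<xi>))))\<^sup>2) has_sum Q) \<Gamma>" for \<xi>
  proof -
    let ?m = "\<lambda>x. indicator K x * eval_char (- \<xi>) x"
    let ?v = "\<lambda>x. ?m x * u x"
    have m: "mult ?m" by (rule mult_Kchar)
    have v: "?v \<in> L2_space \<mu>" by (rule mult_L2(1)[OF m u])
    have "(L2_norm \<mu> ?v)\<^sup>2 = (L2_norm \<mu> (\<lambda>x. indicator K x * u x))\<^sup>2"
      by (simp add: L2_norm_sq norm_mult)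
    moreover have "(\<lambda>x. cnj (?m x) * ?v x) = (\<lambda>x. indicator K x * u x)"
      using eval_char_cnj_mult(1)[of "- \<xi>"] by (auto simp: indicator_def mult.assoc[symmetric])
    then have "L2_inner \<mu> (R ?v) ?v = L2_inner \<mu> (R u) (\<lambda>x. indicator K x * u x)"
      using mult_eq[OF m u v] by simp
    ultimately have "((\<lambda>\<gamma>. (cmod (L2_inner \<mu> ?v (F \<gamma>)))\<^sup>2) has_sum Q / C) \<Gamma>"
      using energy[OF v] C by (simp add: Q_def)
    then have "((\<lambda>\<gamma>. (cmod (L2_inner \<mu> ?v (F \<gamma>)))\<^sup>2 * C) has_sum Q / C * C) \<Gamma>"
      by (rule has_sum_cmult_left)
    moreover have "(cmod (L2_inner \<mu> ?v (F \<gamma>)))\<^sup>2 * C = (cmod (L2_inner \<mu> u (char_on K (\<gamma> + \<xi>))))\<^sup>2" for \<gamma>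
      unfolding uF2 inner_char_on_add[OF K]
      using C inner_char_on_restrict[OF K, of "\<lambda>x. eval_char (- \<xi>) x * u x" \<gamma>] by (simp add: mult.assoc)
    ultimately show ?thesis using C by simp
  qed
  moreover have "0 \<le> Q" using sum[of 0] by (rule has_sum_nonneg) auto
  ultimately show ?thesis using that by blast
qed

text \<open>The Plancherel integral is unfolded along the translates of the section; the inner sum
  is constant and its value is read off at frequency 0. The identity is a product in
  \<open>ennreal\<close> because finiteness of \<open>emeasure \<nu> S\<close> is itself deduced
  from it, in \<open>section_measure\<close>.\<close>

lemma lattice_Parseval_local:
  assumes K: "compact K"
    and sep: "\<And>x y. x \<in> K \<Longrightarrow> y \<in> K \<Longrightarrow> x \<noteq> y \<Longrightarrow> \<exists>\<gamma>\<in>\<Gamma>. eval_char \<gamma> x \<noteq> eval_char \<gamma> y"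
    and u: "u \<in> L2_space \<mu>" and S: "borel_section \<Gamma> S"
  shows "(\<integral>\<^sup>+\<gamma>. ennreal ((cmod (L2_inner \<mu> u (char_on K \<gamma>)))\<^sup>2) \<partial>count_space \<Gamma>) * emeasure \<nu> S
    = ennreal ((L2_norm \<mu> (\<lambda>x. indicator K x * u x))\<^sup>2)"
proof -
  obtain Q where Q: "0 \<le> Q"
    "\<And>\<xi>. ((\<lambda>\<gamma>. (cmod (L2_inner \<mu> u (char_on K (\<gamma> + \<xi>))))\<^sup>2) has_sum Q) \<Gamma>"
    using periodization_constant[OF K sep u] by blast
  have Qsum: "(\<integral>\<^sup>+\<gamma>. ennreal ((cmod (L2_inner \<mu> u (char_on K (\<gamma> + \<xi>))))\<^sup>2) \<partial>count_space \<Gamma>) = ennreal Q" for \<xi>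
    by (rule nn_integral_count_space_has_sum[OF Q(2)]) simp
  note [measurable] = inner_char_on_measurable[OF K u]
  define h where "h \<xi> = ennreal ((cmod (L2_inner \<mu> u (char_on K \<xi>)))\<^sup>2)" for \<xi>
  have S_meas [measurable]: "S \<in> sets borel" using S by (simp add: borel_section_def)
  have [measurable]: "h \<in> borel_measurable borel" unfolding h_def by measurable
  have [measurable]: "(\<lambda>\<xi>. h (\<xi> + \<gamma>)) \<in> borel_measurable borel" for \<gamma>
    by (rule measurable_compose[OF measurable_translate]) measurable
  have [measurable]: "(\<lambda>\<xi>. indicator S (\<xi> + \<gamma>) :: ennreal) \<in> borel_measurable borel" for \<gamma>
    by (rule measurable_compose[OF measurable_translate]) measurable
  have sub: "add_subgroup \<Gamma>" using lattice by (simp add: uniform_lattice_def)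
  have "(\<integral>\<^sup>+\<zeta>. h \<zeta> \<partial>\<nu>) = (\<integral>\<^sup>+\<zeta>. \<integral>\<^sup>+\<gamma>. h \<zeta> * indicator S (\<zeta> + (- \<gamma>)) \<partial>count_space \<Gamma> \<partial>\<nu>)"
  proof (rule nn_integral_cong)
    fix \<zeta>
    have i: "indicator S (\<zeta> + (- \<gamma>)) = indicator {\<gamma>. \<zeta> - \<gamma> \<in> S} \<gamma>" for \<gamma> by (simp add: indicator_def)
    show "h \<zeta> = (\<integral>\<^sup>+\<gamma>. h \<zeta> * indicator S (\<zeta> + (- \<gamma>)) \<partial>count_space \<Gamma>)"
      unfolding i by (rule nn_integral_count_space_unique[symmetric]) (rule borel_section_unique[OF S sub])
  qed
  also have "\<dots> = (\<integral>\<^sup>+\<gamma>. \<integral>\<^sup>+\<zeta>. h \<zeta> * indicator S (\<zeta> + (- \<gamma>)) \<partial>\<nu> \<partial>count_space \<Gamma>)"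
    by (rule nn_integral_count_space_nn_integral[OF countable_lattice]) measurable
  also have "\<dots> = (\<integral>\<^sup>+\<gamma>. \<integral>\<^sup>+\<xi>. h (\<xi> + \<gamma>) * indicator S (\<xi> + \<gamma> + (- \<gamma>)) \<partial>\<nu> \<partial>count_space \<Gamma>)"
    by (intro nn_integral_cong haar_nn_integral_translate[OF haar(2), of "\<lambda>\<zeta>. h \<zeta> * indicator S (\<zeta> + (- \<gamma>))" for \<gamma>, symmetric]) measurable
  also have "\<dots> = (\<integral>\<^sup>+\<xi>. \<integral>\<^sup>+\<gamma>. h (\<xi> + \<gamma>) * indicator S (\<xi> + \<gamma> + (- \<gamma>)) \<partial>count_space \<Gamma> \<partial>\<nu>)"
    by (rule nn_integral_count_space_nn_integral[OF countable_lattice, symmetric]) (simp, measurable)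
  also have "\<dots> = (\<integral>\<^sup>+\<xi>. ennreal Q * indicator S \<xi> \<partial>\<nu>)"
  proof (rule nn_integral_cong)
    fix \<xi>
    have "(\<integral>\<^sup>+\<gamma>. h (\<xi> + \<gamma>) * indicator S (\<xi> + \<gamma> + (- \<gamma>)) \<partial>count_space \<Gamma>)
        = (\<integral>\<^sup>+\<gamma>. h (\<gamma> + \<xi>) * indicator S \<xi> \<partial>count_space \<Gamma>)"
      by (simp add: add.commute)
    also have "\<dots> = (\<integral>\<^sup>+\<gamma>. h (\<gamma> + \<xi>) \<partial>count_space \<Gamma>) * indicator S \<xi>"
      by (rule nn_integral_multc) simp
    finally show "(\<integral>\<^sup>+\<gamma>. h (\<xi> + \<gamma>) * indicator S (\<xi> + \<gamma> + (- \<gamma>)) \<partial>count_space \<Gamma>) = ennreal Q * indicator S \<xi>"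
      using Qsum[of \<xi>] by (simp add: h_def)
  qed
  also have "\<dots> = ennreal Q * emeasure \<nu> S"
    by (simp add: nn_integral_cmult_indicator sets_\<nu>)
  finally show ?thesis
    using Qsum[of 0] unfolding h_def Plancherel_char_on[OF K u] by simp
qed

end

section \<open>Local separation by the lattice\<close>

lemma compact_nbhd:
  fixes x :: "'b::topological_space"
  assumes "locally_compact_space (euclidean :: 'b topology)"
  obtains U K where "open U" "compact K" "x \<in> U" "U \<subseteq> K"
proof -
  obtain U K where "openin euclidean U" "compactin euclidean K" "x \<in> U" "U \<subseteq> K"
    using assms unfolding locally_compact_space_def by (metis UNIV_I topspace_euclidean)
  then show ?thesis using that by (simp only: compactin_euclidean_iff open_openin)
qed

context dual_lattice
begin

lemma translate_measurable [measurable]: "(\<lambda>x. x + a) \<in> measurable \<mu> \<mu>"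
  by (rule haar_translate_measurable[OF haar(1)])

text \<open>If all characters are trivial at x, the indicators of V and of its translate by x have
  the same Fourier transform. By Plancherel their difference vanishes almost everywhere, but it
  equals 1 on the nonempty open set V when V misses its translate.\<close>

lemma characters_separate:
  fixes x :: 'a
  assumes lc: "locally_compact_space (euclidean :: 'a topology)" and x: "\<And>\<xi>. eval_char \<xi> x = 1"
  shows "x = 0"
proof (rule ccontr)
  assume "x \<noteq> 0"
  then obtain P Q where PQ: "open P" "open Q" "0 \<in> P" "x \<in> Q" "P \<inter> Q = {}"
    using hausdorff[of 0 x] by auto
  obtain U0 K0 where U0: "open U0" "compact K0" "(0::'a) \<in> U0" "U0 \<subseteq> K0"
    by (rule compact_nbhd[OF lc, of 0])
  \<comment> \<open>Contained in a compact set, hence of finite measure, and disjoint from its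
    translate by \<open>x\<close> because \<open>V\<close> lies in \<open>P\<close> and the
    translate in \<open>Q\<close>.\<close>
  define V where "V = U0 \<inter> P \<inter> (\<lambda>y. y + x) -` Q"
  have V: "open V" "0 \<in> V" unfolding V_def using PQ U0
    by (auto intro!: open_Int open_vimage continuous_intros)
  have V_disj: "y + (- x) \<notin> V" if "y \<in> V" for y
  proof
    assume "y + (- x) \<in> V"
    then have "y + (- x) + x \<in> Q" unfolding V_def by blast
    then show False using that PQ(5) unfolding V_def by auto
  qed
  have [measurable]: "V \<in> sets borel" using V(1) by simp
  have "emeasure \<mu> V \<le> emeasure \<mu> K0"
    using U0 haar_compact_finite[OF haar(1) U0(2)] by (intro emeasure_mono) (auto simp: V_def)
  then have finV: "emeasure \<mu> V < \<infinity>" using haar_compact_finite[OF haar(1) U0(2)] by (simp add: le_less_trans)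
  define u :: "'a \<Rightarrow> complex" where "u y = indicator V y - indicator V (y + (- x))" for y
  have intV: "integrable \<mu> (\<lambda>y. indicator V y * cnj (eval_char \<xi> y))" for \<xi>
  proof (rule Bochner_Integration.integrable_bound[where f = "indicator V :: 'a \<Rightarrow> real"])
    show "integrable \<mu> (indicator V :: 'a \<Rightarrow> real)" using finV by (simp add: sets_\<mu>)
    show "AE y in \<mu>. norm (indicator V y * cnj (eval_char \<xi> y)) \<le> norm (indicator V y :: real)"
      by (rule AE_I2) (auto simp: indicator_def)
  qed measurable
  have intVx: "integrable \<mu> (\<lambda>y. indicator V (y + (- x)) * cnj (eval_char \<xi> y))"
    and inteq: "(LINT y|\<mu>. indicator V (y + (- x)) * cnj (eval_char \<xi> y)) = (LINT y|\<mu>. indicator V y * cnj (eval_char \<xi> y))" for \<xi>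
  proof -
    have e: "eval_char \<xi> (y + (- x)) = eval_char \<xi> y" for y
      using eval_char_add_arg[of \<xi> "y + (- x)" x] x[of \<xi>] by simp
    have m: "(\<lambda>y. indicator V y * cnj (eval_char \<xi> y)) \<in> borel_measurable \<mu>" by measurable
    show "(LINT y|\<mu>. indicator V (y + (- x)) * cnj (eval_char \<xi> y)) = (LINT y|\<mu>. indicator V y * cnj (eval_char \<xi> y))"
      using haar_integral_translate[OF haar(1) m, of "- x"] by (simp only: e)
    have "integrable (distr \<mu> \<mu> (\<lambda>y. y + (- x))) (\<lambda>y. indicator V y * cnj (eval_char \<xi> y))"
      unfolding haar_distr[OF haar(1)] by (rule intV)
    then have "integrable \<mu> (\<lambda>y. indicator V (y + (- x)) * cnj (eval_char \<xi> (y + (- x))))"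
      by (rule integrable_distr[OF haar_translate_measurable[OF haar(1)]])
    then show "integrable \<mu> (\<lambda>y. indicator V (y + (- x)) * cnj (eval_char \<xi> y))" by (simp only: e)
  qed
  have ft: "fourier_transform \<mu> u \<xi> = 0" for \<xi>
    unfolding fourier_transform_def u_def left_diff_distrib
    by (subst Bochner_Integration.integral_diff[OF intV intVx]) (simp only: inteq diff_self)
  have ind: "(\<lambda>y. indicator V y * cnj (eval_char 0 y)) = (indicator V :: 'a \<Rightarrow> complex)"
    "(\<lambda>y. indicator V (y + (- x)) * cnj (eval_char 0 y)) = (\<lambda>y. indicator V (y + (- x)) :: complex)"
    by (auto simp: eval_char_zero)
  have intu: "integrable \<mu> u"
    unfolding u_def using intV[of 0] intVx[of 0] unfolding ind by (rule Bochner_Integration.integrable_diff)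
  have sq: "(cmod (u y))\<^sup>2 \<le> cmod (u y)" for y
    unfolding u_def by (auto simp: indicator_def)
  have "integrable \<mu> (\<lambda>y. (cmod (u y))\<^sup>2)"
  proof (rule Bochner_Integration.integrable_bound[OF intu])
    have [measurable]: "u \<in> borel_measurable \<mu>" using intu by auto
    show "(\<lambda>y. (cmod (u y))\<^sup>2) \<in> borel_measurable \<mu>" by measurable
  qed (use sq in auto)
  then have uL2: "u \<in> L2_space \<mu>" using intu unfolding L2_space_def by auto
  have "(\<integral>\<^sup>+\<xi>. ennreal ((cmod (fourier_transform \<mu> u \<xi>))\<^sup>2) \<partial>\<nu>) = (\<integral>\<^sup>+y. ennreal ((cmod (u y))\<^sup>2) \<partial>\<mu>)"
    using dual uL2 intu unfolding dual_haar_measures_def by blast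
  then have zero: "(\<integral>\<^sup>+y. ennreal ((cmod (u y))\<^sup>2) \<partial>\<mu>) = 0" by (simp add: ft)
  have "emeasure \<mu> V = (\<integral>\<^sup>+y. indicator V y \<partial>\<mu>)" by (simp add: sets_\<mu>)
  also have "\<dots> \<le> (\<integral>\<^sup>+y. ennreal ((cmod (u y))\<^sup>2) \<partial>\<mu>)"
  proof (rule nn_integral_mono)
    fix y show "indicator V y \<le> ennreal ((cmod (u y))\<^sup>2)"
      using V_disj[of y] by (cases "y \<in> V") (simp_all add: u_def)
  qed
  finally have "emeasure \<mu> V = 0" using zero by simp
  with haar_open_pos[OF haar(1) V(1)] V(2) show False by auto
qed

text \<open>Compactness of the quotient writes every character as one of finitely many, times one
  close to 1 on a compact set, times one in \<Gamma>. So at a point near 0 annihilated by \<Gamma>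
  all characters are uniformly close to 1. Their values there are closed under squaring, and
  squaring repels from 1, so they are all equal to 1.\<close>

lemma annihilator_isolated:
  assumes lc: "locally_compact_space (euclidean :: 'a topology)"
  obtains V where "open V" "0 \<in> V" "\<And>x. x \<in> V \<Longrightarrow> (\<And>\<gamma>. \<gamma> \<in> \<Gamma> \<Longrightarrow> eval_char \<gamma> x = 1) \<Longrightarrow> x = 0"
proof -
  obtain U0 K0 where U0: "open U0" "compact K0" "(0::'a) \<in> U0" "U0 \<subseteq> K0"
    by (rule compact_nbhd[OF lc, of 0])
  obtain W where W: "open W" "0 \<in> W" "W \<subseteq> dual_nbhd K0 (1/2) 0"
    using open_dual_nbhd[OF U0(2), of "1/2" 0] by auto
  \<comment> \<open>The image of a translate of \<open>W\<close> in the quotient. Its preimage is a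
    union of translates of \<open>W\<close>, so these images form an open cover.\<close>
  define cov where "cov \<xi> = add_coset \<Gamma> ` ((\<lambda>w. \<xi> + w) ` W)" for \<xi>
  have "openin (quotient_topology \<Gamma>) (cov \<xi>)" for \<xi>
  proof -
    have "{\<zeta>. add_coset \<Gamma> \<zeta> \<in> cov \<xi>} = (\<Union>\<gamma>\<in>\<Gamma>. (\<lambda>w. (\<xi> + \<gamma>) + w) ` W)"
    proof (intro set_eqI iffI)
      fix \<zeta> assume "\<zeta> \<in> {\<zeta>. add_coset \<Gamma> \<zeta> \<in> cov \<xi>}"
      then obtain w where w: "w \<in> W" "add_coset \<Gamma> \<zeta> = add_coset \<Gamma> (\<xi> + w)" unfolding cov_def by auto
      have "\<zeta> \<in> add_coset \<Gamma> \<zeta>" unfolding add_coset_def using subgroup(1) by (intro image_eqI[of _ _ 0]) auto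
      then obtain \<gamma> where "\<gamma> \<in> \<Gamma>" "\<zeta> = \<xi> + w + \<gamma>" unfolding w(2) by (auto simp: add_coset_def)
      then show "\<zeta> \<in> (\<Union>\<gamma>\<in>\<Gamma>. (\<lambda>w. (\<xi> + \<gamma>) + w) ` W)" using w(1) by (auto intro!: bexI[of _ \<gamma>] image_eqI[of _ _ w])
    next
      fix \<zeta> assume "\<zeta> \<in> (\<Union>\<gamma>\<in>\<Gamma>. (\<lambda>w. (\<xi> + \<gamma>) + w) ` W)"
      then obtain \<gamma> w where g: "\<gamma> \<in> \<Gamma>" "w \<in> W" "\<zeta> = \<xi> + w + \<gamma>" by (auto simp: add_ac)
      have "add_coset \<Gamma> \<zeta> = add_coset \<Gamma> (\<xi> + w)"
        unfolding add_coset_def g(3)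
      proof (intro set_eqI iffI)
        fix z assume "z \<in> (\<lambda>h. \<xi> + w + \<gamma> + h) ` \<Gamma>"
        then obtain h where h: "h \<in> \<Gamma>" "z = \<xi> + w + \<gamma> + h" by auto
        show "z \<in> (\<lambda>h. \<xi> + w + h) ` \<Gamma>"
          by (intro image_eqI[of _ _ "\<gamma> + h"] subgroup(2) g h) (simp add: h(2) add_ac)
      next
        fix z assume "z \<in> (\<lambda>h. \<xi> + w + h) ` \<Gamma>"
        then obtain h where "h \<in> \<Gamma>" "z = \<xi> + w + h" by auto
        then show "z \<in> (\<lambda>h. \<xi> + w + \<gamma> + h) ` \<Gamma>"
          using subgroup(4)[OF _ g(1)] by (intro image_eqI[of _ _ "h - \<gamma>"]) auto
      qed
      then show "\<zeta> \<in> {\<zeta>. add_coset \<Gamma> \<zeta> \<in> cov \<xi>}" unfolding cov_def using g(2) by auto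
    qed
    then have "open {\<zeta>. add_coset \<Gamma> \<zeta> \<in> cov \<xi>}" using open_image_add[OF W(1)] by auto
    then show ?thesis unfolding openin_quotient_topology by (auto simp: cov_def)
  qed
  moreover have "range (add_coset \<Gamma>) \<subseteq> \<Union> (range cov)"
  proof
    fix C assume "C \<in> range (add_coset \<Gamma>)"
    then obtain \<xi> where "C = add_coset \<Gamma> \<xi>" by auto
    then have "C \<in> cov \<xi>" unfolding cov_def using W(2) by (intro image_eqI[of _ _ \<xi>] image_eqI[of _ _ 0]) auto
    then show "C \<in> \<Union> (range cov)" by blast
  qed
  moreover have "compactin (quotient_topology \<Gamma>) (range (add_coset \<Gamma>))"
    using lattice unfolding uniform_lattice_def compact_space_def topspace_quotient_topology by blast
  ultimately obtain \<F> where "finite \<F>" "\<F> \<subseteq> range cov" "range (add_coset \<Gamma>) \<subseteq> \<Union> \<F>"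
    unfolding compactin_def by (metis (no_types, lifting) imageE)
  then obtain X where X: "finite X" "range (add_coset \<Gamma>) \<subseteq> \<Union> (cov ` X)"
    using finite_subset_image[of \<F> cov UNIV] by auto
  have decomp: "\<exists>\<xi>\<in>X. \<exists>w\<in>W. \<exists>\<gamma>\<in>\<Gamma>. \<zeta> = \<xi> + w + \<gamma>" for \<zeta>
  proof -
    obtain \<xi> w where w: "\<xi> \<in> X" "w \<in> W" "add_coset \<Gamma> \<zeta> = add_coset \<Gamma> (\<xi> + w)"
      using X(2) unfolding cov_def by blast
    have "\<zeta> \<in> add_coset \<Gamma> \<zeta>" unfolding add_coset_def using subgroup(1) by (intro image_eqI[of _ _ 0]) auto
    then obtain \<gamma> where "\<gamma> \<in> \<Gamma>" "\<zeta> = \<xi> + w + \<gamma>" unfolding w(3) by (auto simp: add_coset_def)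
    then show ?thesis using w by blast
  qed
  \<comment> \<open>The finitely many representatives contribute 1/4 and the elements of
    \<open>W\<close> contribute 1/2, so every character stays within 3/4 of 1.\<close>
  define V where "V = U0 \<inter> (\<Inter>\<xi>\<in>X. eval_char \<xi> -` ball 1 (1/4))"
  have "open (eval_char \<xi> -` ball 1 (1/4))" for \<xi> :: "'a dual"
    by (rule open_vimage[OF open_ball continuous_eval_char])
  then have V: "open V" "0 \<in> V" unfolding V_def using X(1) U0 by (auto intro!: open_Int open_INT)
  show ?thesis
  proof (rule that[OF V])
    fix x assume x: "x \<in> V" and ann: "\<And>\<gamma>. \<gamma> \<in> \<Gamma> \<Longrightarrow> eval_char \<gamma> x = 1"
    have close: "cmod (eval_char \<zeta> x - 1) \<le> 3/4" for \<zeta>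
    proof -
      obtain \<xi> w \<gamma> where d: "\<xi> \<in> X" "w \<in> W" "\<gamma> \<in> \<Gamma>" "\<zeta> = \<xi> + w + \<gamma>" using decomp by blast
      have "cmod (eval_char w x - 1) < 1/2"
        using W(3) d(2) x U0(4) by (force simp: dual_nbhd_def dist_norm eval_char_zero V_def)
      moreover have "cmod (eval_char \<xi> x - 1) < 1/4"
        using x d(1) by (auto simp: V_def dist_norm norm_minus_commute)
      moreover have "eval_char \<zeta> x - 1 = eval_char \<xi> x * (eval_char w x - 1) + (eval_char \<xi> x - 1)"
        unfolding d(4) by (simp add: eval_char_plus ann[OF d(3)] algebra_simps)
      then have "cmod (eval_char \<zeta> x - 1) = cmod (eval_char \<xi> x * (eval_char w x - 1) + (eval_char \<xi> x - 1))"
        by (rule arg_cong)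
      moreover have "cmod (eval_char \<xi> x * (eval_char w x - 1)) = cmod (eval_char w x - 1)"
        by (simp add: norm_mult)
      ultimately show ?thesis
        using norm_triangle_ineq[of "eval_char \<xi> x * (eval_char w x - 1)" "eval_char \<xi> x - 1"] by linarith
    qed
    \<comment> \<open>For z = \<zeta>(x), |z^2 - 1| = |z + 1| |z - 1| and |z + 1| \<ge> 2 - 3/4 =
      5/4.\<close>
    have double: "5/4 * cmod (eval_char \<zeta> x - 1) \<le> cmod (eval_char (\<zeta> + \<zeta>) x - 1)" for \<zeta>
    proof -
      have "cmod 2 \<le> cmod (eval_char \<zeta> x + 1) + cmod (1 - eval_char \<zeta> x)"
        using norm_triangle_ineq[of "eval_char \<zeta> x + 1" "1 - eval_char \<zeta> x"] by simp
      then have "5/4 \<le> cmod (eval_char \<zeta> x + 1)" using close[of \<zeta>] by (simp add: norm_minus_commute)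
      then have "5/4 * cmod (eval_char \<zeta> x - 1) \<le> cmod (eval_char \<zeta> x + 1) * cmod (eval_char \<zeta> x - 1)"
        by (intro mult_right_mono) auto
      also have "\<dots> = cmod (eval_char (\<zeta> + \<zeta>) x - 1)"
        by (simp add: eval_char_plus algebra_simps flip: norm_mult)
      finally show ?thesis .
    qed
    have "(5/4)^n * cmod (eval_char \<zeta> x - 1) \<le> 3/4" for n \<zeta>
    proof (induction n arbitrary: \<zeta>)
      case 0 then show ?case using close by simp
    next
      case (Suc n)
      have "(5/4)^Suc n * cmod (eval_char \<zeta> x - 1) = (5/4)^n * (5/4 * cmod (eval_char \<zeta> x - 1))" by simp
      also have "\<dots> \<le> (5/4)^n * cmod (eval_char (\<zeta> + \<zeta>) x - 1)" by (intro mult_left_mono double) auto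
      also have "\<dots> \<le> 3/4" by (rule Suc)
      finally show ?case .
    qed
    then have "eval_char \<zeta> x = 1" for \<zeta>
    proof -
      assume *: "\<And>n \<zeta>. (5/4)^n * cmod (eval_char \<zeta> x - 1) \<le> 3/4"
      show ?thesis
      proof (rule ccontr)
        assume "eval_char \<zeta> x \<noteq> 1"
        then have p: "0 < cmod (eval_char \<zeta> x - 1)" by simp
        obtain n where "3/4 / cmod (eval_char \<zeta> x - 1) < (5/4)^n"
          using real_arch_pow[of "5/4" "3/4 / cmod (eval_char \<zeta> x - 1)"] by auto
        with p *[of n \<zeta>] show False by (simp add: pos_divide_less_eq)
      qed
    qed
    then show "x = 0" by (rule characters_separate[OF lc])
  qed
qed

text \<open>\<Gamma> fails to separate two points exactly when their difference lies in the
  annihilator. A compact neighbourhood so small that its differences stay where the annihilator is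
  trivial therefore suffices.\<close>

lemma separated_compact_nbhd:
  assumes lc: "locally_compact_space (euclidean :: 'a topology)"
  obtains U K where "open U" "x \<in> U" "U \<subseteq> K" "compact K"
    "\<And>y z. y \<in> K \<Longrightarrow> z \<in> K \<Longrightarrow> y \<noteq> z \<Longrightarrow> \<exists>\<gamma>\<in>\<Gamma>. eval_char \<gamma> y \<noteq> eval_char \<gamma> z"
proof -
  obtain V where V: "open V" "0 \<in> V" "\<And>x. x \<in> V \<Longrightarrow> (\<And>\<gamma>. \<gamma> \<in> \<Gamma> \<Longrightarrow> eval_char \<gamma> x = 1) \<Longrightarrow> x = 0"
    using annihilator_isolated[OF lc] by blast
  obtain U1 where U1: "open U1" "0 \<in> U1" "\<And>x y. x \<in> U1 \<Longrightarrow> y \<in> U1 \<Longrightarrow> x - y \<in> V"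
    using open_diff_nbhd[OF V(1,2)] by blast
  have "neighbourhood_base_of (compactin (euclidean :: 'a topology)) euclidean"
  proof -
    have "Hausdorff_space (euclidean :: 'a topology)"
      unfolding Hausdorff_space_def disjnt_def using hausdorff by (metis open_openin)
    then show ?thesis using lc locally_compact_space_neighbourhood_base by blast
  qed
  moreover have "openin euclidean ((\<lambda>y. x + y) ` U1)" "x \<in> (\<lambda>y. x + y) ` U1"
    using open_image_add[OF U1(1)] U1(2) by (auto intro!: image_eqI[of _ _ 0])
  ultimately obtain U K where UK: "open U" "compact K" "x \<in> U" "U \<subseteq> K" "K \<subseteq> (\<lambda>y. x + y) ` U1"
    unfolding neighbourhood_base_of by (metis compactin_euclidean_iff open_openin)
  show ?thesis
  proof (rule that[OF UK(1,3,4,2)])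
    fix y z assume yz: "y \<in> K" "z \<in> K" "y \<noteq> z"
    obtain a b where "a \<in> U1" "b \<in> U1" "y = x + a" "z = x + b" using yz UK(5) by blast
    then have "y - z \<in> V" using U1(3)[of a b] by simp
    with V(3)[of "y - z"] yz(3) obtain \<gamma> where g: "\<gamma> \<in> \<Gamma>" "eval_char \<gamma> (y - z) \<noteq> 1" by auto
    then have "eval_char \<gamma> y \<noteq> eval_char \<gamma> z" unfolding eval_char_diff_arg by auto
    then show "\<exists>\<gamma>\<in>\<Gamma>. eval_char \<gamma> y \<noteq> eval_char \<gamma> z" using g(1) by blast
  qed
qed

text \<open>The local Parseval identity for the indicator of a separated compact neighbourhood has a
  positive finite right side, which rules out both 0 and \<infinity> as the measure of the
  section.\<close>

lemma section_measure:
  assumes lc: "locally_compact_space (euclidean :: 'a topology)" and S: "borel_section \<Gamma> S"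
  shows "0 < measure \<nu> S" "emeasure \<nu> S = ennreal (measure \<nu> S)"
proof -
  obtain U K where UK: "open U" "0 \<in> U" "U \<subseteq> K" "compact K"
    and sep: "\<And>y z. y \<in> K \<Longrightarrow> z \<in> K \<Longrightarrow> y \<noteq> z \<Longrightarrow> \<exists>\<gamma>\<in>\<Gamma>. eval_char \<gamma> y \<noteq> eval_char \<gamma> z"
    using separated_compact_nbhd[OF lc, of 0] by blast
  define a where "a = (\<integral>\<^sup>+\<gamma>. ennreal ((cmod (L2_inner \<mu> (char_on K 0) (char_on K \<gamma>)))\<^sup>2) \<partial>count_space \<Gamma>)"
  define b where "b = L2_norm \<mu> (\<lambda>x. indicator K x * char_on K 0 x)"
  have eq: "a * emeasure \<nu> S = ennreal (b\<^sup>2)"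
    unfolding a_def b_def by (rule lattice_Parseval_local[OF UK(4) sep char_on_L2[OF UK(4)] S])
  have "(\<lambda>x. (cmod (indicator K x * char_on K 0 x))\<^sup>2) = (\<lambda>x. indicator K x)"
    by (auto simp: char_on_def indicator_def)
  then have "b\<^sup>2 = measure \<mu> K"
    unfolding b_def L2_norm_sq using K_sets[OF UK(4)] by (simp add: sets_\<mu>)
  moreover have "0 < emeasure \<mu> U" using haar_open_pos[OF haar(1) UK(1)] UK(2) by auto
  then have "0 < emeasure \<mu> K"
    using emeasure_mono[OF UK(3)] haar_compact_finite(2)[OF haar(1) UK(4)] by (metis order_less_le_trans)
  then have "0 < measure \<mu> K"
    using K_finite[OF UK(4)] by (simp add: measure_def enn2real_positive_iff less_top)
  ultimately have b: "0 < b\<^sup>2" by simp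
  have "emeasure \<nu> S \<noteq> 0" using eq b by auto
  moreover have "emeasure \<nu> S \<noteq> \<infinity>"
    using eq b by (cases "a = 0") (auto simp: ennreal_mult_top)
  ultimately show "0 < measure \<nu> S" "emeasure \<nu> S = ennreal (measure \<nu> S)"
    by (auto simp: measure_def enn2real_positive_iff less_top zero_less_iff_neq_zero)
qed

end

section \<open>The density bound\<close>

lemma nn_integral_count_space_Times:
  fixes f :: "'i \<times> 'j \<Rightarrow> ennreal"
  shows "(\<integral>\<^sup>+p. f p \<partial>count_space (A \<times> B)) = (\<integral>\<^sup>+a. \<integral>\<^sup>+b. f (a, b) \<partial>count_space B \<partial>count_space A)"
proof -
  have "(\<integral>\<^sup>+p. f p \<partial>count_space (A \<times> B)) = (\<integral>\<^sup>+p. f p * indicator (A \<times> B) p \<partial>count_space UNIV)"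
    by (simp add: nn_integral_count_space_indicator)
  also have "\<dots> = (\<integral>\<^sup>+a. \<integral>\<^sup>+b. f (a, b) * indicator (A \<times> B) (a, b) \<partial>count_space UNIV \<partial>count_space UNIV)"
    by (rule nn_integral_fst_count_space[symmetric])
  also have "\<dots> = (\<integral>\<^sup>+a. (\<integral>\<^sup>+b. f (a, b) * indicator B b \<partial>count_space UNIV) * indicator A a \<partial>count_space UNIV)"
    by (intro nn_integral_cong) (auto simp: indicator_def)
  finally show ?thesis by (simp add: nn_integral_count_space_indicator)
qed

section \<open>Time-frequency shifts and their commutation with the residual\<close>

context dual_lattice
begin

lemma L2_translate:
  assumes "u \<in> L2_space \<mu>"
  shows "(\<lambda>x. u (x + a)) \<in> L2_space \<mu>"
proof (rule L2_spaceI)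
  have [measurable]: "u \<in> borel_measurable \<mu>" using assms by (rule L2_measurable)
  show "(\<lambda>x. u (x + a)) \<in> borel_measurable \<mu>" by measurable
  have "(\<integral>\<^sup>+x. ennreal ((cmod (u (x + a)))\<^sup>2) \<partial>\<mu>) = (\<integral>\<^sup>+x. ennreal ((cmod (u x))\<^sup>2) \<partial>\<mu>)"
    by (rule haar_nn_integral_translate[OF haar(1), of "\<lambda>x. ennreal ((cmod (u x))\<^sup>2)"]) measurable
  then show "(\<integral>\<^sup>+x. ennreal ((cmod (u (x + a)))\<^sup>2) \<partial>\<mu>) < \<infinity>"
    by (simp add: L2_nn_integral assms)
qed

text \<open>As a function of its generator, \<open>gabor_system u i\<close> is the unitary
  time-frequency shift applied to \<open>u\<close>; this is the adjoint of that shift, and also its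
  inverse.\<close>

definition gabor_adjoint :: "'a \<times> 'a dual \<Rightarrow> ('a \<Rightarrow> complex) \<Rightarrow> 'a \<Rightarrow> complex" where
  "gabor_adjoint i u x = (case i of (a, \<gamma>) \<Rightarrow> eval_char (- \<gamma>) (x + a) * u (x + a))"

lemma gabor_system_eq: "gabor_system u (a, \<gamma>) x = eval_char \<gamma> x * u (x + (- a))"
  by (simp add: gabor_system_def modulation_def translation_def)

lemma gabor_L2: "u \<in> L2_space \<mu> \<Longrightarrow> gabor_system u i \<in> L2_space \<mu>"
  using L2_mult_char[OF L2_translate[of u "- fst i"], of "snd i"]
  by (cases i) (simp add: gabor_system_eq[abs_def])

lemma gabor_adjoint_L2: "u \<in> L2_space \<mu> \<Longrightarrow> gabor_adjoint i u \<in> L2_space \<mu>"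
  using L2_translate[OF L2_mult_char, of u "- snd i" "fst i"]
  by (cases i) (simp add: gabor_adjoint_def[abs_def])

lemma gabor_adjoint:
  assumes u: "u \<in> L2_space \<mu>" and v: "v \<in> L2_space \<mu>"
  shows "L2_inner \<mu> (gabor_system u i) v = L2_inner \<mu> u (gabor_adjoint i v)"
proof -
  obtain a \<gamma> where i: "i = (a, \<gamma>)" by fastforce
  have [measurable]: "u \<in> borel_measurable \<mu>" "v \<in> borel_measurable \<mu>" using u v by (auto intro: L2_measurable)
  let ?g = "\<lambda>x. u x * cnj (gabor_adjoint i v x)"
  have m: "?g \<in> borel_measurable \<mu>"
    using gabor_adjoint_L2[OF v, of i] by measurable
  have "L2_inner \<mu> (gabor_system u i) v = (LINT x|\<mu>. ?g (x + (- a)))"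
    unfolding L2_inner_def
    by (rule Bochner_Integration.integral_cong) (auto simp: i gabor_system_eq gabor_adjoint_def eval_char_uminus)
  also have "\<dots> = (LINT x|\<mu>. ?g x)" by (rule haar_integral_translate[OF haar(1) m])
  finally show ?thesis by (simp add: L2_inner_def)
qed

lemma gabor_unitary:
  assumes u: "u \<in> L2_space \<mu>" and v: "v \<in> L2_space \<mu>"
  shows "L2_inner \<mu> (gabor_system u i) (gabor_system v i) = L2_inner \<mu> u v"
proof -
  have "gabor_adjoint i (gabor_system v i) = v"
    using eval_char_cnj_mult(1)
    by (cases i) (auto simp: gabor_adjoint_def gabor_system_eq eval_char_uminus mult.assoc[symmetric])
  then show ?thesis by (simp add: gabor_adjoint[OF u gabor_L2[OF v]])
qed

text \<open>Translation and modulation commute only up to a phase, so the shifts form a projective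
  representation. The cocycle has modulus 1 and disappears from products in which a shifted
  generator occurs once in each slot.\<close>

lemma gabor_compose:
  "gabor_system f (a + b, \<gamma> + \<delta>) = (\<lambda>x. eval_char \<delta> a * gabor_system (gabor_system f (b, \<delta>)) (a, \<gamma>) x)"
proof
  fix x
  have x: "x + - (a + b) = x + - a + - b" by (simp add: algebra_simps)
  have "eval_char \<delta> x = eval_char \<delta> a * eval_char \<delta> (x + - a)"
    by (subst eval_char_add_arg[symmetric]) simp
  then show "gabor_system f (a + b, \<gamma> + \<delta>) x = eval_char \<delta> a * gabor_system (gabor_system f (b, \<delta>)) (a, \<gamma>) x"
    by (simp only: gabor_system_eq eval_char_plus x mult_ac)
qed

text \<open>The residual \<open>1 - S\<close> of a Gabor system commutes with the time-frequency shifts, whose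
  cocycle phases cancel in \<open>S\<close>.\<close>

lemma gabor_residual_commute:
  fixes \<Lambda> :: "'a set"
  assumes res: "frame_residual \<mu> (\<Lambda> \<times> \<Gamma>) (gabor_system f) R" and \<Lambda>: "add_subgroup \<Lambda>"
    and f: "f \<in> L2_space \<mu>" and i: "i \<in> \<Lambda> \<times> \<Gamma>" and v: "v \<in> L2_space \<mu>" and u: "u \<in> L2_space \<mu>"
  shows "L2_inner \<mu> ((R ^^ j) (gabor_system v i)) u = L2_inner \<mu> ((R ^^ j) v) (gabor_adjoint i u)"
proof -
  interpret frame_residual \<mu> "\<Lambda> \<times> \<Gamma>" "gabor_system f" R by (rule res)
  obtain a \<gamma> where ag: "i = (a, \<gamma>)" "a \<in> \<Lambda>" "\<gamma> \<in> \<Gamma>" using i by auto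
  have \<Lambda>': "x + y \<in> \<Lambda>" "x - y \<in> \<Lambda>" if "x \<in> \<Lambda>" "y \<in> \<Lambda>" for x y
    using \<Lambda> that unfolding add_subgroup_def diff_conv_add_uminus by blast+
  have one: "L2_inner \<mu> (R (gabor_system v i)) u = L2_inner \<mu> (R v) (gabor_adjoint i u)"
    if v: "v \<in> L2_space \<mu>" and u: "u \<in> L2_space \<mu>" for u v
  proof -
    \<comment> \<open>Translation by \<open>i\<close> permutes the index group, so the frame sum may
      be reindexed by it; in each term the phase meets its conjugate.\<close>
    define t where "t k = (a + fst k, \<gamma> + snd k)" for k :: "'a \<times> 'a dual"
    have t: "bij_betw t (\<Lambda> \<times> \<Gamma>) (\<Lambda> \<times> \<Gamma>)"
      by (rule bij_betw_byWitness[where f' = "\<lambda>k. (fst k - a, snd k - \<gamma>)"])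
        (use ag \<Lambda>' subgroup in \<open>auto simp: t_def\<close>)
    have phase: "L2_inner \<mu> (gabor_system v i) (gabor_system f (t k)) * L2_inner \<mu> (gabor_system f (t k)) u
      = L2_inner \<mu> v (gabor_system f k) * L2_inner \<mu> (gabor_system f k) (gabor_adjoint i u)" for k
    proof -
      obtain b \<delta> where k: "k = (b, \<delta>)" by fastforce
      have c: "gabor_system f (t k) = (\<lambda>x. eval_char \<delta> a * gabor_system (gabor_system f k) i x)"
        unfolding t_def k ag(1) fst_conv snd_conv by (rule gabor_compose)
      have "L2_inner \<mu> (gabor_system v i) (gabor_system f (t k)) * L2_inner \<mu> (gabor_system f (t k)) u
        = (cnj (eval_char \<delta> a) * eval_char \<delta> a) * (L2_inner \<mu> v (gabor_system f k) * L2_inner \<mu> (gabor_system f k) (gabor_adjoint i u))"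
        unfolding c L2_inner_scale_left L2_inner_scale_right
        by (simp only: gabor_unitary[OF v gabor_L2[OF f]] gabor_adjoint[OF gabor_L2[OF f] u] mult_ac)
      then show ?thesis by simp
    qed
    have "((\<lambda>k. L2_inner \<mu> v (gabor_system f k) * L2_inner \<mu> (gabor_system f k) (gabor_adjoint i u))
        has_sum L2_inner \<mu> (gabor_system v i) u - L2_inner \<mu> (R (gabor_system v i)) u) (\<Lambda> \<times> \<Gamma>)"
      using resid[OF gabor_L2[OF v, of i] u] has_sum_reindex_bij_betw[OF t,
        of "\<lambda>k. L2_inner \<mu> (gabor_system v i) (gabor_system f k) * L2_inner \<mu> (gabor_system f k) u"]
      unfolding phase by blast
    from has_sum_unique[OF this resid[OF v gabor_adjoint_L2[OF u]]] show ?thesis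
      by (simp add: gabor_adjoint[OF v u])
  qed
  show ?thesis using v u
  proof (induction j arbitrary: u)
    case 0
    then show ?case by (simp add: gabor_adjoint)
  next
    case (Suc j)
    \<comment> \<open>One factor \<open>R\<close> is parked on \<open>u\<close> while the induction
      hypothesis moves the shift past the remaining power, then brought back and commuted by
      \<open>one\<close>.\<close>
    note Rv = R_pow[OF Suc.prems(1), of j]
    have "L2_inner \<mu> ((R ^^ Suc j) (gabor_system v i)) u = L2_inner \<mu> ((R ^^ j) (gabor_system v i)) (R u)"
      using Suc.prems by (simp add: R_selfadjoint R_pow gabor_L2)
    also have "\<dots> = L2_inner \<mu> ((R ^^ j) v) (gabor_adjoint i (R u))" using Suc by (simp add: R)
    also have "\<dots> = L2_inner \<mu> (gabor_system ((R ^^ j) v) i) (R u)"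
      using Suc.prems Rv by (simp add: gabor_adjoint R)
    also have "\<dots> = L2_inner \<mu> (R (gabor_system ((R ^^ j) v) i)) u"
      using Suc.prems Rv by (simp add: R_selfadjoint gabor_L2)
    also have "\<dots> = L2_inner \<mu> ((R ^^ Suc j) v) (gabor_adjoint i u)"
      using one[OF Rv Suc.prems(2)] by simp
    finally show ?case .
  qed
qed

text \<open>For fixed piece and translation, the local Parseval identity sums over \<Gamma> to the
  energy of \<open>u\<close> on a translate of \<open>E n\<close>; the factor
  \<open>sqrt (measure \<nu> S)\<close> absorbs the measure of the section. Summing over pieces and
  translations exhausts the group, since the translates of the pieces tile it.\<close>

lemma indicator_gabor_Parseval:
  fixes \<Lambda> S\<^sub>\<Lambda> :: "'a set" and K E :: "nat \<Rightarrow> 'a set"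
  assumes lc: "locally_compact_space (euclidean :: 'a topology)"
    and S: "borel_section \<Gamma> S" and \<Lambda>: "add_subgroup \<Lambda>" "countable \<Lambda>" "borel_section \<Lambda> S\<^sub>\<Lambda>"
    and K: "\<And>n. compact (K n)"
    and sep: "\<And>n y z. y \<in> K n \<Longrightarrow> z \<in> K n \<Longrightarrow> y \<noteq> z \<Longrightarrow> \<exists>\<gamma>\<in>\<Gamma>. eval_char \<gamma> y \<noteq> eval_char \<gamma> z"
    and E: "\<And>n. E n \<in> sets borel" "\<And>n. E n \<subseteq> K n" "disjoint_family E" "(\<Union>n. E n) = S\<^sub>\<Lambda>"
    and u: "u \<in> L2_space \<mu>"
  shows "((\<lambda>(n, i). (cmod (L2_inner \<mu> u (gabor_adjoint i
      (\<lambda>x. complex_of_real (sqrt (measure \<nu> S)) * indicator (E n) x))))\<^sup>2) has_sum (L2_norm \<mu> u)\<^sup>2) (UNIV \<times> (\<Lambda> \<times> \<Gamma>))"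
proof (rule has_sum_nn_integral_count_space)
  note [measurable] = E(1)
  have [measurable]: "u \<in> borel_measurable \<mu>" using u by (rule L2_measurable)
  let ?s = "measure \<nu> S"
  let ?g = "\<lambda>n x. complex_of_real (sqrt ?s) * indicator (E n) x"
  note s = section_measure[OF lc S]
  have inner: "(\<integral>\<^sup>+\<gamma>. ennreal ((cmod (L2_inner \<mu> u (gabor_adjoint (a, \<gamma>) (?g n))))\<^sup>2) \<partial>count_space \<Gamma>)
      = (\<integral>\<^sup>+y. ennreal ((cmod (u y))\<^sup>2) * indicator (E n) (y + a) \<partial>\<mu>)" for n a
  proof -
    define v where "v x = indicator (E n) x * u (x + (- a))" for x
    have v: "v \<in> L2_space \<mu>" unfolding v_def by (intro L2_mult_indicator L2_translate u E)
    have vm [measurable]: "v \<in> borel_measurable \<mu>" using v by (rule L2_measurable)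
    \<comment> \<open>The change of variable moves the translation onto \<open>u\<close>. The
      adjoint shift leaves the frequency \<open>- \<gamma>\<close>, and negation is a bijection of
      \<Gamma>.\<close>
    have gn: "L2_inner \<mu> u (gabor_adjoint (a, \<gamma>) (?g n)) = complex_of_real (sqrt ?s) * L2_inner \<mu> v (char_on (K n) (- \<gamma>))" for \<gamma>
    proof -
      let ?h = "\<lambda>x. complex_of_real (sqrt ?s) * (v x * cnj (char_on (K n) (- \<gamma>) x))"
      have m: "?h \<in> borel_measurable \<mu>"
        using char_on_L2[OF K, of n "- \<gamma>"] by measurable
      have "L2_inner \<mu> u (gabor_adjoint (a, \<gamma>) (?g n)) = (LINT x|\<mu>. ?h (x + a))"
        unfolding L2_inner_def
        by (rule Bochner_Integration.integral_cong)
          (use E(2) in \<open>auto simp: gabor_adjoint_def v_def char_on_def eval_char_uminus indicator_def\<close>)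
      also have "\<dots> = (LINT x|\<mu>. ?h x)" by (rule haar_integral_translate[OF haar(1) m])
      finally show ?thesis by (simp add: L2_inner_def)
    qed
    have bij: "bij_betw uminus \<Gamma> \<Gamma>"
      by (rule bij_betw_byWitness[where f' = uminus]) (use subgroup in auto)
    have "(\<integral>\<^sup>+\<gamma>. ennreal ((cmod (L2_inner \<mu> u (gabor_adjoint (a, \<gamma>) (?g n))))\<^sup>2) \<partial>count_space \<Gamma>)
      = (\<integral>\<^sup>+\<gamma>. ennreal ((cmod (L2_inner \<mu> v (char_on (K n) (- \<gamma>))))\<^sup>2) * emeasure \<nu> S \<partial>count_space \<Gamma>)"
      unfolding gn s(2) by (intro nn_integral_cong) (simp add: norm_mult power_mult_distrib ennreal_mult mult.commute)
    also have "\<dots> = (\<integral>\<^sup>+\<gamma>. ennreal ((cmod (L2_inner \<mu> v (char_on (K n) (- \<gamma>))))\<^sup>2) \<partial>count_space \<Gamma>) * emeasure \<nu> S"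
      by (rule nn_integral_multc) simp
    also have "(\<integral>\<^sup>+\<gamma>. ennreal ((cmod (L2_inner \<mu> v (char_on (K n) (- \<gamma>))))\<^sup>2) \<partial>count_space \<Gamma>)
        = (\<integral>\<^sup>+\<gamma>. ennreal ((cmod (L2_inner \<mu> v (char_on (K n) \<gamma>)))\<^sup>2) \<partial>count_space \<Gamma>)"
      by (rule nn_integral_bij_count_space[OF bij])
    also have "\<dots> * emeasure \<nu> S = ennreal ((L2_norm \<mu> (\<lambda>x. indicator (K n) x * v x))\<^sup>2)"
      by (rule lattice_Parseval_local[OF K sep v S])
    also have "(\<lambda>x. indicator (K n) x * v x) = v"
      by (rule ext) (use E(2)[of n] in \<open>auto simp: v_def indicator_def\<close>)
    also have "ennreal ((L2_norm \<mu> v)\<^sup>2) = (\<integral>\<^sup>+x. ennreal ((cmod (v x))\<^sup>2) \<partial>\<mu>)"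
      by (rule L2_nn_integral[OF v, symmetric])
    also have "\<dots> = (\<integral>\<^sup>+x. ennreal ((cmod (v (x + a)))\<^sup>2) \<partial>\<mu>)"
      by (rule haar_nn_integral_translate[OF haar(1), of "\<lambda>x. ennreal ((cmod (v x))\<^sup>2)", symmetric]) measurable
    also have "\<dots> = (\<integral>\<^sup>+y. ennreal ((cmod (u y))\<^sup>2) * indicator (E n) (y + a) \<partial>\<mu>)"
      by (intro nn_integral_cong) (auto simp: v_def indicator_def)
    finally show ?thesis .
  qed
  have [measurable]: "(\<lambda>y. indicator (E n) (y + a) :: ennreal) \<in> borel_measurable \<mu>" for n a
    by (rule measurable_compose[OF translate_measurable]) measurable
  have uniq: "\<exists>!h. h \<in> \<Lambda> \<and> y + h \<in> S\<^sub>\<Lambda>" for y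
  proof -
    obtain h where h: "h \<in> \<Lambda>" "y - h \<in> S\<^sub>\<Lambda>" "\<And>k. k \<in> \<Lambda> \<Longrightarrow> y - k \<in> S\<^sub>\<Lambda> \<Longrightarrow> k = h"
      using borel_section_unique[OF \<Lambda>(3,1), of y] by blast
    have neg: "- k \<in> \<Lambda>" if "k \<in> \<Lambda>" for k using \<Lambda>(1) that by (simp add: add_subgroup_def)
    show ?thesis
    proof (rule ex1I[of _ "- h"])
      show "- h \<in> \<Lambda> \<and> y + - h \<in> S\<^sub>\<Lambda>" using h(2) neg[OF h(1)] by simp
      fix k assume "k \<in> \<Lambda> \<and> y + k \<in> S\<^sub>\<Lambda>"
      then have "- k = h" using neg[of k] by (intro h(3)) auto
      then show "k = - h" by auto
    qed
  qed
  \<comment> \<open>The tiling property: \<Lambda> brings \<open>y\<close> into the section in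
    exactly one way, and the resulting point lies in exactly one piece.\<close>
  have uniq2: "\<exists>!p. p \<in> UNIV \<times> \<Lambda> \<and> y + snd p \<in> E (fst p)" for y
  proof -
    obtain h where h: "h \<in> \<Lambda>" "y + h \<in> S\<^sub>\<Lambda>" "\<And>k. k \<in> \<Lambda> \<Longrightarrow> y + k \<in> S\<^sub>\<Lambda> \<Longrightarrow> k = h"
      using uniq[of y] by metis
    have "y + h \<in> (\<Union>n. E n)" unfolding E(4) by (rule h(2))
    then obtain n where n: "y + h \<in> E n" by (rule UN_E)
    show ?thesis
    proof (rule ex1I[of _ "(n, h)"])
      fix p assume p: "p \<in> UNIV \<times> \<Lambda> \<and> y + snd p \<in> E (fst p)"
      then have "y + snd p \<in> (\<Union>n. E n)" by (intro UN_I[of "fst p"]) auto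
      then have "snd p = h" using h(3)[of "snd p"] p unfolding E(4) by (simp add: mem_Times_iff)
      moreover from this p n have "fst p = n"
        using E(3) unfolding disjoint_family_on_def by blast
      ultimately show "p = (n, h)" by (simp add: prod_eq_iff)
    qed (use h(1) n in simp)
  qed
  have "(\<integral>\<^sup>+p. ennreal (case p of (n, i) \<Rightarrow> (cmod (L2_inner \<mu> u (gabor_adjoint i (?g n))))\<^sup>2) \<partial>count_space (UNIV \<times> (\<Lambda> \<times> \<Gamma>)))
    = (\<integral>\<^sup>+n. \<integral>\<^sup>+a. \<integral>\<^sup>+y. ennreal ((cmod (u y))\<^sup>2) * indicator (E n) (y + a) \<partial>\<mu> \<partial>count_space \<Lambda> \<partial>count_space UNIV)"
    unfolding nn_integral_count_space_Times by (simp only: prod.case inner)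
  also have "\<dots> = (\<integral>\<^sup>+p. \<integral>\<^sup>+y. ennreal ((cmod (u y))\<^sup>2) * indicator (E (fst p)) (y + snd p) \<partial>\<mu> \<partial>count_space (UNIV \<times> \<Lambda>))"
    by (simp add: nn_integral_count_space_Times)
  also have "\<dots> = (\<integral>\<^sup>+y. \<integral>\<^sup>+p. ennreal ((cmod (u y))\<^sup>2) * indicator (E (fst p)) (y + snd p) \<partial>count_space (UNIV \<times> \<Lambda>) \<partial>\<mu>)"
    by (rule nn_integral_count_space_nn_integral[symmetric]) (use \<Lambda>(2) in auto)
  also have "\<dots> = (\<integral>\<^sup>+y. ennreal ((cmod (u y))\<^sup>2) \<partial>\<mu>)"
  proof (rule nn_integral_cong)
    fix y
    have i: "indicator (E (fst p)) (y + snd p) = indicator {p. y + snd p \<in> E (fst p)} p" for p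
      by (simp add: indicator_def)
    show "(\<integral>\<^sup>+p. ennreal ((cmod (u y))\<^sup>2) * indicator (E (fst p)) (y + snd p) \<partial>count_space (UNIV \<times> \<Lambda>)) = ennreal ((cmod (u y))\<^sup>2)"
      unfolding i by (rule nn_integral_count_space_unique[OF uniq2])
  qed
  also have "\<dots> = ennreal ((L2_norm \<mu> u)\<^sup>2)" by (rule L2_nn_integral[OF u])
  finally show "(\<integral>\<^sup>+p. ennreal (case p of (n, i) \<Rightarrow> (cmod (L2_inner \<mu> u (gabor_adjoint i (?g n))))\<^sup>2) \<partial>count_space (UNIV \<times> (\<Lambda> \<times> \<Gamma>)))
    = ennreal ((L2_norm \<mu> u)\<^sup>2)" .
qed auto

text \<open>Second countability reduces the cover by separated neighbourhoods to a sequence, which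
  is what allows the section to be cut into countably many pieces.\<close>

lemma separated_compact_cover:
  assumes lc: "locally_compact_space (euclidean :: 'a topology)"
  obtains K :: "nat \<Rightarrow> 'a set" where "\<And>n. compact (K n)" "(\<Union>n. K n) = UNIV"
    "\<And>n y z. y \<in> K n \<Longrightarrow> z \<in> K n \<Longrightarrow> y \<noteq> z \<Longrightarrow> \<exists>\<gamma>\<in>\<Gamma>. eval_char \<gamma> y \<noteq> eval_char \<gamma> z"
proof -
  define good where "good K \<longleftrightarrow> compact K \<and>
    (\<forall>y\<in>K. \<forall>z\<in>K. y \<noteq> z \<longrightarrow> (\<exists>\<gamma>\<in>\<Gamma>. eval_char \<gamma> y \<noteq> eval_char \<gamma> z))" for K :: "'a set"
  define \<U> where "\<U> = {U :: 'a set. open U \<and> (\<exists>K. U \<subseteq> K \<and> good K)}"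
  have cover: "\<Union>\<U> = UNIV"
  proof (intro set_eqI iffI UNIV_I)
    fix x :: 'a
    obtain U K where "open U" "x \<in> U" "U \<subseteq> K" "compact K"
      "\<And>y z. y \<in> K \<Longrightarrow> z \<in> K \<Longrightarrow> y \<noteq> z \<Longrightarrow> \<exists>\<gamma>\<in>\<Gamma>. eval_char \<gamma> y \<noteq> eval_char \<gamma> z"
      using separated_compact_nbhd[OF lc, of x] by blast
    then have "good K" "U \<in> \<U>" unfolding good_def \<U>_def by blast+
    then show "x \<in> \<Union>\<U>" using \<open>x \<in> U\<close> by blast
  qed
  obtain \<V> where \<V>: "\<V> \<subseteq> \<U>" "countable \<V>" "\<Union>\<V> = UNIV"
    using Lindelof[of \<U>] cover unfolding \<U>_def by (metis (no_types, lifting) mem_Collect_eq)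
  have ne: "\<V> \<noteq> {}" using \<V>(3) by auto
  have "\<exists>K. from_nat_into \<V> n \<subseteq> K \<and> good K" for n
    using from_nat_into[OF ne, of n] \<V>(1) unfolding \<U>_def by blast
  then obtain K where K: "\<And>n. from_nat_into \<V> n \<subseteq> K n" "\<And>n. good (K n)" by metis
  show ?thesis
  proof (rule that[of K])
    show "(\<Union>n. K n) = UNIV"
    proof (intro set_eqI iffI UNIV_I)
      fix x
      have "x \<in> \<Union>\<V>" unfolding \<V>(3) by (rule UNIV_I)
      then obtain U where U: "U \<in> \<V>" "x \<in> U" by (rule UnionE)
      then obtain n where "from_nat_into \<V> n = U"
        using from_nat_into_surj[OF \<V>(2)] by metis
      then have "x \<in> K n" using U(2) K(1)[of n] by auto
      then show "x \<in> (\<Union>n. K n)" by blast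
    qed
  qed (use K(2) in \<open>unfold good_def, blast+\<close>)
qed

end

text \<open>Normalise \<open>f\<close> so that its Bessel bound is \<open>1\<close>; the tight frame used as test family
  is generated by the pieces of the section of \<open>\<Lambda>\<close> on which \<open>\<Gamma>\<close> separates points.\<close>

theorem theorem3p1:
  fixes \<mu> :: "'a::{topological_ab_group_add, t2_space, second_countable_topology} measure"
    and \<nu> :: "'a dual measure"
    and \<Lambda> S\<^sub>\<Lambda> S\<^sub>A :: "'a set"
    and \<Gamma> S\<^sub>\<Gamma> :: "'a dual set"
    and f :: "'a \<Rightarrow> complex"
  assumes "locally_compact_space (euclidean :: 'a topology)"
    and "infinite (UNIV :: 'a set)"
    and "dual_haar_measures \<mu> \<nu>"
    and "uniform_lattice \<Lambda>" and "countable \<Lambda>"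
    and "uniform_lattice \<Gamma>" and "countable \<Gamma>"
    and "borel_section \<Lambda> S\<^sub>\<Lambda>"
    and "borel_section (annihilator \<Gamma>) S\<^sub>A"
    and "borel_section \<Gamma> S\<^sub>\<Gamma>"
    and "\<exists>(k::nat) \<alpha>. (\<forall>i\<in>{1..k}. \<alpha> i \<in> annihilator \<Gamma>) \<and>
           (\<Union>i\<in>{1..k}. ((\<lambda>s. \<alpha> i + s) ` S\<^sub>A) \<inter> S\<^sub>\<Lambda>) = S\<^sub>\<Lambda>"
    and "f \<in> L2_space \<mu>"
    and "complete_family \<mu> (\<Lambda> \<times> \<Gamma>) (gabor_system f)"
    and "bessel_sequence \<mu> (\<Lambda> \<times> \<Gamma>) (gabor_system f)"
  shows "lattice_size \<mu> \<nu> S\<^sub>\<Lambda> S\<^sub>\<Gamma> \<le> 1"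
proof -
  note lc = assms(1) and f = assms(12) and complete = assms(13)
  interpret dual_lattice \<mu> \<nu> \<Gamma> by standard (fact assms(3) assms(6) assms(7))+
  have \<Lambda>: "add_subgroup \<Lambda>" using assms(4) by (simp add: uniform_lattice_def)
  obtain B where B: "B > 0" and bessel: "\<And>g. g \<in> L2_space \<mu> \<Longrightarrow>
      (\<lambda>i. (cmod (L2_inner \<mu> g (gabor_system f i)))\<^sup>2) summable_on \<Lambda> \<times> \<Gamma> \<and>
      (\<Sum>\<^sub>\<infinity>i\<in>\<Lambda> \<times> \<Gamma>. (cmod (L2_inner \<mu> g (gabor_system f i)))\<^sup>2) \<le> B * (L2_norm \<mu> g)\<^sup>2"
    using assms(14) unfolding bessel_sequence_def by blast
  define f' where "f' x = complex_of_real (1 / sqrt B) * f x" for x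
  have f': "f' \<in> L2_space \<mu>" unfolding f'_def by (rule L2_scale[OF f])
  have gf': "gabor_system f' i = (\<lambda>x. complex_of_real (1 / sqrt B) * gabor_system f i x)" for i
    by (cases i) (auto simp: gabor_system_eq f'_def)
  have inner': "(cmod (L2_inner \<mu> g (gabor_system f' i)))\<^sup>2 = (cmod (L2_inner \<mu> g (gabor_system f i)))\<^sup>2 / B" for g i
    unfolding gf' L2_inner_scale_right norm_mult power_mult_distrib
    using B by (simp add: power_divide norm_divide)
  have bessel': "(\<Sum>i\<in>J. (cmod (L2_inner \<mu> g (gabor_system f' i)))\<^sup>2) \<le> (L2_norm \<mu> g)\<^sup>2"
    if "g \<in> L2_space \<mu>" "finite J" "J \<subseteq> \<Lambda> \<times> \<Gamma>" for g J
  proof -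
    have "(\<Sum>i\<in>J. (cmod (L2_inner \<mu> g (gabor_system f i)))\<^sup>2) \<le> B * (L2_norm \<mu> g)\<^sup>2"
      using finite_sum_le_infsum[of "\<lambda>i. (cmod (L2_inner \<mu> g (gabor_system f i)))\<^sup>2" "\<Lambda> \<times> \<Gamma>" J]
        bessel[OF that(1)] that by (meson order_trans zero_le_power2)
    then show ?thesis
      unfolding inner' sum_divide_distrib[symmetric] using B by (simp add: pos_divide_le_eq mult.commute)
  qed
  have gL2: "gabor_system f' i \<in> L2_space \<mu>" for i by (rule gabor_L2[OF f'])
  obtain R where R: "frame_residual \<mu> (\<Lambda> \<times> \<Gamma>) (gabor_system f') R"
    using frame_residual_exists[of "\<Lambda> \<times> \<Gamma>" "gabor_system f'" \<mu>] gL2 bessel' by metis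
  have complete': "complete_family \<mu> (\<Lambda> \<times> \<Gamma>) (gabor_system f')"
  proof -
    have "family_span (\<Lambda> \<times> \<Gamma>) (gabor_system f) \<subseteq> family_span (\<Lambda> \<times> \<Gamma>) (gabor_system f')"
    proof
      fix h assume "h \<in> family_span (\<Lambda> \<times> \<Gamma>) (gabor_system f)"
      then obtain J c where J: "finite J" "J \<subseteq> \<Lambda> \<times> \<Gamma>" and h: "h = (\<lambda>x. \<Sum>i\<in>J. c i * gabor_system f i x)"
        unfolding family_span_def by blast
      have "h = (\<lambda>x. \<Sum>i\<in>J. (c i * complex_of_real (sqrt B)) * gabor_system f' i x)"
        unfolding h gf' using B by simp
      then show "h \<in> family_span (\<Lambda> \<times> \<Gamma>) (gabor_system f')"
        unfolding family_span_def
        by (intro CollectI exI[of _ J] exI[of _ "\<lambda>i. c i * complex_of_real (sqrt B)"] conjI J)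
    qed
    then show ?thesis using complete gL2 unfolding complete_family_def by blast
  qed
  obtain K :: "nat \<Rightarrow> 'a set" where K: "\<And>n. compact (K n)" "(\<Union>n. K n) = UNIV"
    and sep: "\<And>n y z. y \<in> K n \<Longrightarrow> z \<in> K n \<Longrightarrow> y \<noteq> z \<Longrightarrow> \<exists>\<gamma>\<in>\<Gamma>. eval_char \<gamma> y \<noteq> eval_char \<gamma> z"
    using separated_compact_cover[OF lc] by blast
  \<comment> \<open>Disjointing the cover keeps each piece inside \<open>K n\<close>, so the
    separation needed for the local Parseval identity is inherited.\<close>
  define E where "E n = S\<^sub>\<Lambda> \<inter> disjointed K n" for n
  have S\<Lambda>: "S\<^sub>\<Lambda> \<in> sets borel" using assms(8) by (simp add: borel_section_def)
  have "range (disjointed K) \<subseteq> sets borel"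
    by (rule sets.range_disjointed_sets) (auto intro: K_sets[OF K(1)])
  then have E1: "E n \<in> sets borel" for n unfolding E_def using S\<Lambda> by (intro sets.Int) auto
  have E2: "E n \<subseteq> K n" for n unfolding E_def using disjointed_subset[of K n] by blast
  have E3: "disjoint_family E"
    using disjoint_family_disjointed[of K] unfolding disjoint_family_on_def E_def by blast
  have "(\<Union>n. E n) = S\<^sub>\<Lambda> \<inter> (\<Union>n. disjointed K n)" unfolding E_def by blast
  then have E4: "(\<Union>n. E n) = S\<^sub>\<Lambda>" unfolding UN_disjointed_eq K(2) by simp
  let ?s = "measure \<nu> S\<^sub>\<Gamma>"
  note s = section_measure[OF lc assms(10)]
  have finE: "emeasure \<mu> (E n) < \<infinity>" for n
    using emeasure_mono[OF E2[of n], of \<mu>] K_finite[OF K(1)] K_sets[OF K(1)]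
    by (simp add: sets_\<mu> le_less_trans)
  define g where "g n x = complex_of_real (sqrt ?s) * indicator (E n) x" for n x
  have ind_sq: "(\<lambda>x. (cmod (indicator (E n) x :: complex))\<^sup>2) = (\<lambda>x. indicator (E n) x :: real)" for n
    by (auto simp: indicator_def)
  have indE: "(indicator (E n) :: 'a \<Rightarrow> complex) \<in> L2_space \<mu>" for n
    using finE[of n] E1[of n] by (simp add: L2_space_def ind_sq sets_\<mu>)
  have g: "g n \<in> L2_space \<mu>" for n unfolding g_def by (rule L2_scale[OF indE])
  have norm_g: "(L2_norm \<mu> (g n))\<^sup>2 = ?s * measure \<mu> (E n)" for n
    unfolding g_def L2_norm_scale power_mult_distrib
    using E1[of n] by (simp add: L2_norm_sq ind_sq sets_\<mu>)
  \<comment> \<open>The trivial shift, whose index singles out \<open>f'\<close> as the generator in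
    the trace argument.\<close>
  have i0: "(0, 0) \<in> \<Lambda> \<times> \<Gamma>" using \<Lambda> subgroup(1) by (simp add: add_subgroup_def)
  have F0: "gabor_system f' (0, 0) = f'" by (auto simp: gabor_system_eq eval_char_zero)
  have bound: "(\<Sum>n<m. (L2_norm \<mu> (g n))\<^sup>2) \<le> 1" for m
  proof (rule frame_residual.trace_bound[OF R complete' i0 g])
    show "gabor_adjoint i u \<in> L2_space \<mu>" if "u \<in> L2_space \<mu>" for i u by (rule gabor_adjoint_L2[OF that])
    show "L2_inner \<mu> ((R ^^ j) (gabor_system f' i)) u = L2_inner \<mu> ((R ^^ j) (gabor_system f' (0, 0))) (gabor_adjoint i u)"
      if "i \<in> \<Lambda> \<times> \<Gamma>" "u \<in> L2_space \<mu>" for i u j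
      unfolding F0 by (rule gabor_residual_commute[OF R \<Lambda> f' that(1) f' that(2)])
    show "((\<lambda>(n, i). (cmod (L2_inner \<mu> u (gabor_adjoint i (g n))))\<^sup>2) has_sum (L2_norm \<mu> u)\<^sup>2) (UNIV \<times> (\<Lambda> \<times> \<Gamma>))"
      if "u \<in> L2_space \<mu>" for u
      unfolding g_def[abs_def]
      by (rule indicator_gabor_Parseval[OF lc assms(10) \<Lambda> assms(5,8) K(1) sep E1 E2 E3 E4 that])
  qed
  \<comment> \<open>The squared norms of the \<open>g n\<close> add up to the lattice size by
    countable additivity over the pieces. In \<open>ennreal\<close> the bound on all partial sums
    gives the bound on the total, including its finiteness.\<close>
  have "lattice_size \<mu> \<nu> S\<^sub>\<Lambda> S\<^sub>\<Gamma> = (\<Sum>n. emeasure \<mu> (E n)) * ennreal ?s"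
    unfolding lattice_size_def s(2)[symmetric] E4[symmetric]
    using E1 E3 by (subst suminf_emeasure) (auto simp: sets_\<mu>)
  also have "\<dots> = (\<Sum>n. ennreal ((L2_norm \<mu> (g n))\<^sup>2))"
    unfolding norm_g using finE s(1)
    by (subst ennreal_suminf_multc[symmetric])
      (auto simp: emeasure_eq_ennreal_measure ennreal_mult mult.commute less_top)
  also have "\<dots> = (SUP m. \<Sum>n<m. ennreal ((L2_norm \<mu> (g n))\<^sup>2))"
    by (rule suminf_eq_SUP)
  also have "\<dots> \<le> 1"
  proof (rule SUP_least)
    fix m :: nat
    have "(\<Sum>n<m. ennreal ((L2_norm \<mu> (g n))\<^sup>2)) = ennreal (\<Sum>n<m. (L2_norm \<mu> (g n))\<^sup>2)"
      by (rule sum_ennreal) simp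
    also have "\<dots> \<le> ennreal 1" by (rule ennreal_leI[OF bound])
    finally show "(\<Sum>n<m. ennreal ((L2_norm \<mu> (g n))\<^sup>2)) \<le> 1" by simp
  qed
  finally show ?thesis .
qed

end
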